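(* Let $A$ be a connected cdga with $A^1$ finite-dimensional, let $\mathfrak{g}$ be a finite-dimensional Lie algebra, and let $\theta\colon\mathfrak{g}\to\mathfrak{gl}(V)$ be a representation with $V$ finite-dimensional. Let $A_1=(A^1)^*$ and let $\mathfrak{h}(A)$ be the holonomy Lie algebra of $A$. The natural linear isomorphism $\psi\colon A^1\otimes\mathfrak{g}\cong\operatorname{Hom}(A_1,\mathfrak{g})$ restricts to an isomorphism $\psi\colon\mathcal{F}(A,\mathfrak{g})\cong\operatorname{Hom}_{\mathrm{Lie}}(\mathfrak{h}(A),\mathfrak{g})$, and induces isomorphisms $\mathcal{R}^i_r(A,\theta)\cong\mathcal{R}^i_r(\mathfrak{h}(A),\theta)$, for $i\le 1$ and $r\ge 0$. Furthermore, if $A=\mathcal{C}^\bullet(\mathfrak{f})$, where $\mathfrak{f}$ is a Lie algebra of finite dimension, then $\mathfrak{h}(A)=\mathfrak{f}$, and $\psi$ induces isomorphisms $\mathcal{R}^i_r(A,\theta)\cong\mathcal{R}^i_r(\mathfrak{f},\theta)$, for all $i,r\ge 0$.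
   Context: Everything is over $\mathbb{C}$. A cdga is a (graded-)commutative, non-negatively graded differential graded algebra $A=(A^\bullet,d)$; it is connected if $A^0=\mathbb{C}\cdot 1$. Flat connections: $A\otimes\mathfrak{g}$ has bracket $[\alpha\otimes x,\beta\otimes y]=\alpha\beta\otimes[x,y]$ and differential $\partial(\alpha\otimes x)=d\alpha\otimes x$; $\mathcal{F}(A,\mathfrak{g})=\{\omega\in A^1\otimes\mathfrak{g}\mid\partial\omega+\frac12[\omega,\omega]=0\}$. For $\omega=\sum_i\eta_i\otimes g_i\in\mathcal{F}(A,\mathfrak{g})$, $d_\omega(\alpha\otimes v)=d\alpha\otimes v+\sum_i\eta_i\alpha\otimes\theta(g_i)v$ is a differential on $A\otimes V$, and $\mathcal{R}^i_r(A,\theta)=\{\omega\in\mathcal{F}(A,\mathfrak{g})\mid\dim_{\mathbb{C}}H^i(A\otimes V,d_\omega)\ge r\}$. Holonomy Lie algebra: put $A_i=(A^i)^*$ and let $\mathbf{L}(A_1)$ be the free Lie algebra on $A_1$, graded by bracket length, with $\mathbf{L}^1(A_1)=A_1$ and $\mathbf{L}^2(A_1)=A_1\wedge A_1$ via $[u,v]\leftrightarrow u\wedge v$. Let $d^*\colon A_2\to A_1$ and $\cup^*\colon A_2\to A_1\wedge A_1$ be the duals of the differential $d\colon A^1\to A^2$ and of the product $\cup\colon A^1\wedge A^1\to A^2$. Then $\mathfrak{h}(A)=\mathbf{L}(A_1)/\mathrm{ideal}(\operatorname{im}(d^*+\cup^* ))$. Since $A_1$ generates $\mathfrak{h}(A)$,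 restriction to $A_1$ gives an inclusion $\operatorname{Hom}_{\mathrm{Lie}}(\mathfrak{h}(A),\mathfrak{g})\subseteq\operatorname{Hom}(A_1,\mathfrak{g})$. The map $\psi$ is given by $\psi(\eta\otimes g)(u^* )=\langle\eta,u^*\rangle g$. Lie algebra resonance: for a Lie algebra $\mathfrak{h}$, $\mathcal{R}^i_r(\mathfrak{h},\theta)=\{\rho\in\operatorname{Hom}_{\mathrm{Lie}}(\mathfrak{h},\mathfrak{g})\mid\dim_{\mathbb{C}}H^i(\mathfrak{h},V_{\theta\circ\rho})\ge r\}$, where $V_{\theta\circ\rho}$ is the $\mathfrak{h}$-module $V$ with structure map $\theta\circ\rho$. Chevalley–Eilenberg algebra: for a finite-dimensional Lie algebra $\mathfrak{f}$, $\mathcal{C}^\bullet(\mathfrak{f})=(\bigwedge^\bullet\mathfrak{f}^*,d)$, with $d\colon\mathfrak{f}^*\to\mathfrak{f}^*\wedge\mathfrak{f}^*$ equal to minus the dual of the Lie bracket, extended by the graded Leibniz rule. In this case $A_1=\mathfrak{f}$, and the equality $\mathfrak{h}(A)=\mathfrak{f}$ means that the identity of $A_1=\mathfrak{f}$ induces an isomorphism of Lie algebras. *)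

theory Defs
  imports
    Complex_Main
    "HOL-Library.Function_Algebras"
    "HOL-Library.Poly_Mapping"
    "HOL-Library.Extended_Nat"
begin

section \<open>Complex vector spaces\<close>

text \<open>A finite-dimensional Lie algebra or module is a whole type of the following class;
  graded pieces, duals, spaces of homomorphisms and cochains are subspaces of such types.\<close>

class complex_vector = ab_group_add +
  fixes scaleC :: "complex \<Rightarrow> 'a \<Rightarrow> 'a" (infixr \<open>*\<^sub>C\<close> 75)
  assumes scaleC_add_right: "c *\<^sub>C (x + y) = c *\<^sub>C x + c *\<^sub>C y"
    and scaleC_add_left: "(c + d) *\<^sub>C x = c *\<^sub>C x + d *\<^sub>C x"
    and scaleC_scaleC: "c *\<^sub>C d *\<^sub>C x = (c * d) *\<^sub>C x"
    and scaleC_one: "1 *\<^sub>C x = x"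

global_interpretation cvs: vector_space "scaleC :: complex \<Rightarrow> 'a \<Rightarrow> 'a::complex_vector"
  defines csubspace = cvs.subspace
    and cspan = cvs.span
  by standard (simp_all add: scaleC_add_right scaleC_add_left scaleC_scaleC scaleC_one)

instantiation complex :: complex_vector
begin

definition scaleC_complex :: "complex \<Rightarrow> complex \<Rightarrow> complex" where
  "scaleC_complex c x = c * x"

instance by standard (simp_all add: scaleC_complex_def algebra_simps)

end

instantiation "fun" :: (type, complex_vector) complex_vector
begin

definition scaleC_fun :: "complex \<Rightarrow> ('a \<Rightarrow> 'b) \<Rightarrow> 'a \<Rightarrow> 'b" where
  "scaleC_fun c f = (\<lambda>x. c *\<^sub>C f x)"

instance by standard (simp_all add: scaleC_fun_def fun_eq_iff
    scaleC_add_right scaleC_add_left scaleC_scaleC scaleC_one)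

end

instantiation poly_mapping :: (type, complex_vector) complex_vector
begin

lift_definition scaleC_poly_mapping :: "complex \<Rightarrow> ('a \<Rightarrow>\<^sub>0 'b) \<Rightarrow> 'a \<Rightarrow>\<^sub>0 'b" is
  "\<lambda>c f x. c *\<^sub>C f x"
proof -
  fix c :: complex and f :: "'a \<Rightarrow> 'b"
  assume "finite {x. f x \<noteq> 0}"
  then show "finite {x. c *\<^sub>C f x \<noteq> 0}"
    by (rule rev_finite_subset) auto
qed

instance by (standard; transfer; simp add: fun_eq_iff
    scaleC_add_right scaleC_add_left scaleC_scaleC scaleC_one)

end

definition fin_dim :: "'a::complex_vector set \<Rightarrow> bool" where
  "fin_dim W \<longleftrightarrow> (\<exists>B. finite B \<and> W = cspan B)"

definition linear_on :: "'a::complex_vector set \<Rightarrow> ('a \<Rightarrow> 'b::complex_vector) \<Rightarrow> bool" where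
  "linear_on W f \<longleftrightarrow>
     (\<forall>x\<in>W. \<forall>y\<in>W. f (x + y) = f x + f y) \<and> (\<forall>c. \<forall>x\<in>W. f (c *\<^sub>C x) = c *\<^sub>C f x)"

definition bilinear_on ::
  "'a::complex_vector set \<Rightarrow> 'b::complex_vector set \<Rightarrow> ('a \<Rightarrow> 'b \<Rightarrow> 'c::complex_vector) \<Rightarrow> bool" where
  "bilinear_on W W' f \<longleftrightarrow>
     (\<forall>y\<in>W'. linear_on W (\<lambda>x. f x y)) \<and> (\<forall>x\<in>W. linear_on W' (f x))"

text \<open>\<open>Hom(W, U)\<close> for a subspace \<open>W\<close>: a linear map on \<open>W\<close> is represented by
  its extension by zero, so that equal maps are equal functions.\<close>

definition hom_space :: "'a::complex_vector set \<Rightarrow> ('a \<Rightarrow> 'b::complex_vector) set" where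
  "hom_space W = {f. linear_on W f \<and> (\<forall>x. x \<notin> W \<longrightarrow> f x = 0)}"

abbreviation dual_space :: "'a::complex_vector set \<Rightarrow> ('a \<Rightarrow> complex) set" where
  "dual_space W \<equiv> hom_space W"

text \<open>\<open>quotient_dim Z B\<close> is the dimension of \<open>Z / B\<close>: the supremum of the sizes of
  finite subsets of \<open>Z\<close> whose classes modulo \<open>B\<close> are linearly independent.\<close>

definition independent_mod :: "'a::complex_vector set \<Rightarrow> 'a set \<Rightarrow> bool" where
  "independent_mod B S \<longleftrightarrow>
     (\<forall>c. (\<Sum>v\<in>S. c v *\<^sub>C v) \<in> B \<longrightarrow> (\<forall>v\<in>S. c v = 0))"

definition quotient_dim :: "'a::complex_vector set \<Rightarrow> 'a set \<Rightarrow> enat" where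
  "quotient_dim Z B = (SUP S\<in>{S. finite S \<and> S \<subseteq> Z \<and> independent_mod B S}. enat (card S))"

definition cohomology_dim :: "(nat \<Rightarrow> 'a::complex_vector set) \<Rightarrow> ('a \<Rightarrow> 'a) \<Rightarrow> nat \<Rightarrow> enat" where
  "cohomology_dim C d i =
     quotient_dim {x \<in> C i. d x = 0} (case i of 0 \<Rightarrow> {0} | Suc j \<Rightarrow> d ` C j)"


section \<open>Tensor products\<close>

definition tensor_relations ::
  "(('a::complex_vector \<times> 'b::complex_vector) \<Rightarrow>\<^sub>0 complex) set" where
  "tensor_relations =
     {Poly_Mapping.single (a + a', b) 1 - Poly_Mapping.single (a, b) 1
        - Poly_Mapping.single (a', b) 1 | a a' b. True} \<union>
     {Poly_Mapping.single (a, b + b') 1 - Poly_Mapping.single (a, b) 1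
        - Poly_Mapping.single (a, b') 1 | a b b'. True} \<union>
     {Poly_Mapping.single (c *\<^sub>C a, b) 1 - c *\<^sub>C Poly_Mapping.single (a, b) 1 | c a b. True} \<union>
     {Poly_Mapping.single (a, c *\<^sub>C b) 1 - c *\<^sub>C Poly_Mapping.single (a, b) 1 | c a b. True}"

definition tensor_rel ::
  "(('a::complex_vector \<times> 'b::complex_vector) \<Rightarrow>\<^sub>0 complex) \<Rightarrow> (('a \<times> 'b) \<Rightarrow>\<^sub>0 complex) \<Rightarrow> bool" where
  "tensor_rel f g \<longleftrightarrow> f - g \<in> cspan tensor_relations"

quotient_type (overloaded) ('a, 'b) tensor =
  "('a::complex_vector \<times> 'b::complex_vector) \<Rightarrow>\<^sub>0 complex" / tensor_rel
proof (rule equivpI)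
  show "reflp tensor_rel"
    by (simp add: reflp_def tensor_rel_def cvs.span_zero)
  show "symp tensor_rel"
    unfolding symp_def tensor_rel_def using cvs.span_neg by fastforce
  show "transp tensor_rel"
    unfolding transp_def tensor_rel_def using cvs.span_add by fastforce
qed

instantiation tensor :: (complex_vector, complex_vector) complex_vector
begin

lift_definition zero_tensor :: "('a, 'b) tensor" is 0 .

lift_definition plus_tensor :: "('a, 'b) tensor \<Rightarrow> ('a, 'b) tensor \<Rightarrow> ('a, 'b) tensor" is "(+)"
proof -
  fix f f' g g' :: "('a \<times> 'b) \<Rightarrow>\<^sub>0 complex"
  assume "tensor_rel f f'" "tensor_rel g g'"
  then have "(f - f') + (g - g') \<in> cspan tensor_relations"
    unfolding tensor_rel_def by (rule cvs.span_add)
  then show "tensor_rel (f + g) (f' + g')"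
    unfolding tensor_rel_def by (simp add: algebra_simps)
qed

lift_definition minus_tensor :: "('a, 'b) tensor \<Rightarrow> ('a, 'b) tensor \<Rightarrow> ('a, 'b) tensor" is "(-)"
proof -
  fix f f' g g' :: "('a \<times> 'b) \<Rightarrow>\<^sub>0 complex"
  assume "tensor_rel f f'" "tensor_rel g g'"
  then have "(f - f') - (g - g') \<in> cspan tensor_relations"
    unfolding tensor_rel_def by (rule cvs.span_diff)
  then show "tensor_rel (f - g) (f' - g')"
    unfolding tensor_rel_def by (simp add: algebra_simps)
qed

lift_definition uminus_tensor :: "('a, 'b) tensor \<Rightarrow> ('a, 'b) tensor" is uminus
proof -
  fix f f' :: "('a \<times> 'b) \<Rightarrow>\<^sub>0 complex"
  assume "tensor_rel f f'"
  then have "- (f - f') \<in> cspan tensor_relations"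
    unfolding tensor_rel_def by (rule cvs.span_neg)
  then show "tensor_rel (- f) (- f')"
    unfolding tensor_rel_def by (simp add: algebra_simps)
qed

lift_definition scaleC_tensor :: "complex \<Rightarrow> ('a, 'b) tensor \<Rightarrow> ('a, 'b) tensor" is scaleC
proof -
  fix c and f f' :: "('a \<times> 'b) \<Rightarrow>\<^sub>0 complex"
  assume "tensor_rel f f'"
  then have "c *\<^sub>C (f - f') \<in> cspan tensor_relations"
    unfolding tensor_rel_def by (rule cvs.span_scale)
  then show "tensor_rel (c *\<^sub>C f) (c *\<^sub>C f')"
    unfolding tensor_rel_def by (simp add: cvs.scale_right_diff_distrib)
qed

instance
  by (standard; transfer; simp add: tensor_rel_def cvs.span_zero add.assoc add.commute
      cvs.scale_right_distrib cvs.scale_left_distrib)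

end

lift_definition pure_tensor ::
  "'a::complex_vector \<Rightarrow> 'b::complex_vector \<Rightarrow> ('a, 'b) tensor" (infix \<open>\<otimes>\<close> 76)
  is "\<lambda>a b. Poly_Mapping.single (a, b) 1" .

text \<open>For a subspace \<open>W\<close> of the left factor, \<open>W \<otimes> V\<close> is regarded as a
  subspace of the tensor product of the ambient types (tensoring is exact over a field).\<close>

definition tensor_space :: "'a::complex_vector set \<Rightarrow> ('a, 'b::complex_vector) tensor set" where
  "tensor_space W = cspan {a \<otimes> b | a b. a \<in> W}"

text \<open>The linear map on \<open>W \<otimes> V\<close> induced by a bilinear map on \<open>W \<times> V\<close>,
  extended by zero.\<close>

definition tensor_lift :: "'a::complex_vector set \<Rightarrow> ('a \<Rightarrow> 'b::complex_vector \<Rightarrow> 'c::complex_vector)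
    \<Rightarrow> ('a, 'b) tensor \<Rightarrow> 'c" where
  "tensor_lift W \<beta> = (THE h. h \<in> hom_space (tensor_space W) \<and> (\<forall>a\<in>W. \<forall>b. h (a \<otimes> b) = \<beta> a b))"


section \<open>Commutative differential graded algebras\<close>

record 'a cdga =
  grade :: "nat \<Rightarrow> 'a set"
  mult :: "'a \<Rightarrow> 'a \<Rightarrow> 'a"
  unit :: "'a"
  diff :: "'a \<Rightarrow> 'a"

definition total_space :: "'a::complex_vector cdga \<Rightarrow> 'a set" where
  "total_space A = cspan (\<Union>i. grade A i)"

locale cdga =
  fixes A :: "'a::complex_vector cdga"
  assumes subspace_grade: "csubspace (grade A i)"
    and grade_direct: "(\<And>i. i \<le> n \<Longrightarrow> x i \<in> grade A i) \<Longrightarrow> (\<Sum>i\<le>n. x i) = 0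
          \<Longrightarrow> i \<le> n \<Longrightarrow> x i = 0"
    and bilinear_mult: "bilinear_on (total_space A) (total_space A) (mult A)"
    and mult_grade: "a \<in> grade A i \<Longrightarrow> b \<in> grade A j \<Longrightarrow> mult A a b \<in> grade A (i + j)"
    and unit_grade: "unit A \<in> grade A 0"
    and unit_left: "a \<in> grade A i \<Longrightarrow> mult A (unit A) a = a"
    and unit_right: "a \<in> grade A i \<Longrightarrow> mult A a (unit A) = a"
    and mult_assoc: "a \<in> grade A i \<Longrightarrow> b \<in> grade A j \<Longrightarrow> c \<in> grade A k
          \<Longrightarrow> mult A (mult A a b) c = mult A a (mult A b c)"
    and mult_commute: "a \<in> grade A i \<Longrightarrow> b \<in> grade A j
          \<Longrightarrow> mult A a b = (- 1) ^ (i * j) *\<^sub>C mult A b a"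
    and linear_diff: "linear_on (total_space A) (diff A)"
    and diff_grade: "a \<in> grade A i \<Longrightarrow> diff A a \<in> grade A (Suc i)"
    and diff_diff: "a \<in> grade A i \<Longrightarrow> diff A (diff A a) = 0"
    and leibniz: "a \<in> grade A i \<Longrightarrow> b \<in> grade A j
          \<Longrightarrow> diff A (mult A a b) = mult A (diff A a) b + (- 1) ^ i *\<^sub>C mult A a (diff A b)"

locale connected_cdga = cdga +
  assumes connected: "grade A 0 = cspan {unit A}"
    and unit_nonzero: "unit A \<noteq> 0"


section \<open>Lie algebras\<close>

text \<open>Finite-dimensional Lie algebras are given by a bracket on a type. The
  record covers also those whose elements are classes modulo an ideal, such as the
  holonomy Lie algebra; it is used without the Lie axioms for the free nonassociative algebra.\<close>

record 'a lie =
  carrier :: "'a set"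
  add :: "'a \<Rightarrow> 'a \<Rightarrow> 'a"
  smult :: "complex \<Rightarrow> 'a \<Rightarrow> 'a"
  bracket :: "'a \<Rightarrow> 'a \<Rightarrow> 'a"

definition lie_bracket :: "('g::complex_vector \<Rightarrow> 'g \<Rightarrow> 'g) \<Rightarrow> bool" where
  "lie_bracket br \<longleftrightarrow> bilinear_on UNIV UNIV br \<and> (\<forall>x. br x x = 0) \<and>
     (\<forall>x y z. br x (br y z) + br y (br z x) + br z (br x y) = 0)"

definition lie_of :: "('g::complex_vector \<Rightarrow> 'g \<Rightarrow> 'g) \<Rightarrow> 'g lie" where
  "lie_of br = \<lparr>carrier = UNIV, add = (+), smult = scaleC, bracket = br\<rparr>"

definition representation ::
  "('g::complex_vector \<Rightarrow> 'g \<Rightarrow> 'g) \<Rightarrow> ('g \<Rightarrow> 'v::complex_vector \<Rightarrow> 'v) \<Rightarrow> bool" where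
  "representation br \<theta> \<longleftrightarrow> bilinear_on UNIV UNIV \<theta> \<and>
     (\<forall>x y v. \<theta> (br x y) v = \<theta> x (\<theta> y v) - \<theta> y (\<theta> x v))"

definition lie_hom :: "'h lie \<Rightarrow> 'k lie \<Rightarrow> ('h \<Rightarrow> 'k) \<Rightarrow> bool" where
  "lie_hom L M \<rho> \<longleftrightarrow>
     (\<forall>x\<in>carrier L. \<rho> x \<in> carrier M) \<and>
     (\<forall>x\<in>carrier L. \<forall>y\<in>carrier L. \<rho> (add L x y) = add M (\<rho> x) (\<rho> y)) \<and>
     (\<forall>c. \<forall>x\<in>carrier L. \<rho> (smult L c x) = smult M c (\<rho> x)) \<and>
     (\<forall>x\<in>carrier L. \<forall>y\<in>carrier L. \<rho> (bracket L x y) = bracket M (\<rho> x) (\<rho> y))"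

definition lie_iso :: "'h lie \<Rightarrow> 'k lie \<Rightarrow> ('h \<Rightarrow> 'k) \<Rightarrow> bool" where
  "lie_iso L M \<rho> \<longleftrightarrow> lie_hom L M \<rho> \<and> bij_betw \<rho> (carrier L) (carrier M)"

definition Hom_Lie :: "'h lie \<Rightarrow> ('g::complex_vector \<Rightarrow> 'g \<Rightarrow> 'g) \<Rightarrow> ('h \<Rightarrow> 'g) set" where
  "Hom_Lie L br = {\<rho>. lie_hom L (lie_of br) \<rho> \<and> (\<forall>x. x \<notin> carrier L \<longrightarrow> \<rho> x = 0)}"

definition lie_ideal :: "'h lie \<Rightarrow> 'h set \<Rightarrow> bool" where
  "lie_ideal L I \<longleftrightarrow> I \<subseteq> carrier L \<and> I \<noteq> {} \<and>
     (\<forall>x\<in>I. \<forall>y\<in>I. add L x y \<in> I) \<and> (\<forall>c. \<forall>x\<in>I. smult L c x \<in> I) \<and>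
     (\<forall>x\<in>I. \<forall>y\<in>carrier L. bracket L x y \<in> I \<and> bracket L y x \<in> I)"

definition ideal_generated :: "'h lie \<Rightarrow> 'h set \<Rightarrow> 'h set" where
  "ideal_generated L S = \<Inter>{I. lie_ideal L I \<and> S \<subseteq> I}"

definition coset :: "'h lie \<Rightarrow> 'h set \<Rightarrow> 'h \<Rightarrow> 'h set" where
  "coset L I x = {add L x i | i. i \<in> I}"

definition quotient_lie :: "'h lie \<Rightarrow> 'h set \<Rightarrow> 'h set lie" where
  "quotient_lie L I =
     \<lparr>carrier = coset L I ` carrier L,
      add = (\<lambda>X Y. {add L x y | x y. x \<in> X \<and> y \<in> Y}),
      smult = (\<lambda>c X. {add L (smult L c x) i | x i. x \<in> X \<and> i \<in> I}),
      bracket = (\<lambda>X Y. {add L (bracket L x y) i | x y i. x \<in> X \<and> y \<in> Y \<and> i \<in> I})\<rparr>"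


section \<open>Free Lie algebras\<close>

datatype (leaves: 'x) magma = Leaf 'x | Node "'x magma" "'x magma"

definition magma_mult :: "('x magma \<Rightarrow>\<^sub>0 complex) \<Rightarrow> ('x magma \<Rightarrow>\<^sub>0 complex) \<Rightarrow> ('x magma \<Rightarrow>\<^sub>0 complex)"
  where
  "magma_mult f g = (\<Sum>s\<in>Poly_Mapping.keys f. \<Sum>t\<in>Poly_Mapping.keys g.
     Poly_Mapping.single (Node s t) (Poly_Mapping.lookup f s * Poly_Mapping.lookup g t))"

definition magma_algebra :: "'w set \<Rightarrow> ('w magma \<Rightarrow>\<^sub>0 complex) lie" where
  "magma_algebra W =
     \<lparr>carrier = {f. \<forall>t\<in>Poly_Mapping.keys f. leaves t \<subseteq> W},
      add = (+), smult = scaleC, bracket = magma_mult\<rparr>"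

definition leaf :: "'w \<Rightarrow> 'w magma \<Rightarrow>\<^sub>0 complex" where
  "leaf u = Poly_Mapping.single (Leaf u) 1"

definition free_lie_relations :: "'w::complex_vector set \<Rightarrow> ('w magma \<Rightarrow>\<^sub>0 complex) set" where
  "free_lie_relations W =
     {leaf (u + v) - leaf u - leaf v | u v. u \<in> W \<and> v \<in> W} \<union>
     {leaf (c *\<^sub>C u) - c *\<^sub>C leaf u | c u. u \<in> W} \<union>
     {magma_mult f f | f. f \<in> carrier (magma_algebra W)} \<union>
     {magma_mult f (magma_mult g h) + magma_mult g (magma_mult h f) + magma_mult h (magma_mult f g)
        | f g h. f \<in> carrier (magma_algebra W) \<and> g \<in> carrier (magma_algebra W)
            \<and> h \<in> carrier (magma_algebra W)}"

definition free_lie_ideal :: "'w::complex_vector set \<Rightarrow> ('w magma \<Rightarrow>\<^sub>0 complex) set" where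
  "free_lie_ideal W = ideal_generated (magma_algebra W) (free_lie_relations W)"

text \<open>The free Lie algebra on the vector space \<open>W\<close>, with the inclusion
  \<open>free_lie_gen W\<close> of \<open>W\<close> as the part of bracket length one.\<close>

definition free_lie :: "'w::complex_vector set \<Rightarrow> ('w magma \<Rightarrow>\<^sub>0 complex) set lie" where
  "free_lie W = quotient_lie (magma_algebra W) (free_lie_ideal W)"

definition free_lie_gen :: "'w::complex_vector set \<Rightarrow> 'w \<Rightarrow> ('w magma \<Rightarrow>\<^sub>0 complex) set" where
  "free_lie_gen W u = coset (magma_algebra W) (free_lie_ideal W) (leaf u)"


section \<open>The holonomy Lie algebra\<close>

definition diff_dual :: "'a::complex_vector cdga \<Rightarrow> ('a \<Rightarrow> complex) \<Rightarrow> ('a \<Rightarrow> complex)" where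
  "diff_dual A \<phi> = (\<lambda>a. if a \<in> grade A 1 then \<phi> (diff A a) else 0)"

text \<open>As \<open>A\<^sup>1\<close> is finite-dimensional, the dual of its exterior square is identified
  with the exterior square of \<open>A\<^sub>1\<close> by
  \<open>\<langle>u \<and> v, a \<and> b\<rangle> = u(a) v(b) - u(b) v(a)\<close>; a functional on the
  exterior square of \<open>A\<^sup>1\<close> is written as an alternating bilinear form.\<close>

definition cup_dual :: "'a::complex_vector cdga \<Rightarrow> ('a \<Rightarrow> complex) \<Rightarrow> ('a \<Rightarrow> 'a \<Rightarrow> complex)" where
  "cup_dual A \<phi> = (\<lambda>a b. if a \<in> grade A 1 \<and> b \<in> grade A 1 then \<phi> (mult A a b) else 0)"

definition wedge2 :: "('a \<Rightarrow> complex) \<Rightarrow> ('a \<Rightarrow> complex) \<Rightarrow> ('a \<Rightarrow> 'a \<Rightarrow> complex)" where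
  "wedge2 u v = (\<lambda>a b. u a * v b - u b * v a)"

text \<open>The elements \<open>d\<^sup>*(\<phi>) + \<union>\<^sup>*(\<phi>)\<close> of the free Lie algebra:
  writing \<open>\<union>\<^sup>*(\<phi>)\<close> as a sum of terms \<open>u \<and> v\<close>, the
  second summand is the corresponding sum of brackets \<open>[u, v]\<close>.\<close>

definition holonomy_relators ::
  "'a::complex_vector cdga \<Rightarrow> (('a \<Rightarrow> complex) magma \<Rightarrow>\<^sub>0 complex) set set" where
  "holonomy_relators A =
     (let A1 = dual_space (grade A 1); L = free_lie A1; \<iota> = free_lie_gen A1
      in {foldr (\<lambda>(u, v) x. add L (bracket L (\<iota> u) (\<iota> v)) x) ps (\<iota> (diff_dual A \<phi>)) | ps \<phi>.
            \<phi> \<in> dual_space (grade A 2) \<and> set ps \<subseteq> A1 \<times> A1 \<and>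
            cup_dual A \<phi> = (\<Sum>(u, v)\<leftarrow>ps. wedge2 u v)})"

definition holonomy_ideal ::
  "'a::complex_vector cdga \<Rightarrow> (('a \<Rightarrow> complex) magma \<Rightarrow>\<^sub>0 complex) set set" where
  "holonomy_ideal A = ideal_generated (free_lie (dual_space (grade A 1))) (holonomy_relators A)"

definition holonomy ::
  "'a::complex_vector cdga \<Rightarrow> (('a \<Rightarrow> complex) magma \<Rightarrow>\<^sub>0 complex) set set lie" where
  "holonomy A = quotient_lie (free_lie (dual_space (grade A 1))) (holonomy_ideal A)"

definition holonomy_gen ::
  "'a::complex_vector cdga \<Rightarrow> ('a \<Rightarrow> complex) \<Rightarrow> (('a \<Rightarrow> complex) magma \<Rightarrow>\<^sub>0 complex) set set" where
  "holonomy_gen A u = coset (free_lie (dual_space (grade A 1))) (holonomy_ideal A)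
     (free_lie_gen (dual_space (grade A 1)) u)"

definition restrict_gen :: "'a::complex_vector cdga
    \<Rightarrow> ((('a \<Rightarrow> complex) magma \<Rightarrow>\<^sub>0 complex) set set \<Rightarrow> 'g::complex_vector) \<Rightarrow> (('a \<Rightarrow> complex) \<Rightarrow> 'g)"
  where
  "restrict_gen A \<rho> = (\<lambda>u. if u \<in> dual_space (grade A 1) then \<rho> (holonomy_gen A u) else 0)"


section \<open>Flat connections and resonance of a cdga\<close>

definition tensor_diff ::
  "'a::complex_vector cdga \<Rightarrow> ('a, 'v::complex_vector) tensor \<Rightarrow> ('a, 'v) tensor" where
  "tensor_diff A = tensor_lift (total_space A) (\<lambda>\<alpha> v. diff A \<alpha> \<otimes> v)"

text \<open>The bilinear map with \<open>(\<eta> \<otimes> x, \<alpha> \<otimes> v) \<mapsto> \<eta>\<alpha> \<otimes> m x v\<close>.\<close>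

definition tensor_mult :: "'a::complex_vector cdga
    \<Rightarrow> ('g::complex_vector \<Rightarrow> 'v::complex_vector \<Rightarrow> 'w::complex_vector)
    \<Rightarrow> ('a, 'g) tensor \<Rightarrow> ('a, 'v) tensor \<Rightarrow> ('a, 'w) tensor" where
  "tensor_mult A m \<omega> t =
     tensor_lift (total_space A) (\<lambda>\<eta> x. tensor_lift (total_space A) (\<lambda>\<alpha> v. mult A \<eta> \<alpha> \<otimes> m x v) t) \<omega>"

definition flat_connections ::
  "'a::complex_vector cdga \<Rightarrow> ('g::complex_vector \<Rightarrow> 'g \<Rightarrow> 'g) \<Rightarrow> ('a, 'g) tensor set" where
  "flat_connections A br =
     {\<omega> \<in> tensor_space (grade A 1). tensor_diff A \<omega> + (1 / 2) *\<^sub>C tensor_mult A br \<omega> \<omega> = 0}"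

definition twisted_diff :: "'a::complex_vector cdga \<Rightarrow> ('g::complex_vector \<Rightarrow> 'v::complex_vector \<Rightarrow> 'v)
    \<Rightarrow> ('a, 'g) tensor \<Rightarrow> ('a, 'v) tensor \<Rightarrow> ('a, 'v) tensor" where
  "twisted_diff A \<theta> \<omega> t = tensor_diff A t + tensor_mult A \<theta> \<omega> t"

definition resonance_cdga :: "'a::complex_vector cdga \<Rightarrow> ('g::complex_vector \<Rightarrow> 'g \<Rightarrow> 'g)
    \<Rightarrow> ('g \<Rightarrow> 'v::complex_vector \<Rightarrow> 'v) \<Rightarrow> nat \<Rightarrow> nat \<Rightarrow> ('a, 'g) tensor set" where
  "resonance_cdga A br \<theta> i r =
     {\<omega> \<in> flat_connections A br.
        enat r \<le> cohomology_dim (\<lambda>j. tensor_space (grade A j)) (twisted_diff A \<theta> \<omega>) i}"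

definition psi :: "'a::complex_vector cdga \<Rightarrow> ('a, 'g::complex_vector) tensor \<Rightarrow> (('a \<Rightarrow> complex) \<Rightarrow> 'g)"
  where
  "psi A \<omega> = (\<lambda>u. if u \<in> dual_space (grade A 1)
     then tensor_lift (grade A 1) (\<lambda>\<eta> g. u \<eta> *\<^sub>C g) \<omega> else 0)"


section \<open>Cohomology and resonance of a Lie algebra\<close>

text \<open>Cohomology of a Lie algebra with coefficients in a module is computed by the
  Chevalley-Eilenberg complex of alternating multilinear maps, a map of \<open>n\<close> arguments being
  a function on lists that vanishes except on lists of length \<open>n\<close> over the carrier.\<close>

definition ce_cochains :: "'h lie \<Rightarrow> nat \<Rightarrow> ('h list \<Rightarrow> 'v::complex_vector) set" where
  "ce_cochains L n = {c.
     (\<forall>xs. \<not> (length xs = n \<and> set xs \<subseteq> carrier L) \<longrightarrow> c xs = 0) \<and>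
     (\<forall>us x y vs. set us \<union> {x, y} \<union> set vs \<subseteq> carrier L \<longrightarrow>
        c (us @ add L x y # vs) = c (us @ x # vs) + c (us @ y # vs)) \<and>
     (\<forall>us k x vs. set us \<union> {x} \<union> set vs \<subseteq> carrier L \<longrightarrow>
        c (us @ smult L k x # vs) = k *\<^sub>C c (us @ x # vs)) \<and>
     (\<forall>xs. set xs \<subseteq> carrier L \<and> \<not> distinct xs \<longrightarrow> c xs = 0)}"

definition omit :: "nat \<Rightarrow> 'h list \<Rightarrow> 'h list" where
  "omit i xs = take i xs @ drop (Suc i) xs"

definition ce_diff :: "'h lie \<Rightarrow> ('h \<Rightarrow> 'v \<Rightarrow> 'v) \<Rightarrow> ('h list \<Rightarrow> 'v::complex_vector) \<Rightarrow> 'h list \<Rightarrow> 'v"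
  where
  "ce_diff L act c xs =
     (if set xs \<subseteq> carrier L then
        (\<Sum>i<length xs. (- 1) ^ i *\<^sub>C act (xs ! i) (c (omit i xs))) +
        (\<Sum>j<length xs. \<Sum>i<j.
           (- 1) ^ (i + j) *\<^sub>C c (bracket L (xs ! i) (xs ! j) # omit i (omit j xs)))
      else 0)"

definition resonance_lie :: "'h lie \<Rightarrow> ('g::complex_vector \<Rightarrow> 'g \<Rightarrow> 'g)
    \<Rightarrow> ('g \<Rightarrow> 'v::complex_vector \<Rightarrow> 'v) \<Rightarrow> nat \<Rightarrow> nat \<Rightarrow> ('h \<Rightarrow> 'g) set" where
  "resonance_lie L br \<theta> i r =
     {\<rho> \<in> Hom_Lie L br.
        enat r \<le> cohomology_dim (ce_cochains L) (ce_diff L (\<lambda>x. \<theta> (\<rho> x))) i}"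


section \<open>The Chevalley-Eilenberg algebra\<close>

text \<open>The exterior algebra of the dual of \<open>\<ff>\<close> is realised by alternating forms on
  \<open>\<ff>\<close>; the product is the sum over shuffles, with \<open>S\<close> the set of positions
  of the arguments of the first factor and the sign given by the number of inversions.\<close>

definition wedge :: "('f list \<Rightarrow> complex) \<Rightarrow> ('f list \<Rightarrow> complex) \<Rightarrow> ('f list \<Rightarrow> complex)" where
  "wedge \<alpha> \<beta> xs = (\<Sum>S\<in>Pow {..<length xs}.
     (- 1) ^ card {(i, j). i \<in> S \<and> j \<in> {..<length xs} - S \<and> j < i} *
       \<alpha> (nths xs S) * \<beta> (nths xs (- S)))"

definition CE_algebra ::
  "('f::complex_vector \<Rightarrow> 'f \<Rightarrow> 'f) \<Rightarrow> ('f list \<Rightarrow> complex) cdga" where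
  "CE_algebra br =
     \<lparr>grade = ce_cochains (lie_of br),
      mult = wedge,
      unit = (\<lambda>xs. if xs = [] then 1 else 0),
      diff = ce_diff (lie_of br) (\<lambda>_ _. 0)\<rparr>"

text \<open>The identification of \<open>\<ff>\<close> with \<open>A\<^sub>1\<close> for this algebra, by evaluation.\<close>

definition CE_eval :: "('f::complex_vector \<Rightarrow> 'f \<Rightarrow> 'f) \<Rightarrow> 'f \<Rightarrow> (('f list \<Rightarrow> complex) \<Rightarrow> complex)" where
  "CE_eval br x = (\<lambda>\<alpha>. if \<alpha> \<in> grade (CE_algebra br) 1 then \<alpha> [x] else 0)"

subsection \<open>The Chevalley-Eilenberg algebra is a connected cdga\<close>

text \<open>The explicit formula for the differential gives minus the dual of the bracket on
  \<open>\<ff>\<^sup>*\<close> (lemma \<open>diff_CE_algebra_1\<close>) and satisfies the graded Leibniz rule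
  (part of lemma \<open>connected_cdga_CE_algebra\<close>). The proofs are by recursion on the list of
  arguments, using the contraction by the first argument and Cartan's formula.\<close>

definition contract :: "'f \<Rightarrow> ('f list \<Rightarrow> complex) \<Rightarrow> ('f list \<Rightarrow> complex)" where
  "contract x c = (\<lambda>xs. c (x # xs))"

definition parity :: "('f list \<Rightarrow> complex) \<Rightarrow> ('f list \<Rightarrow> complex)" where
  "parity c = (\<lambda>xs. (- 1) ^ length xs * c xs)"

primrec lie_derivative ::
  "('f \<Rightarrow> 'f \<Rightarrow> 'f) \<Rightarrow> 'f \<Rightarrow> 'f list \<Rightarrow> ('f list \<Rightarrow> complex) \<Rightarrow> complex" where
  "lie_derivative br x [] c = 0"
| "lie_derivative br x (y # ys) c = lie_derivative br x ys (contract y c) - c (br x y # ys)"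

lemma contract_simps [simp]:
  "contract x (a + b) = contract x a + contract x b"
  "contract x (a - b) = contract x a - contract x b"
  "contract x (- a) = - contract x a"
  "contract x 0 = 0"
  "contract x (parity a) = - parity (contract x a)"
  by (simp_all add: contract_def parity_def fun_eq_iff)

lemma parity_simps [simp]:
  "parity (a + b) = parity a + parity b"
  "parity (a - b) = parity a - parity b"
  "parity (- a) = - parity a"
  "parity 0 = 0"
  "parity (parity a) = a"
  by (simp_all add: parity_def fun_eq_iff algebra_simps flip: mult.assoc power_add)

lemma wedge_simps [simp]:
  "wedge (a + a') b = wedge a b + wedge a' b"
  "wedge (a - a') b = wedge a b - wedge a' b"
  "wedge (- a) b = - wedge a b"
  "wedge 0 b = 0"
  "wedge a (b + b') = wedge a b + wedge a b'"
  "wedge a (b - b') = wedge a b - wedge a b'"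
  "wedge a (- b) = - wedge a b"
  "wedge a 0 = 0"
  by (simp_all add: wedge_def fun_eq_iff algebra_simps sum.distrib sum_subtractf sum_negf)

lemma wedge_scaleC [simp]:
  "wedge (k *\<^sub>C a) b = k *\<^sub>C wedge a b"
  "wedge a (k *\<^sub>C b) = k *\<^sub>C wedge a b"
  by (simp_all add: wedge_def fun_eq_iff scaleC_fun_def scaleC_complex_def sum_distrib_left
      mult_ac)

lemma wedge_Nil [simp]: "wedge a b [] = a [] * b []"
  by (simp add: wedge_def)

lemma Pow_lessThan_Suc:
  "Pow {..<Suc n} = (\<lambda>T. Suc ` T) ` Pow {..<n} \<union> (\<lambda>T. insert 0 (Suc ` T)) ` Pow {..<n}"
proof -
  have "Pow {..<Suc n} = Pow (insert 0 (Suc ` {..<n}))"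
    by (simp only: lessThan_Suc_eq_insert_0)
  also have "\<dots> = Pow (Suc ` {..<n}) \<union> insert 0 ` Pow (Suc ` {..<n})"
    by (rule Pow_insert)
  also have "Pow (Suc ` {..<n}) = (\<lambda>T. Suc ` T) ` Pow {..<n}"
    by (rule image_Pow_surj[OF refl, symmetric])
  finally show ?thesis
    by (simp add: image_image)
qed

definition inversions :: "nat \<Rightarrow> nat set \<Rightarrow> (nat \<times> nat) set" where
  "inversions n S = {(i, j). i \<in> S \<and> j \<in> {..<n} - S \<and> j < i}"

lemma finite_inversions: "finite S \<Longrightarrow> finite (inversions n S)"
  by (rule finite_subset[of _ "S \<times> {..<n}"]) (auto simp: inversions_def)

lemma card_inversions_insert:
  assumes "finite T"
  shows "card (inversions (Suc n) (insert 0 (Suc ` T))) = card (inversions n T)"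
proof -
  have "inversions (Suc n) (insert 0 (Suc ` T)) = map_prod Suc Suc ` inversions n T"
  proof (rule set_eqI)
    fix p show "p \<in> inversions (Suc n) (insert 0 (Suc ` T)) \<longleftrightarrow> p \<in> map_prod Suc Suc ` inversions n T"
      by (cases p; cases "snd p"; cases "fst p") (auto simp: inversions_def image_iff)
  qed
  moreover have "inj_on (map_prod Suc Suc) (inversions n T)"
    by (auto simp: inj_on_def)
  ultimately show ?thesis by (simp add: card_image)
qed

lemma card_inversions_Suc:
  assumes "finite T"
  shows "card (inversions (Suc n) (Suc ` T)) = card (inversions n T) + card T"
proof -
  have "inversions (Suc n) (Suc ` T) =
      map_prod Suc Suc ` inversions n T \<union> (\<lambda>i. (Suc i, 0)) ` T" (is "_ = ?A \<union> ?B")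
  proof (rule set_eqI)
    fix p show "p \<in> inversions (Suc n) (Suc ` T) \<longleftrightarrow> p \<in> ?A \<union> ?B"
      by (cases p; cases "snd p"; cases "fst p") (auto simp: inversions_def image_iff)
  qed
  moreover have "?A \<inter> ?B = {}" by auto
  moreover have "card ?A = card (inversions n T)" "card ?B = card T"
    by (auto intro!: card_image simp: inj_on_def)
  ultimately show ?thesis
    using assms by (simp add: card_Un_disjoint finite_inversions)
qed

lemma wedge_inversions:
  "wedge a b xs = (\<Sum>S\<in>Pow {..<length xs}.
     (- 1) ^ card (inversions (length xs) S) * a (nths xs S) * b (nths xs (- S)))"
  by (simp add: wedge_def inversions_def)

lemma wedge_Cons: "wedge a b (x # xs) = wedge (contract x a) b xs + wedge (parity a) (contract x b) xs"
proof -
  let ?n = "length xs"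
  let ?f = "\<lambda>S. (- 1) ^ card (inversions (Suc ?n) S) * a (nths (x # xs) S) * b (nths (x # xs) (- S))"
  have inj: "inj_on (\<lambda>T. Suc ` T) (Pow {..<?n})" "inj_on (\<lambda>T. insert 0 (Suc ` T)) (Pow {..<?n})"
    by (auto simp: inj_on_def inj_image_eq_iff insert_ident)
  have "wedge a b (x # xs) = sum ?f (Pow {..<Suc ?n})"
    by (simp add: wedge_inversions)
  also have "\<dots> = sum ?f ((\<lambda>T. insert 0 (Suc ` T)) ` Pow {..<?n})
      + sum ?f ((\<lambda>T. Suc ` T) ` Pow {..<?n})"
    unfolding Pow_lessThan_Suc by (subst sum.union_disjoint) auto
  also have "sum ?f ((\<lambda>T. insert 0 (Suc ` T)) ` Pow {..<?n}) = wedge (contract x a) b xs"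
  proof -
    have "?f (insert 0 (Suc ` T)) =
        (- 1) ^ card (inversions ?n T) * contract x a (nths xs T) * b (nths xs (- T))"
      if "T \<in> Pow {..<?n}" for T
    proof -
      have "{j. Suc j \<in> insert 0 (Suc ` T)} = T" "{j. Suc j \<in> - insert 0 (Suc ` T)} = - T"
        by auto
      moreover have "finite T" using that finite_subset by blast
      ultimately show ?thesis
        by (simp add: nths_Cons card_inversions_insert contract_def)
    qed
    then show ?thesis
      by (simp add: sum.reindex inj wedge_inversions)
  qed
  also have "sum ?f ((\<lambda>T. Suc ` T) ` Pow {..<?n}) = wedge (parity a) (contract x b) xs"
  proof -
    have "?f (Suc ` T) =
        (- 1) ^ card (inversions ?n T) * parity a (nths xs T) * contract x b (nths xs (- T))"
      if "T \<in> Pow {..<?n}" for T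
    proof -
      have "{j. Suc j \<in> Suc ` T} = T" "{j. Suc j \<in> - Suc ` T} = - T" "0 \<notin> Suc ` T"
        by auto
      moreover have "finite T" using that finite_subset by blast
      moreover have "{i. i < ?n \<and> i \<in> T} = T" using that by auto
      then have "length (nths xs T) = card T" by (simp add: length_nths)
      ultimately show ?thesis
        by (simp add: nths_Cons card_inversions_Suc contract_def parity_def power_add)
    qed
    then show ?thesis
      by (simp add: sum.reindex inj wedge_inversions)
  qed
  finally show ?thesis .
qed

lemma contract_wedge [simp]:
  "contract x (wedge a b) = wedge (contract x a) b + wedge (parity a) (contract x b)"
  by (simp add: contract_def[of x "wedge a b"] fun_eq_iff wedge_Cons)

lemma parity_wedge [simp]: "parity (wedge a b) = wedge (parity a) (parity b)"
proof
  fix xs show "parity (wedge a b) xs = wedge (parity a) (parity b) xs"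
  proof (induction xs arbitrary: a b)
    case Nil then show ?case by (simp add: parity_def)
  next
    case (Cons x xs)
    have "parity (wedge a b) (x # xs) =
        - parity (wedge (contract x a) b) xs - parity (wedge (parity a) (contract x b)) xs"
      by (simp add: parity_def wedge_Cons algebra_simps)
    then show ?case by (simp add: Cons wedge_Cons)
  qed
qed

lemma wedge_assoc: "wedge (wedge a b) c = wedge a (wedge b c)"
proof
  fix xs show "wedge (wedge a b) c xs = wedge a (wedge b c) xs"
    by (induction xs arbitrary: a b c) (simp_all add: wedge_Cons)
qed

lemma wedge_unit:
  "wedge (\<lambda>xs. if xs = [] then 1 else 0) a = a"
  "wedge a (\<lambda>xs. if xs = [] then 1 else 0) = a"
proof -
  let ?u = "\<lambda>xs :: 'a list. if xs = [] then 1 else 0 :: complex"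
  have u: "contract x ?u = 0" "parity ?u = ?u" for x
    by (auto simp: contract_def parity_def fun_eq_iff)
  have "wedge ?u a xs = a xs \<and> wedge a ?u xs = a xs" for xs
    by (induction xs arbitrary: a) (simp_all add: wedge_Cons u, simp add: contract_def)
  then show "wedge ?u a = a" "wedge a ?u = a" by auto
qed

lemma wedge_commute:
  assumes "\<And>xs. length xs \<noteq> p \<Longrightarrow> a xs = 0" "\<And>xs. length xs \<noteq> q \<Longrightarrow> b xs = 0"
  shows "wedge a b = (- 1) ^ (p * q) *\<^sub>C wedge b a"
proof
  fix xs show "wedge a b xs = ((- 1) ^ (p * q) *\<^sub>C wedge b a) xs"
    using assms
  proof (induction xs arbitrary: a b p q)
    case Nil
    then have "p \<noteq> 0 \<Longrightarrow> a [] = 0" "q \<noteq> 0 \<Longrightarrow> b [] = 0" by simp_all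
    then show ?case by (cases "p = 0"; cases "q = 0") (simp_all add: scaleC_fun_def scaleC_complex_def)
  next
    case (Cons x xs)
    have par: "parity a = (- 1) ^ p *\<^sub>C a" "parity b = (- 1) ^ q *\<^sub>C b"
      using Cons.prems by (fastforce simp: parity_def fun_eq_iff scaleC_fun_def scaleC_complex_def)+
    have 1: "wedge (contract x a) b xs = (- 1) ^ (p * q) * (- 1) ^ q * wedge b (contract x a) xs"
    proof (cases p)
      case 0
      then have "contract x a = 0" using Cons.prems(1) by (simp add: contract_def fun_eq_iff)
      then show ?thesis by simp
    next
      case (Suc p')
      have "wedge (contract x a) b xs = ((- 1) ^ (p' * q) *\<^sub>C wedge b (contract x a)) xs"
        by (rule Cons.IH) (use Suc Cons.prems in \<open>simp_all add: contract_def\<close>)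
      then show ?thesis
        using Suc by (simp add: scaleC_fun_def scaleC_complex_def power_add flip: power_mult_distrib)
    qed
    have 2: "wedge a (contract x b) xs = (- 1) ^ (p * q) * (- 1) ^ p * wedge (contract x b) a xs"
    proof (cases q)
      case 0
      then have "contract x b = 0" using Cons.prems(2) by (simp add: contract_def fun_eq_iff)
      then show ?thesis by simp
    next
      case (Suc q')
      have "wedge a (contract x b) xs = ((- 1) ^ (p * q') *\<^sub>C wedge (contract x b) a) xs"
        by (rule Cons.IH) (use Suc Cons.prems in \<open>simp_all add: contract_def\<close>)
      then show ?thesis
        using Suc by (simp add: scaleC_fun_def scaleC_complex_def power_add flip: power_mult_distrib)
    qed
    have 3: "wedge (parity a) (contract x b) xs = (- 1) ^ p * wedge a (contract x b) xs"
      "wedge (parity b) (contract x a) xs = (- 1) ^ q * wedge b (contract x a) xs"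
      unfolding par wedge_scaleC by (simp_all add: scaleC_fun_def scaleC_complex_def)
    have 4: "(- 1) ^ p * ((- 1) ^ (p * q) * (- 1) ^ p * z) = (- 1) ^ (p * q) * (z::complex)" for z
      by (simp flip: power_add)
        (simp add: power_add flip: power_mult_distrib)
    have "wedge a b (x # xs) =
        (- 1) ^ (p * q) * (- 1) ^ q * wedge b (contract x a) xs
          + (- 1) ^ (p * q) * wedge (contract x b) a xs"
      unfolding wedge_Cons 3 1 2 4 ..
    then show ?case
      by (simp add: wedge_Cons 3 scaleC_fun_def scaleC_complex_def algebra_simps)
  qed
qed


definition alternating :: "nat \<Rightarrow> ('f::complex_vector list \<Rightarrow> complex) \<Rightarrow> bool" where
  "alternating n c \<longleftrightarrow>
     (\<forall>xs. length xs \<noteq> n \<longrightarrow> c xs = 0) \<and>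
     (\<forall>us x y vs. c (us @ (x + y) # vs) = c (us @ x # vs) + c (us @ y # vs)) \<and>
     (\<forall>us k x vs. c (us @ (k *\<^sub>C x) # vs) = k *\<^sub>C c (us @ x # vs)) \<and>
     (\<forall>xs. \<not> distinct xs \<longrightarrow> c xs = 0)"

lemma grade_CE_algebra: "grade (CE_algebra br) n = {c. alternating n c}"
  by (simp add: CE_algebra_def ce_cochains_def lie_of_def alternating_def)

lemma alternating_swap:
  assumes "alternating n c"
  shows "c (x # y # xs) = - c (y # x # xs)"
proof -
  have add1: "c ((a + b) # zs) = c (a # zs) + c (b # zs)" for a b zs
    using assms unfolding alternating_def by (metis append_Nil)
  have add2: "c (z # (a + b) # zs) = c (z # a # zs) + c (z # b # zs)" for z a b zs
    using assms unfolding alternating_def by (metis append_Cons append_Nil)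
  have diag: "c (a # a # zs) = 0" for a zs
    using assms unfolding alternating_def by simp
  have "0 = c ((x + y) # (x + y) # xs)"
    by (simp add: diag)
  also have "\<dots> = c (x # y # xs) + c (y # x # xs)"
    unfolding add1 add2 by (simp add: diag)
  finally show ?thesis by (metis eq_neg_iff_add_eq_0)
qed

lemma alternating_contract:
  assumes "alternating (Suc n) c"
  shows "alternating n (contract x c)"
  unfolding alternating_def contract_def
proof (intro conjI allI impI)
  fix us vs :: "'a list" and y z k
  show "c (x # us @ (y + z) # vs) = c (x # us @ y # vs) + c (x # us @ z # vs)"
    using assms unfolding alternating_def by (metis append_Cons)
  show "c (x # us @ (k *\<^sub>C y) # vs) = k *\<^sub>C c (x # us @ y # vs)"
    using assms unfolding alternating_def by (metis append_Cons)
qed (use assms in \<open>simp_all add: alternating_def\<close>)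

lemma alternating_0_contract:
  assumes "alternating 0 c"
  shows "contract x c = 0"
  using assms by (simp add: alternating_def contract_def fun_eq_iff)

lemma alternating_move:
  assumes "alternating n c"
  shows "c (us @ x # vs) = (- 1) ^ length us * c (x # us @ vs)"
  using assms
proof (induction us arbitrary: n c)
  case (Cons u us)
  show ?case
  proof (cases n)
    case 0
    then show ?thesis using Cons.prems by (simp add: alternating_def)
  next
    case (Suc m)
    have "contract u c (us @ x # vs) = (- 1) ^ length us * contract u c (x # us @ vs)"
      using Cons.IH Cons.prems Suc alternating_contract by blast
    then show ?thesis
      using alternating_swap[OF Cons.prems, of u x "us @ vs"] by (simp add: contract_def)
  qed
qed simp

lemma alternating_0_iff: "alternating 0 c \<longleftrightarrow> (\<forall>x xs. c (x # xs) = 0)"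
proof
  assume "\<forall>x xs. c (x # xs) = 0"
  then have "c xs = 0" if "xs \<noteq> []" for xs
    using that by (cases xs) auto
  then show "alternating 0 c"
    unfolding alternating_def by (metis append_is_Nil_conv distinct.simps(1) add_0 cvs.scale_zero_right length_0_conv list.distinct(1))
qed (simp add: alternating_def)

lemma alternating_Suc_iff:
  "alternating (Suc n) c \<longleftrightarrow>
     c [] = 0 \<and> (\<forall>x. alternating n (contract x c)) \<and>
     (\<forall>x y. contract (x + y) c = contract x c + contract y c) \<and>
     (\<forall>k x. contract (k *\<^sub>C x) c = k *\<^sub>C contract x c) \<and>
     (\<forall>x. contract x (contract x c) = 0)" (is "?L \<longleftrightarrow> ?R")
proof
  assume L: ?L
  have "c ((x + y) # zs) = c (x # zs) + c (y # zs)" "c ((k *\<^sub>C x) # zs) = k *\<^sub>C c (x # zs)" for k x y zs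
    using L unfolding alternating_def by (metis append_Nil)+
  moreover have "c [] = 0" "c (x # x # zs) = 0" for x zs
    using L by (simp_all add: alternating_def)
  ultimately show ?R
    using alternating_contract[OF L] by (simp add: contract_def fun_eq_iff scaleC_fun_def)
next
  assume R: ?R
  then have Nil: "c [] = 0" and alt: "\<And>x. alternating n (contract x c)"
    and lin: "\<And>x y zs. c ((x + y) # zs) = c (x # zs) + c (y # zs)"
      "\<And>k x zs. c ((k *\<^sub>C x) # zs) = k *\<^sub>C c (x # zs)"
    and diag: "\<And>x zs. c (x # x # zs) = 0"
    by (simp_all add: contract_def fun_eq_iff scaleC_fun_def)
  show ?L
    unfolding alternating_def
  proof (intro conjI allI impI)
    fix xs :: "'a list"
    assume "length xs \<noteq> Suc n"
    then show "c xs = 0"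
      using Nil alt by (cases xs) (auto simp: alternating_def contract_def)
  next
    fix us vs :: "'a list" and x y
    show "c (us @ (x + y) # vs) = c (us @ x # vs) + c (us @ y # vs)"
    proof (cases us)
      case (Cons u us')
      then show ?thesis using alt[of u] by (simp add: alternating_def contract_def)
    qed (simp add: lin)
  next
    fix us vs :: "'a list" and k x
    show "c (us @ (k *\<^sub>C x) # vs) = k *\<^sub>C c (us @ x # vs)"
    proof (cases us)
      case (Cons u us')
      then show ?thesis using alt[of u] by (simp add: alternating_def contract_def)
    qed (simp add: lin)
  next
    fix xs :: "'a list"
    assume "\<not> distinct xs"
    then obtain x ys where xs: "xs = x # ys" and "x \<in> set ys \<or> \<not> distinct ys"
      by (cases xs) auto
    then consider "\<not> distinct ys" | us vs where "ys = us @ x # vs"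
      by (meson split_list)
    then show "c xs = 0"
    proof cases
      case 1
      then show ?thesis using alt[of x] xs by (simp add: alternating_def contract_def)
    next
      case 2
      then show ?thesis
        using alternating_move[OF alt[of x], of us x vs] xs diag by (simp add: contract_def)
    qed
  qed
qed

lemma alternating_closed:
  "alternating n 0"
  "alternating n a \<Longrightarrow> alternating n b \<Longrightarrow> alternating n (a + b)"
  "alternating n a \<Longrightarrow> alternating n (k *\<^sub>C a)"
  by (simp_all add: alternating_def scaleC_fun_def scaleC_complex_def algebra_simps)

lemma scaleC_minus_one: "- a = (- 1) *\<^sub>C (a :: 'a::complex_vector)"
  by simp

lemma alternating_uminus: "alternating n a \<Longrightarrow> alternating n (- a)"
  by (subst scaleC_minus_one) (rule alternating_closed)

lemma alternating_diff: "alternating n a \<Longrightarrow> alternating n b \<Longrightarrow> alternating n (a - b)"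
  by (simp only: diff_conv_add_uminus alternating_closed alternating_uminus)

lemma parity_alternating:
  assumes "alternating n a"
  shows "parity a = (- 1) ^ n *\<^sub>C a"
  using assms by (fastforce simp: alternating_def parity_def fun_eq_iff scaleC_fun_def scaleC_complex_def)

lemma alternating_parity: "alternating n a \<Longrightarrow> alternating n (parity a)"
  by (simp add: parity_alternating alternating_closed)

lemma alternating_wedge:
  assumes "alternating p a" "alternating q b"
  shows "alternating (p + q) (wedge a b)"
  using assms
proof (induction "p + q" arbitrary: p q a b)
  case 0
  then have "alternating 0 a" "alternating 0 b" by simp_all
  then have "contract x a = 0" "contract x b = 0" for x
    by (simp_all add: alternating_0_contract)
  then show ?case
    using 0 by (simp add: alternating_0_iff wedge_Cons)
next
  case (Suc n)
  have a: "alternating n (wedge (contract x a) b)" for x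
  proof (cases p)
    case 0
    then show ?thesis using Suc.prems by (simp add: alternating_0_contract alternating_closed)
  next
    case (Suc p')
    then show ?thesis using Suc.hyps Suc.prems alternating_contract by fastforce
  qed
  have b: "alternating n (wedge (parity a) (contract x b))" for x
  proof (cases q)
    case 0
    then show ?thesis using Suc.prems by (simp add: alternating_0_contract alternating_closed)
  next
    case (Suc q')
    then show ?thesis
      using Suc.hyps Suc.prems alternating_contract alternating_parity by fastforce
  qed
  have lin: "contract (x + y) c = contract x c + contract y c"
     "contract (k *\<^sub>C x) c = k *\<^sub>C contract x c" "contract x (contract x c) = 0"
    if "alternating r c" for r c k and x y :: 'a
    using that by (cases r; simp add: alternating_0_contract alternating_Suc_iff)+
  have ab: "a [] * b [] = 0"
    using Suc by (cases p) (auto simp: alternating_def)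
  have "alternating (Suc n) (wedge a b)"
    unfolding alternating_Suc_iff
    using Suc.prems ab by (simp add: a b alternating_closed lin scaleC_add_right)
  then show ?case using Suc.hyps by simp
qed

abbreviation CE_diff :: "('f::complex_vector \<Rightarrow> 'f \<Rightarrow> 'f) \<Rightarrow> ('f list \<Rightarrow> complex) \<Rightarrow> 'f list \<Rightarrow> complex"
  where "CE_diff br \<equiv> ce_diff (lie_of br) (\<lambda>_ _. 0)"

lemma CE_diff_eq:
  "CE_diff br c xs =
     (\<Sum>j<length xs. \<Sum>i<j. (- 1) ^ (i + j) * c (br (xs ! i) (xs ! j) # omit i (omit j xs)))"
  by (simp add: ce_diff_def lie_of_def scaleC_complex_def)

lemma omit_Cons [simp]: "omit 0 (x # xs) = xs" "omit (Suc i) (x # xs) = x # omit i xs"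
  by (simp_all add: omit_def)

lemma CE_diff_simps [simp]:
  "CE_diff br (a + b) = CE_diff br a + CE_diff br b"
  "CE_diff br (a - b) = CE_diff br a - CE_diff br b"
  "CE_diff br (- a) = - CE_diff br a"
  "CE_diff br 0 = 0"
  by (simp_all add: CE_diff_eq fun_eq_iff algebra_simps sum.distrib sum_subtractf sum_negf)

lemma CE_diff_scaleC: "CE_diff br (k *\<^sub>C a) = k *\<^sub>C CE_diff br a"
  by (simp add: CE_diff_eq fun_eq_iff scaleC_fun_def scaleC_complex_def sum_distrib_left mult_ac)

lemma CE_diff_Nil [simp]: "CE_diff br c [] = 0"
  by (simp add: CE_diff_eq)

lemma lie_derivative_alternating:
  assumes "alternating n c"
  shows "lie_derivative br x xs c = - (\<Sum>j<length xs. (- 1) ^ j * c (br x (xs ! j) # omit j xs))"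
  using assms
proof (induction xs arbitrary: n c)
  case (Cons y ys)
  show ?case
  proof (cases n)
    case 0
    then show ?thesis using Cons by (simp add: alternating_0_contract alternating_closed)
      (use Cons.prems 0 in \<open>simp add: alternating_def\<close>)
  next
    case (Suc m)
    have "lie_derivative br x ys (contract y c) =
        - (\<Sum>j<length ys. (- 1) ^ j * contract y c (br x (ys ! j) # omit j ys))"
      using Cons Suc alternating_contract by blast
    also have "\<dots> = (\<Sum>j<length ys. (- 1) ^ j * c (br x (ys ! j) # y # omit j ys))"
      by (simp add: contract_def alternating_swap[OF Cons.prems, of y] sum_negf)
    finally show ?thesis
      by (simp add: sum.lessThan_Suc_shift sum_negf del: sum.lessThan_Suc)
  qed
qed simp

lemma CE_diff_Cons:
  assumes "alternating n c"
  shows "CE_diff br c (x # xs) = lie_derivative br x xs c - CE_diff br (contract x c) xs"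
proof -
  have "CE_diff br c (x # xs) =
     (\<Sum>j<length xs. (- 1) ^ Suc j * c (br x (xs ! j) # omit j xs) +
       (\<Sum>i<j. (- 1) ^ (i + j) * c (br (xs ! i) (xs ! j) # x # omit i (omit j xs))))"
    by (simp add: CE_diff_eq sum.lessThan_Suc_shift del: sum.lessThan_Suc)
  also have "\<dots> = lie_derivative br x xs c - CE_diff br (contract x c) xs"
    by (simp add: lie_derivative_alternating[OF assms] CE_diff_eq contract_def
        alternating_swap[OF assms, of x] sum.distrib sum_negf sum_subtractf)
  finally show ?thesis .
qed

definition lie_der ::
  "('f \<Rightarrow> 'f \<Rightarrow> 'f) \<Rightarrow> 'f \<Rightarrow> ('f list \<Rightarrow> complex) \<Rightarrow> 'f list \<Rightarrow> complex" where
  "lie_der br x c = (\<lambda>xs. lie_derivative br x xs c)"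

lemma contract_CE_diff:
  "alternating n c \<Longrightarrow> contract x (CE_diff br c) = lie_der br x c - CE_diff br (contract x c)"
  by (simp add: contract_def[of x "CE_diff br c"] lie_der_def fun_eq_iff CE_diff_Cons)

lemma lie_der_Nil [simp]: "lie_der br x c [] = 0"
  by (simp add: lie_der_def)

lemma contract_lie_der [simp]:
  "contract y (lie_der br x c) = lie_der br x (contract y c) - contract (br x y) c"
proof
  fix xs
  have "contract y (lie_der br x c) xs = lie_derivative br x (y # xs) c"
    by (simp only: contract_def lie_der_def)
  also have "\<dots> = lie_der br x (contract y c) xs - contract (br x y) c xs"
    by (simp add: lie_der_def contract_def[of "br x y"])
  finally show "contract y (lie_der br x c) xs = (lie_der br x (contract y c) - contract (br x y) c) xs"
    by simp
qed

lemma fun_list_eqI: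
  assumes "f [] = g []" "\<And>x. contract x f = contract x g"
  shows "f = g"
proof
  fix xs show "f xs = g xs"
    using assms by (cases xs) (auto simp: contract_def fun_eq_iff)
qed

lemma lie_der_simps [simp]:
  "lie_der br x (a + b) = lie_der br x a + lie_der br x b"
  "lie_der br x (a - b) = lie_der br x a - lie_der br x b"
  "lie_der br x (- a) = - lie_der br x a"
  "lie_der br x 0 = 0"
proof -
  have "lie_derivative br x xs (a + b) = lie_derivative br x xs a + lie_derivative br x xs b" for xs
    by (induction xs arbitrary: a b) simp_all
  then show "lie_der br x (a + b) = lie_der br x a + lie_der br x b"
    by (simp add: lie_der_def fun_eq_iff)
  have "lie_derivative br x xs (a - b) = lie_derivative br x xs a - lie_derivative br x xs b" for xs a b
    by (induction xs arbitrary: a b) simp_all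
  then show diff: "lie_der br x (a - b) = lie_der br x a - lie_der br x b" for a b
    by (simp add: lie_der_def fun_eq_iff)
  have "lie_derivative br x xs (- a) = - lie_derivative br x xs a" for xs
    by (induction xs arbitrary: a) simp_all
  then show "lie_der br x (- a) = - lie_der br x a"
    by (simp add: lie_der_def fun_eq_iff)
  show "lie_der br x 0 = 0"
    using diff[of 0 0] by simp
qed

lemma contract_scaleC [simp]: "contract x (k *\<^sub>C a) = k *\<^sub>C contract x a"
  by (simp add: contract_def scaleC_fun_def)

lemma lie_der_scaleC [simp]: "lie_der br x (k *\<^sub>C a) = k *\<^sub>C lie_der br x a"
proof -
  have "lie_derivative br x xs (k *\<^sub>C a) = k * lie_derivative br x xs a" for xs
    by (induction xs arbitrary: a) (simp_all add: algebra_simps, simp add: scaleC_fun_def scaleC_complex_def)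
  then show ?thesis
    by (simp add: lie_der_def fun_eq_iff scaleC_fun_def scaleC_complex_def)
qed

lemma parity_lie_der [simp]: "parity (lie_der br x a) = lie_der br x (parity a)"
proof
  fix xs show "parity (lie_der br x a) xs = lie_der br x (parity a) xs"
  proof (induction xs arbitrary: a)
    case (Cons y ys)
    have "parity (lie_der br x a) (y # ys) = - parity (contract y (lie_der br x a)) ys"
      by (simp add: parity_def contract_def)
    also have "\<dots> = contract y (lie_der br x (parity a)) ys"
      by (simp add: Cons)
    finally show ?case by (simp add: contract_def)
  qed (simp add: parity_def)
qed

lemma lie_der_wedge: "lie_der br x (wedge a b) = wedge (lie_der br x a) b + wedge a (lie_der br x b)"
proof
  fix xs show "lie_der br x (wedge a b) xs = (wedge (lie_der br x a) b + wedge a (lie_der br x b)) xs"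
  proof (induction xs arbitrary: a b)
    case (Cons y ys)
    have "contract y (lie_der br x (wedge a b)) ys =
      contract y (wedge (lie_der br x a) b + wedge a (lie_der br x b)) ys"
      by (simp add: Cons)
    then show ?case by (simp add: contract_def)
  qed simp
qed

lemma parity_CE_diff: "parity (CE_diff br a) = - CE_diff br (parity a)"
proof
  fix xs :: "'a list"
  have "length (br (xs ! i) (xs ! j) # omit i (omit j xs)) = length xs - 1"
    if "i < j" "j < length xs" for i j
    using that by (simp add: omit_def)
  then have "CE_diff br (parity a) xs = (- 1) ^ (length xs - 1) * CE_diff br a xs"
    by (simp add: CE_diff_eq parity_def sum_distrib_left mult_ac)
  then show "parity (CE_diff br a) xs = (- CE_diff br (parity a)) xs"
    by (cases xs) (simp_all add: parity_def)
qed

lemma CE_diff_wedge: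
  assumes "alternating p a" "alternating q b"
  shows "CE_diff br (wedge a b) = wedge (CE_diff br a) b + wedge (parity a) (CE_diff br b)"
proof
  fix xs
  show "CE_diff br (wedge a b) xs = (wedge (CE_diff br a) b + wedge (parity a) (CE_diff br b)) xs"
    using assms
  proof (induction xs arbitrary: a b p q)
    case (Cons x xs)
    have 1: "CE_diff br (wedge (contract x a) b) xs =
        (wedge (CE_diff br (contract x a)) b + wedge (parity (contract x a)) (CE_diff br b)) xs"
    proof (cases p)
      case 0
      then show ?thesis using Cons.prems by (simp add: alternating_0_contract)
    next
      case (Suc p')
      then show ?thesis using Cons alternating_contract by blast
    qed
    have 2: "CE_diff br (wedge (parity a) (contract x b)) xs =
        (wedge (CE_diff br (parity a)) (contract x b) + wedge a (CE_diff br (contract x b))) xs"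
    proof (cases q)
      case 0
      then show ?thesis using Cons.prems by (simp add: alternating_0_contract)
    next
      case (Suc q')
      have "CE_diff br (wedge (parity a) (contract x b)) xs =
        (wedge (CE_diff br (parity a)) (contract x b)
          + wedge (parity (parity a)) (CE_diff br (contract x b))) xs"
        using Cons Suc alternating_contract alternating_parity by blast
      then show ?thesis by simp
    qed
    have "contract x (CE_diff br (wedge a b)) xs =
        contract x (wedge (CE_diff br a) b + wedge (parity a) (CE_diff br b)) xs"
      using 1 2
      by (simp add: contract_CE_diff[OF alternating_wedge[OF Cons.prems]]
          contract_CE_diff[OF Cons.prems(1)] contract_CE_diff[OF Cons.prems(2)]
          lie_der_wedge parity_CE_diff)
    then show ?case by (simp add: contract_def)
  qed simp
qed

context
  fixes br :: "'f::complex_vector \<Rightarrow> 'f \<Rightarrow> 'f"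
  assumes br: "lie_bracket br"
begin

lemma br_simps:
  "br (x + y) z = br x z + br y z" "br x (y + z) = br x y + br x z"
  "br (k *\<^sub>C x) z = k *\<^sub>C br x z" "br x (k *\<^sub>C z) = k *\<^sub>C br x z"
  "br x x = 0"
  using br by (simp_all add: lie_bracket_def bilinear_on_def linear_on_def)

lemma br_antisym: "br x y = - br y x"
proof -
  have "0 = br (x + y) (x + y)" by (simp only: br_simps(5))
  also have "\<dots> = br x y + br y x" unfolding br_simps(1,2) by (simp add: br_simps(5))
  finally show ?thesis by (metis eq_neg_iff_add_eq_0)
qed

lemma contract_linear:
  assumes "alternating n c"
  shows "contract (x + y) c = contract x c + contract y c"
    "contract (k *\<^sub>C x) c = k *\<^sub>C contract x c" "contract x (contract x c) = 0"
    "contract 0 c = 0" "contract (- x) c = - contract x c"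
proof -
  show *: "contract (x + y) c = contract x c + contract y c"
    "contract (k *\<^sub>C x) c = k *\<^sub>C contract x c" "contract x (contract x c) = 0" for k x y
    using assms by (cases n; simp add: alternating_0_contract alternating_Suc_iff)+
  show "contract 0 c = 0" using *(2)[of 0 0] by simp
  show "contract (- x) c = - contract x c" using *(2)[of "- 1" x] by simp
qed

lemma contract_swap:
  assumes "alternating n c"
  shows "contract x (contract y c) = - contract y (contract x c)"
proof
  fix zs show "contract x (contract y c) zs = (- contract y (contract x c)) zs"
    using alternating_swap[OF assms, of y x zs] by (simp add: contract_def)
qed

lemma lie_der_linear:
  assumes "alternating n c"
  shows "lie_der br (x + y) c = lie_der br x c + lie_der br y c"
    "lie_der br (k *\<^sub>C x) c = k *\<^sub>C lie_der br x c"
proof -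
  have "c ((u + v) # zs) = c (u # zs) + c (v # zs)" "c ((k *\<^sub>C u) # zs) = k * c (u # zs)" for u v zs k
    using contract_linear(1)[OF assms, of u v] contract_linear(2)[OF assms, of k u]
    by (simp_all add: contract_def fun_eq_iff scaleC_fun_def scaleC_complex_def)
  note lin = this lie_derivative_alternating[OF assms] br_simps
  show "lie_der br (x + y) c = lie_der br x c + lie_der br y c"
    by (simp add: lie_der_def fun_eq_iff lin distrib_left sum.distrib)
  show "lie_der br (k *\<^sub>C x) c = k *\<^sub>C lie_der br x c"
    by (simp add: lie_der_def fun_eq_iff lin scaleC_fun_def scaleC_complex_def sum_distrib_left mult.left_commute)
qed

lemma alternating_lie_der:
  assumes "alternating n c"
  shows "alternating n (lie_der br x c)"
  using assms
proof (induction n arbitrary: c)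
  case 0
  then have "contract y (lie_der br x c) = 0" for y
    by (simp add: alternating_0_contract)
  then show ?case by (simp add: alternating_0_iff contract_def fun_eq_iff)
next
  case (Suc n)
  note lin = contract_linear[OF Suc.prems]
  have c: "alternating n (contract y c)" for y
    using Suc.prems by (rule alternating_contract)
  then have "alternating n (contract y (lie_der br x c))" for y
    by (simp add: Suc.IH alternating_diff)
  moreover have "contract y (contract y (lie_der br x c)) = 0" for y
    using contract_swap[OF Suc.prems, of y "br x y"] by (simp add: lin)
  moreover have "contract (y + z) (lie_der br x c) = contract y (lie_der br x c) + contract z (lie_der br x c)"
    for y z
    unfolding contract_lie_der br_simps(2) lin(1) lie_der_simps(1) by (rule add_diff_add)
  moreover have "contract (k *\<^sub>C y) (lie_der br x c) = k *\<^sub>C contract y (lie_der br x c)" for k y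
    unfolding contract_lie_der br_simps(4) lin(2) lie_der_scaleC cvs.scale_right_diff_distrib ..
  ultimately show ?case
    unfolding alternating_Suc_iff by (simp del: contract_lie_der)
qed

lemma alternating_CE_diff:
  assumes "alternating n c"
  shows "alternating (Suc n) (CE_diff br c)"
  using assms
proof (induction n arbitrary: c)
  case 0
  have "contract x (CE_diff br c) = lie_der br x c" for x
    using 0 by (simp add: contract_CE_diff alternating_0_contract)
  then show ?case
    using 0 alternating_lie_der[OF 0]
    by (simp add: alternating_Suc_iff lie_der_linear[OF 0] alternating_0_contract br_simps)
next
  case (Suc n)
  note lin = contract_linear[OF Suc.prems]
  note Cartan = contract_CE_diff[OF Suc.prems, of _ br]
  have c: "alternating n (contract x c)" for x
    using Suc.prems by (rule alternating_contract)
  have "alternating (Suc n) (contract x (CE_diff br c))" for x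
    unfolding Cartan by (intro alternating_diff alternating_lie_der Suc.prems Suc.IH c)
  moreover have "contract x (contract x (CE_diff br c)) = 0" for x
    by (simp add: Cartan contract_CE_diff[OF c] br_simps lin)
  moreover have "contract (x + y) (CE_diff br c) = contract x (CE_diff br c) + contract y (CE_diff br c)"
    for x y
    unfolding Cartan lin(1) lie_der_linear(1)[OF Suc.prems] CE_diff_simps(1)
    by (rule add_diff_add)
  moreover have "contract (k *\<^sub>C x) (CE_diff br c) = k *\<^sub>C contract x (CE_diff br c)" for k x
    unfolding Cartan lin(2) lie_der_linear(2)[OF Suc.prems] CE_diff_scaleC cvs.scale_right_diff_distrib ..
  ultimately show ?case
    unfolding alternating_Suc_iff[of "Suc n"] by simp
qed

lemma lie_der_commutator:
  assumes "alternating n c"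
  shows "lie_der br x (lie_der br y c) - lie_der br y (lie_der br x c) = lie_der br (br x y) c"
  using assms
proof (induction n arbitrary: c)
  case 0
  have "contract z (lie_der br x (lie_der br y c) - lie_der br y (lie_der br x c)) =
      contract z (lie_der br (br x y) c)" for z
    by (simp add: alternating_0_contract[OF 0])
  then show ?case by (rule fun_list_eqI[rotated]) simp
next
  case (Suc n)
  note lin = contract_linear[OF Suc.prems]
  have jac: "br (br x y) z = br x (br y z) - br y (br x z)" for z
  proof -
    have "br x (br y z) + br y (br z x) + br z (br x y) = 0"
      using br by (simp add: lie_bracket_def)
    moreover have "br z (br x y) = - br (br x y) z" by (rule br_antisym)
    moreover have "br y (br z x) = - br y (br x z)"
      using br_simps(4)[of y "- 1" "br x z"] by (simp add: br_antisym[of z x])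
    ultimately have "br x (br y z) - br y (br x z) - br (br x y) z = 0" by simp
    then show ?thesis by (simp only: right_minus_eq)
  qed
  have diff: "contract (u - v) c = contract u c - contract v c" for u v
    using lin(1)[of u "- v"] by (simp add: lin(5))
  have "contract z (lie_der br x (lie_der br y c) - lie_der br y (lie_der br x c)) =
      contract z (lie_der br (br x y) c)" for z
  proof -
    have "lie_der br x (lie_der br y (contract z c)) - lie_der br y (lie_der br x (contract z c))
        = lie_der br (br x y) (contract z c)"
      by (rule Suc.IH[OF alternating_contract[OF Suc.prems]])
    then show ?thesis
      by (simp add: jac diff algebra_simps)
  qed
  then show ?case by (rule fun_list_eqI[rotated]) simp
qed

lemma lie_der_CE_diff:
  assumes "alternating n c"
  shows "lie_der br x (CE_diff br c) = CE_diff br (lie_der br x c)"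
  using assms
proof (induction n arbitrary: c x)
  case (0 c x)
  have "contract y (lie_der br x (CE_diff br c)) = contract y (CE_diff br (lie_der br x c))" for y
    using lie_der_commutator[OF 0, of x y]
    by (simp add: contract_CE_diff[OF 0] contract_CE_diff[OF alternating_lie_der[OF 0]]
        alternating_0_contract[OF 0] algebra_simps)
  then show ?case by (rule fun_list_eqI[rotated]) simp
next
  case (Suc n c x)
  have "contract y (lie_der br x (CE_diff br c)) = contract y (CE_diff br (lie_der br x c))" for y
    using lie_der_commutator[OF Suc.prems, of x y] Suc.IH[OF alternating_contract[OF Suc.prems], of x y]
    by (simp add: contract_CE_diff[OF Suc.prems] contract_CE_diff[OF alternating_lie_der[OF Suc.prems]]
        algebra_simps)
  then show ?case by (rule fun_list_eqI[rotated]) simp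
qed

lemma CE_diff_CE_diff:
  assumes "alternating n c"
  shows "CE_diff br (CE_diff br c) = 0"
  using assms
proof (induction n arbitrary: c)
  case 0
  have "contract x (CE_diff br (CE_diff br c)) = contract x 0" for x
    by (simp add: contract_CE_diff[OF alternating_CE_diff[OF 0]] contract_CE_diff[OF 0]
        alternating_0_contract[OF 0] lie_der_CE_diff[OF 0])
  then show ?case by (rule fun_list_eqI[rotated]) simp
next
  case (Suc n)
  have "contract x (CE_diff br (CE_diff br c)) = contract x 0" for x
    by (simp add: contract_CE_diff[OF alternating_CE_diff[OF Suc.prems]]
        contract_CE_diff[OF Suc.prems] lie_der_CE_diff[OF Suc.prems]
        Suc.IH alternating_contract[OF Suc.prems])
      (simp add: zero_fun_def)
  then show ?case by (rule fun_list_eqI[rotated]) simp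
qed

lemma connected_cdga_CE_algebra: "connected_cdga (CE_algebra br)"
proof unfold_locales
  let ?A = "CE_algebra br"
  have [simp]: "mult ?A = wedge" "unit ?A = (\<lambda>xs. if xs = [] then 1 else 0)" "diff ?A = CE_diff br"
    by (simp_all add: CE_algebra_def)
  note [simp] = grade_CE_algebra
  show "csubspace (grade ?A i)" for i
    by (simp add: cvs.subspace_def alternating_closed)
  show "x i = 0" if x: "\<And>i. i \<le> n \<Longrightarrow> x i \<in> grade ?A i" "(\<Sum>i\<le>n. x i) = 0" "i \<le> n" for x n i
  proof
    fix xs :: "'f list"
    have sum: "(\<Sum>j\<in>J. x j) xs = (\<Sum>j\<in>J. x j xs)" for J
      by (induction J rule: infinite_finite_induct) simp_all
    show "x i xs = 0 xs"
    proof (cases "length xs = i")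
      case True
      have "(\<Sum>j\<le>n. x j xs) = (\<Sum>j\<le>n. if j = i then x i xs else 0)"
        using x(1) True by (intro sum.cong) (auto simp: alternating_def)
      also have "\<dots> = x i xs" using x(3) by simp
      finally show ?thesis using x(2) sum[of "{..n}"] by simp
    next
      case False
      then show ?thesis using x(1,3) by (simp add: alternating_def)
    qed
  qed
  show "bilinear_on (total_space ?A) (total_space ?A) (mult ?A)"
    by (simp add: bilinear_on_def linear_on_def)
  show "mult ?A a b \<in> grade ?A (i + j)" if "a \<in> grade ?A i" "b \<in> grade ?A j" for a b i j
    using that by (simp add: alternating_wedge)
  show "unit ?A \<in> grade ?A 0"
    by (simp add: alternating_0_iff)
  show "mult ?A (unit ?A) a = a" "mult ?A a (unit ?A) = a" for a
    by (simp_all add: wedge_unit)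
  show "mult ?A (mult ?A a b) c = mult ?A a (mult ?A b c)" for a b c
    by (simp add: wedge_assoc)
  show "mult ?A a b = (- 1) ^ (i * j) *\<^sub>C mult ?A b a"
    if "a \<in> grade ?A i" "b \<in> grade ?A j" for a b i j
    using that wedge_commute[of i a j b] by (simp add: alternating_def)
  show "linear_on (total_space ?A) (diff ?A)"
    by (simp add: linear_on_def CE_diff_scaleC)
  show "diff ?A a \<in> grade ?A (Suc i)" if "a \<in> grade ?A i" for a i
    using that by (simp add: alternating_CE_diff)
  show "diff ?A (diff ?A a) = 0" if "a \<in> grade ?A i" for a i
    using that CE_diff_CE_diff by simp
  show "diff ?A (mult ?A a b) = mult ?A (diff ?A a) b + (- 1) ^ i *\<^sub>C mult ?A a (diff ?A b)"
    if "a \<in> grade ?A i" "b \<in> grade ?A j" for a b i j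
    using that by (simp add: CE_diff_wedge parity_alternating)
  show "grade ?A 0 = cspan {unit ?A}"
  proof -
    have "alternating 0 c \<longleftrightarrow> (\<exists>k. c = k *\<^sub>C (\<lambda>xs. if xs = [] then 1 else 0))" for c :: "'f list \<Rightarrow> complex"
    proof
      assume "alternating 0 c"
      then have "c = c [] *\<^sub>C (\<lambda>xs. if xs = [] then 1 else 0)"
        by (auto simp: alternating_def scaleC_fun_def scaleC_complex_def fun_eq_iff)
      then show "\<exists>k. c = k *\<^sub>C (\<lambda>xs. if xs = [] then 1 else 0)" ..
    qed (auto simp: alternating_0_iff scaleC_fun_def scaleC_complex_def)
    then show ?thesis by (auto simp: cvs.span_singleton)
  qed
  show "unit ?A \<noteq> 0"
    by (auto simp: fun_eq_iff)
qed

end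

lemma diff_CE_algebra_1: "diff (CE_algebra br) c [x, y] = - c [br x y]"
  by (simp add: CE_algebra_def CE_diff_eq omit_def lessThan_Suc)

lemma mult_CE_algebra_1:
  assumes "a \<in> grade (CE_algebra br) 1" "b \<in> grade (CE_algebra br) 1"
  shows "mult (CE_algebra br) a b [x, y] = a [x] * b [y] - a [y] * b [x]"
  using assms
  by (simp add: CE_algebra_def ce_cochains_def wedge_Cons contract_def parity_def)

end

theory Submission
  imports Defs "HOL-Library.Product_Plus"
begin

text \<open>
  Let \<open>A\<close> be a connected cdga. A functional \<open>\<phi>\<close> on \<open>A\<^sup>2\<close>, applied to the first
  factor of an equation in \<open>A\<^sup>2 \<otimes> X\<close>, gives an equation in \<open>X\<close>, and for
  finite-dimensional \<open>X\<close> all functionals together recover the original equation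
  (\<open>slant_separates\<close>). Applied to \<open>\<partial>\<omega> + [\<omega>, \<omega>] / 2\<close> with
  \<open>\<omega>\<close> in \<open>A\<^sup>1 \<otimes> \<gg>\<close> this yields
  \<open>f (d\<^sup>*\<phi>) + \<Sum> [f u, f v]\<close>, where \<open>f = psi \<omega>\<close> and
  \<open>\<union>\<^sup>*\<phi> = \<Sum> u \<and> v\<close> (\<open>flat_iff\<close>). This is the image under \<open>f\<close> of the
  relator that \<open>\<phi>\<close> gives for the holonomy Lie algebra \<open>\<hh>(A)\<close>. By the universal property of \<open>\<hh>(A)\<close>
  (\<open>holonomy_universal\<close>, \<open>restrict_gen_Hom_Lie\<close>) the maps \<open>f\<close> that kill all relators are exactly the
  restrictions of homomorphisms \<open>\<rho>\<close> from \<open>\<hh>(A)\<close> to \<open>\<gg>\<close>; so \<open>psi\<close> matches flat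
  connections with homomorphisms.

  For the resonance varieties the cohomology of both sides is computed from \<open>f\<close> alone. In degree
  zero it consists of the vectors of \<open>V\<close> that are annihilated by \<open>f u\<close> for all \<open>u\<close> in
  \<open>A\<^sub>1\<close>. In degree one, both cocycle spaces are identified with the same subspace of
  \<open>Hom(A\<^sub>1, V)\<close>: for \<open>A\<close> by pairing with functionals (\<open>twisted_cocycle_iff\<close>), and for
  \<open>\<hh>(A)\<close> because a cocycle along \<open>\<rho>\<close> is the second component of a lift of \<open>\<rho>\<close> to the
  semidirect product \<open>\<gg> \<ltimes> V\<close>, to which the universal property applies again
  (\<open>restrict_cocycle_image\<close>). The coboundaries correspond as well.

  If \<open>A\<close> is the Chevalley-Eilenberg algebra of \<open>\<ff>\<close>, a tensor in \<open>A \<otimes> V\<close> is an alternating form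
  with values in \<open>V\<close>. This turns the twisted differential into the Chevalley-Eilenberg differential with
  coefficients in \<open>V\<close> (\<open>vector_form_twisted_diff\<close>), in all degrees, and the flatness equation into
  compatibility of the connection form \<open>\<ff> \<rightarrow> \<gg>\<close> with brackets (\<open>CE_flat_iff\<close>). Evaluation of
  two-forms at a pair of vectors gives the relators that make \<open>\<ff> \<rightarrow> \<hh>(A)\<close> a homomorphism; the
  canonical flat connection, with form \<open>id: \<ff> \<rightarrow> \<ff>\<close>, gives its inverse (\<open>holonomy_CE_iso\<close>).
\<close>

(* The theory speaks of the degrees 1 and 2; with this rule the simplifier would rewrite 1 to Suc 0. *)
declare One_nat_def [simp del]

section \<open>Linear maps and finite-dimensional spaces\<close>

lemma linear_onD:
  assumes "linear_on W f"
  shows "x \<in> W \<Longrightarrow> y \<in> W \<Longrightarrow> f (x + y) = f x + f y" "x \<in> W \<Longrightarrow> f (c *\<^sub>C x) = c *\<^sub>C f x"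
  using assms by (auto simp: linear_on_def)

lemma linear_on_0:
  assumes "csubspace W" "linear_on W f" shows "f 0 = 0"
  using linear_onD(2)[OF assms(2), of 0 0] cvs.subspace_0[OF assms(1)] by simp

lemma linear_on_diff:
  assumes "csubspace W" "linear_on W f" "x \<in> W" "y \<in> W"
  shows "f (x - y) = f x - f y"
proof -
  have "f (x + (- 1) *\<^sub>C y) = f x + (- 1) *\<^sub>C f y"
    using assms cvs.subspace_scale[OF assms(1), of y] by (simp only: linear_onD)
  then show ?thesis by simp
qed

lemma linear_on_sum:
  assumes "csubspace W" "linear_on W f" "\<And>i. i \<in> I \<Longrightarrow> x i \<in> W"
  shows "f (\<Sum>i\<in>I. c i *\<^sub>C x i) = (\<Sum>i\<in>I. c i *\<^sub>C f (x i))"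
  using assms(3)
proof (induction I rule: infinite_finite_induct)
  case (insert i I)
  then have "(\<Sum>i\<in>I. c i *\<^sub>C x i) \<in> W" "c i *\<^sub>C x i \<in> W"
    using assms(1) by (auto intro: cvs.subspace_sum cvs.subspace_scale)
  then show ?case using insert linear_onD[OF assms(2)] by simp
qed (simp_all add: linear_on_0[OF assms(1,2)])

lemma linear_on_subset: "linear_on W f \<Longrightarrow> U \<subseteq> W \<Longrightarrow> linear_on U f"
  unfolding linear_on_def by blast

lemma linear_on_closed:
  "linear_on W f \<Longrightarrow> linear_on W g \<Longrightarrow> linear_on W (\<lambda>x. f x + g x)"
  "linear_on W f \<Longrightarrow> linear_on W (\<lambda>x. c *\<^sub>C f x)"
  "linear_on W (\<lambda>x. 0)"
  by (simp_all add: linear_on_def cvs.scale_right_distrib algebra_simps)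

lemma fun_sum_apply: "(\<Sum>i\<in>I. f i) x = (\<Sum>i\<in>I. f i x)"
  by (induction I rule: infinite_finite_induct) simp_all

lemma scaleC_fun_apply [simp]: "(c *\<^sub>C f) x = c *\<^sub>C f x"
  by (simp add: scaleC_fun_def)

lemma linear_on_sum_list:
  "(\<And>p. p \<in> set ps \<Longrightarrow> linear_on W (f p)) \<Longrightarrow> linear_on W (\<lambda>x. \<Sum>p\<leftarrow>ps. f p x)"
proof (induction ps)
  case (Cons p ps)
  then show ?case using linear_on_closed(1)[of W "f p"] by simp
qed (simp add: linear_on_closed(3))

lemma linear_on_minus:
  "linear_on W f \<Longrightarrow> linear_on W g \<Longrightarrow> linear_on W (\<lambda>x. f x - g x)"
  by (simp add: linear_on_def cvs.scale_right_diff_distrib)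

lemma linear_on_apply: "linear_on W f \<Longrightarrow> linear_on W (\<lambda>t. f t xs)"
  by (simp add: linear_on_def)

lemma linear_on_fun_sum:
  "(\<And>i. linear_on W (g i)) \<Longrightarrow> linear_on W (\<lambda>x. \<Sum>i\<in>I. g i x)"
  by (induction I rule: infinite_finite_induct) (auto intro: linear_on_closed)

lemma linear_on_compose:
  assumes "linear_on W f" "linear_on U g" "f ` W \<subseteq> U"
  shows "linear_on W (\<lambda>x. g (f x))"
  using assms by (auto simp: linear_on_def image_subset_iff)

lemma linear_on_span_into:
  assumes "linear_on (cspan S) f" "\<And>x. x \<in> S \<Longrightarrow> f x \<in> U" "csubspace U" "x \<in> cspan S"
  shows "f x \<in> U"
proof -
  have "csubspace {x \<in> cspan S. f x \<in> U}"
    using linear_on_0[OF cvs.subspace_span assms(1)] linear_onD[OF assms(1)] assms(3)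
    by (auto simp: cvs.subspace_def cvs.span_zero cvs.span_add cvs.span_scale)
  then have "cspan S \<subseteq> {x \<in> cspan S. f x \<in> U}"
    using assms(2) by (intro cvs.span_minimal) (auto simp: cvs.span_base)
  then show ?thesis using assms(4) by blast
qed

lemma linear_on_eq_span:
  assumes "linear_on (cspan S) f" "linear_on (cspan S) g" "\<And>x. x \<in> S \<Longrightarrow> f x = g x" "x \<in> cspan S"
  shows "f x = g x"
  using linear_on_span_into[OF linear_on_minus[OF assms(1,2)] _ _ assms(4), of "{0}"] assms(3)
  by (simp add: cvs.subspace_def)

lemma hom_spaceD:
  assumes "f \<in> hom_space W"
  shows "linear_on W f" "x \<notin> W \<Longrightarrow> f x = 0"
  using assms by (auto simp: hom_space_def)

lemma hom_space_ext:
  assumes "f \<in> hom_space W" "g \<in> hom_space W" "\<And>x. x \<in> W \<Longrightarrow> f x = g x"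
  shows "f = g"
  using assms unfolding hom_space_def by fastforce

lemma csubspace_hom_space: "csubspace (hom_space W)"
  by (auto simp: cvs.subspace_def hom_space_def linear_on_def scaleC_fun_def algebra_simps)

text \<open>Elements of the dual space are extended by zero outside \<open>W\<close>, hence so are the coordinate
  functionals; only their values on \<open>W\<close> matter.\<close>

lemma finite_dual_basis:
  assumes "fin_dim W"
  obtains B \<kappa> where "finite B" "B \<subseteq> W" "\<And>b. \<kappa> b \<in> dual_space W"
    "\<And>x. x \<in> W \<Longrightarrow> x = (\<Sum>b\<in>B. \<kappa> b x *\<^sub>C b)"
    "\<And>b b'. b \<in> B \<Longrightarrow> b' \<in> B \<Longrightarrow> \<kappa> b b' = (if b = b' then 1 else 0)"
proof -
  obtain B0 where B0: "finite B0" "W = cspan B0" using assms by (auto simp: fin_dim_def)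
  obtain B where B: "B \<subseteq> B0" "cvs.independent B" "B0 \<subseteq> cspan B"
    using cvs.maximal_independent_subset by blast
  have fin: "finite B" using B B0 finite_subset by blast
  have W: "W = cspan B"
    using B B0 by (metis cvs.span_mono cvs.span_span subset_antisym)
  define \<kappa> where "\<kappa> b x = (if x \<in> W then cvs.representation B x b else 0)" for b x
  show ?thesis
  proof
    show "finite B" "B \<subseteq> W" using fin W by (auto simp: cvs.span_base)
    show "\<kappa> b \<in> dual_space W" for b
      using B(2) W
      by (auto simp: hom_space_def linear_on_def \<kappa>_def cvs.representation_add cvs.representation_scale
          cvs.span_add cvs.span_scale scaleC_complex_def)
    show "x = (\<Sum>b\<in>B. \<kappa> b x *\<^sub>C b)" if "x \<in> W" for x
      using cvs.sum_representation_eq[OF B(2), of x B] that fin W by (simp add: \<kappa>_def)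
    show "\<kappa> b b' = (if b = b' then 1 else 0)" if "b \<in> B" "b' \<in> B" for b b'
      using cvs.representation_basis[OF B(2) that(2)] that W by (simp add: \<kappa>_def cvs.span_base)
  qed
qed

text \<open>In a basis of \<open>W\<close> that contains \<open>x\<close>, take the coordinate of \<open>x\<close>. The case of
  interest is \<open>A\<^sup>2\<close>, which may have infinite dimension.\<close>

lemma functional_nonzero:
  assumes "csubspace W" "x \<in> W" "x \<noteq> 0"
  obtains \<phi> where "\<phi> \<in> dual_space W" "\<phi> x \<noteq> 0"
proof -
  obtain B where B: "{x} \<subseteq> B" "B \<subseteq> W" "cvs.independent B" "W \<subseteq> cspan B"
    using cvs.maximal_independent_subset_extend[of "{x}" W] assms by auto
  have W: "W = cspan B"
    using B assms(1) by (metis cvs.span_mono cvs.span_subspace subset_antisym)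
  let ?\<phi> = "\<lambda>y. if y \<in> W then cvs.representation B y x else 0"
  have "?\<phi> \<in> dual_space W"
    using B(3) W
    by (auto simp: hom_space_def linear_on_def cvs.representation_add cvs.representation_scale
        cvs.span_add cvs.span_scale scaleC_complex_def)
  moreover have "?\<phi> x \<noteq> 0"
    using B assms(2) cvs.representation_basis[OF B(3), of x] by simp
  ultimately show ?thesis by (rule that)
qed

lemma linear_projection:
  assumes "csubspace (W :: 'a::complex_vector set)"
  obtains p where "linear_on UNIV p" "\<And>x. p x \<in> W" "\<And>x. x \<in> W \<Longrightarrow> p x = x"
proof -
  interpret vector_space_pair "scaleC :: complex \<Rightarrow> 'a \<Rightarrow> 'a" "scaleC :: complex \<Rightarrow> 'a \<Rightarrow> 'a"
    by unfold_locales
  obtain p :: "'a \<Rightarrow> 'a" where p: "p ` UNIV \<subseteq> W" "Vector_Spaces.linear scaleC scaleC p" "\<forall>v\<in>W. p (id v) = v"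
    using linear_exists_left_inverse_on[OF cvs.linear_id assms[unfolded csubspace_def]] by auto
  then have "linear_on UNIV p"
    by (auto simp: linear_on_def module_hom_iff dest!: Vector_Spaces.linear.axioms(3))
  then show ?thesis using p(1,3) by (intro that[of p]) auto
qed

section \<open>Dimensions of quotients\<close>

text \<open>Independence modulo a subspace is a condition on linear combinations of vectors, so that an
  injective linear map preserves it in both directions.\<close>

lemma quotient_dim_image:
  assumes W: "csubspace W" and f: "linear_on W f" "inj_on f W" and "Z \<subseteq> W" "B \<subseteq> W"
  shows "quotient_dim (f ` Z) (f ` B) = quotient_dim Z B"
proof -
  have ind: "independent_mod (f ` B) (f ` S) \<longleftrightarrow> independent_mod B S" if "S \<subseteq> W" for S
  proof -
    have inj: "inj_on f S" using f(2) that by (rule inj_on_subset)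
    have *: "(\<Sum>v\<in>f ` S. c v *\<^sub>C v) \<in> f ` B \<longleftrightarrow> (\<Sum>v\<in>S. c (f v) *\<^sub>C v) \<in> B" for c
    proof -
      have "(\<Sum>v\<in>f ` S. c v *\<^sub>C v) = f (\<Sum>v\<in>S. c (f v) *\<^sub>C v)"
        using that linear_on_sum[OF W f(1), of S "\<lambda>v. v" "c \<circ> f"]
        by (simp add: sum.reindex[OF inj] subset_iff)
      moreover have "(\<Sum>v\<in>S. c (f v) *\<^sub>C v) \<in> W"
        using that by (intro cvs.subspace_sum cvs.subspace_scale W) auto
      ultimately show ?thesis
        using inj_on_image_mem_iff[OF f(2)] assms(5) by simp
    qed
    show ?thesis
      unfolding independent_mod_def *
    proof (intro iffI allI impI)
      fix c assume "\<forall>c. (\<Sum>v\<in>S. c (f v) *\<^sub>C v) \<in> B \<longrightarrow> (\<forall>v\<in>f ` S. c v = 0)" "(\<Sum>v\<in>S. c v *\<^sub>C v) \<in> B"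
      then show "\<forall>v\<in>S. c v = 0"
        by (auto dest!: spec[of _ "\<lambda>w. c (inv_into S f w)"] simp: inj inv_into_f_f cong: sum.cong)
    next
      fix c assume "\<forall>c. (\<Sum>v\<in>S. c v *\<^sub>C v) \<in> B \<longrightarrow> (\<forall>v\<in>S. c v = 0)" "(\<Sum>v\<in>S. c (f v) *\<^sub>C v) \<in> B"
      then show "\<forall>v\<in>f ` S. c v = 0" by (auto dest: spec[of _ "\<lambda>v. c (f v)"])
    qed
  qed
  have "(\<lambda>S. enat (card S)) ` {S. finite S \<and> S \<subseteq> f ` Z \<and> independent_mod (f ` B) S}
      = (\<lambda>S. enat (card S)) ` {S. finite S \<and> S \<subseteq> Z \<and> independent_mod B S}" (is "?L = ?R")
  proof (intro equalityI subsetI)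
    fix n assume "n \<in> ?L"
    then obtain S where S: "n = enat (card S)" "finite S" "S \<subseteq> f ` Z" "independent_mod (f ` B) S" by auto
    then obtain T where T: "T \<subseteq> Z" "finite T" "S = f ` T" by (metis finite_subset_image)
    have "T \<subseteq> W" using T(1) assms(4) by blast
    then have "independent_mod B T" "card S = card T"
      using S ind[of T] T card_image[OF inj_on_subset[OF f(2)]] by auto
    then show "n \<in> ?R" using S T by auto
  next
    fix n assume "n \<in> ?R"
    then obtain T where T: "n = enat (card T)" "finite T" "T \<subseteq> Z" "independent_mod B T" by auto
    have "T \<subseteq> W" using T assms(4) by blast
    then have "independent_mod (f ` B) (f ` T)" "card (f ` T) = card T"
      using ind[of T] T card_image[OF inj_on_subset[OF f(2)]] by auto
    then show "n \<in> ?L" using T by (auto intro!: image_eqI[of _ _ "f ` T"])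
  qed
  then show ?thesis unfolding quotient_dim_def by simp
qed

text \<open>A degreewise bijective chain map carries cocycles onto cocycles and coboundaries onto
  coboundaries.\<close>

lemma cohomology_dim_iso:
  assumes C: "\<And>j. csubspace (C j)" "\<And>j t. t \<in> C j \<Longrightarrow> d t \<in> C (Suc j)"
    and F: "\<And>j. linear_on (C j) F" "\<And>j. inj_on F (C j)" "\<And>j. F ` C j = C' j"
    and chain: "\<And>j t. t \<in> C j \<Longrightarrow> F (d t) = d' (F t)"
  shows "cohomology_dim C d i = cohomology_dim C' d' i"
proof -
  have F0: "F 0 = 0" by (rule linear_on_0[OF C(1) F(1)])
  have "d' (F t) = 0 \<longleftrightarrow> d t = 0" if "t \<in> C i" for t
    using inj_on_eq_iff[OF F(2) C(2)[OF that] cvs.subspace_0[OF C(1)]] chain[OF that] F0 by simp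
  then have Z: "{c \<in> C' i. d' c = 0} = F ` {t \<in> C i. d t = 0}"
    unfolding F(3)[symmetric] by auto
  have B: "(case i of 0 \<Rightarrow> {0} | Suc j \<Rightarrow> d' ` C' j) = F ` (case i of 0 \<Rightarrow> {0} | Suc j \<Rightarrow> d ` C j)"
    unfolding F(3)[symmetric] using F0 by (auto split: nat.split simp: image_image chain)
  have "(case i of 0 \<Rightarrow> {0} | Suc j \<Rightarrow> d ` C j) \<subseteq> C i"
    using C by (auto split: nat.split intro: cvs.subspace_0)
  then show ?thesis
    unfolding cohomology_dim_def Z B
    by (intro quotient_dim_image[OF C(1) F(1,2), symmetric]) auto
qed

section \<open>Linear extension to finitely supported functions\<close>

definition linear_extension :: "('x \<Rightarrow> 'b::complex_vector) \<Rightarrow> ('x \<Rightarrow>\<^sub>0 complex) \<Rightarrow> 'b" where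
  "linear_extension g p = (\<Sum>t\<in>Poly_Mapping.keys p. Poly_Mapping.lookup p t *\<^sub>C g t)"

lemma linear_extension_superset:
  assumes "finite K" "Poly_Mapping.keys p \<subseteq> K"
  shows "linear_extension g p = (\<Sum>t\<in>K. Poly_Mapping.lookup p t *\<^sub>C g t)"
  unfolding linear_extension_def using assms
  by (intro sum.mono_neutral_left) (auto simp: in_keys_iff)

lemma lookup_scaleC [simp]: "Poly_Mapping.lookup (c *\<^sub>C p) t = c *\<^sub>C Poly_Mapping.lookup p t"
  by transfer simp

lemma keys_scaleC: "Poly_Mapping.keys (c *\<^sub>C p) \<subseteq> Poly_Mapping.keys (p :: 'x \<Rightarrow>\<^sub>0 complex)"
  by (auto simp: in_keys_iff scaleC_complex_def)

lemma linear_extension_add: "linear_extension g (p + q) = linear_extension g p + linear_extension g q"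
proof -
  let ?K = "Poly_Mapping.keys p \<union> Poly_Mapping.keys q"
  have "Poly_Mapping.keys (p + q) \<subseteq> ?K" by (rule Poly_Mapping.keys_add)
  then show ?thesis
    by (simp add: linear_extension_superset[of ?K] lookup_add scaleC_add_left sum.distrib)
qed

lemma linear_extension_scaleC: "linear_extension g (c *\<^sub>C p) = c *\<^sub>C linear_extension g p"
  using keys_scaleC[of c p]
  by (simp add: linear_extension_superset[of "Poly_Mapping.keys p"] scaleC_complex_def cvs.scale_sum_right)

lemma linear_extension_single [simp]: "linear_extension g (Poly_Mapping.single t c) = c *\<^sub>C g t"
  by (cases "c = 0") (simp_all add: linear_extension_def)

lemma linear_on_linear_extension: "linear_on W (linear_extension g)"
  by (simp add: linear_on_def linear_extension_add linear_extension_scaleC)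

lemma linear_extension_diff: "linear_extension g (p - q) = linear_extension g p - linear_extension g q"
  using linear_on_diff[OF cvs.subspace_UNIV linear_on_linear_extension] by simp

lemma scaleC_single: "c *\<^sub>C Poly_Mapping.single t d = Poly_Mapping.single t (c *\<^sub>C d)"
  by transfer (auto simp: fun_eq_iff when_def)

lemma linear_extension_single_id: "linear_extension (\<lambda>t. Poly_Mapping.single t 1) p = p"
proof (rule poly_mapping_eqI)
  fix s
  have "Poly_Mapping.lookup (linear_extension (\<lambda>t. Poly_Mapping.single t 1) p) s
      = (\<Sum>t\<in>Poly_Mapping.keys p. if t = s then Poly_Mapping.lookup p s else 0)"
    by (auto simp: linear_extension_def lookup_sum scaleC_single lookup_single scaleC_complex_def
        when_def intro!: sum.cong)
  then show "Poly_Mapping.lookup (linear_extension (\<lambda>t. Poly_Mapping.single t 1) p) s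
      = Poly_Mapping.lookup p s"
    by (simp add: in_keys_iff)
qed

lemma linear_linear_extension:
  assumes "linear_on UNIV h"
  shows "h (linear_extension g p) = linear_extension (\<lambda>t. h (g t)) p"
  unfolding linear_extension_def by (rule linear_on_sum[OF cvs.subspace_UNIV assms]) simp

lemma linear_extension_plus:
  "linear_extension (\<lambda>t. g t + h t) p = linear_extension g p + linear_extension h p"
  "linear_extension (\<lambda>t. c *\<^sub>C g t) p = c *\<^sub>C linear_extension g p"
  by (simp_all add: linear_extension_def scaleC_add_right sum.distrib cvs.scale_sum_right
      scaleC_scaleC mult.commute)

section \<open>Tensor products\<close>

lemma pure_tensor_add:
  "(a + a') \<otimes> b = a \<otimes> b + a' \<otimes> b" "a \<otimes> (b + b') = a \<otimes> b + a \<otimes> b'"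
  "(c *\<^sub>C a) \<otimes> b = c *\<^sub>C (a \<otimes> b)" "a \<otimes> (c *\<^sub>C b) = c *\<^sub>C (a \<otimes> b)"
  by (transfer; unfold tensor_rel_def diff_diff_eq[symmetric]; rule cvs.span_base;
      unfold tensor_relations_def; blast)+

lemma pure_tensor_0 [simp]: "0 \<otimes> b = 0" "a \<otimes> 0 = 0"
  using pure_tensor_add(3)[of 0 0 b] pure_tensor_add(4)[of a 0 0] by simp_all

lemma bilinear_onD:
  assumes "bilinear_on W W' f"
  shows "x \<in> W \<Longrightarrow> x' \<in> W \<Longrightarrow> y \<in> W' \<Longrightarrow> f (x + x') y = f x y + f x' y"
    "x \<in> W \<Longrightarrow> y \<in> W' \<Longrightarrow> y' \<in> W' \<Longrightarrow> f x (y + y') = f x y + f x y'"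
    "x \<in> W \<Longrightarrow> y \<in> W' \<Longrightarrow> f (c *\<^sub>C x) y = c *\<^sub>C f x y"
    "x \<in> W \<Longrightarrow> y \<in> W' \<Longrightarrow> f x (c *\<^sub>C y) = c *\<^sub>C f x y"
  using assms by (auto simp: bilinear_on_def linear_on_def)

lemma bilinear_onI:
  assumes "\<And>x x' y. x \<in> W \<Longrightarrow> x' \<in> W \<Longrightarrow> y \<in> W' \<Longrightarrow> f (x + x') y = f x y + f x' y"
    "\<And>x y y'. x \<in> W \<Longrightarrow> y \<in> W' \<Longrightarrow> y' \<in> W' \<Longrightarrow> f x (y + y') = f x y + f x y'"
    "\<And>x y c. x \<in> W \<Longrightarrow> y \<in> W' \<Longrightarrow> f (c *\<^sub>C x) y = c *\<^sub>C f x y"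
    "\<And>x y c. x \<in> W \<Longrightarrow> y \<in> W' \<Longrightarrow> f x (c *\<^sub>C y) = c *\<^sub>C f x y"
  shows "bilinear_on W W' f"
  using assms by (auto simp: bilinear_on_def linear_on_def)

lemma linear_on_bilinear:
  assumes "bilinear_on UNIV UNIV m"
  shows "linear_on W f \<Longrightarrow> linear_on W (\<lambda>x. m (f x) y)" "linear_on W g \<Longrightarrow> linear_on W (\<lambda>x. m z (g x))"
  by (simp_all add: linear_on_def bilinear_onD[OF assms])

text \<open>The linear extension of \<open>\<beta>\<close> to formal combinations of pairs kills the defining
  relations of the tensor product, because \<open>\<beta>\<close> is bilinear; so it descends to the quotient.\<close>

lemma tensor_universal:
  assumes "bilinear_on UNIV UNIV (\<beta> :: 'a::complex_vector \<Rightarrow> 'b::complex_vector \<Rightarrow> 'c::complex_vector)"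
  obtains h where "linear_on UNIV h" "\<And>a b. h (a \<otimes> b) = \<beta> a b"
proof -
  let ?g = "linear_extension (\<lambda>(a, b). \<beta> a b)"
  note bl = bilinear_onD[OF assms, simplified]
  have kernel: "?g r = 0" if "r \<in> cspan tensor_relations" for r
  proof (rule linear_on_eq_span[OF linear_on_linear_extension linear_on_closed(3) _ that])
    show "?g r = 0" if "r \<in> tensor_relations" for r
      using that unfolding tensor_relations_def
      by (auto simp: linear_extension_diff linear_extension_scaleC bl)
  qed
  define h where "h t = ?g (rep_tensor t)" for t :: "('a, 'b) tensor"
  have h: "h (abs_tensor p) = ?g p" for p
  proof -
    have "tensor_rel (rep_tensor (abs_tensor p)) p"
      by (rule Quotient3_rep_abs[OF Quotient3_tensor]) (simp add: tensor_rel_def cvs.span_zero)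
    then have "?g (rep_tensor (abs_tensor p) - p) = 0"
      unfolding tensor_rel_def by (rule kernel)
    then show ?thesis by (simp add: h_def linear_extension_diff)
  qed
  show ?thesis
  proof
    show "linear_on UNIV h"
      unfolding linear_on_def
    proof (intro conjI ballI allI)
      fix x y :: "('a, 'b) tensor" and c
      obtain p q where p: "x = abs_tensor p" "y = abs_tensor q"
        using Quotient3_abs_rep[OF Quotient3_tensor] by metis
      show "h (x + y) = h x + h y"
        unfolding p plus_tensor.abs_eq h linear_extension_add ..
      show "h (c *\<^sub>C x) = c *\<^sub>C h x"
        unfolding p scaleC_tensor.abs_eq h linear_extension_scaleC ..
    qed
    show "h (a \<otimes> b) = \<beta> a b" for a b
      unfolding pure_tensor.abs_eq h by simp
  qed
qed

lemma csubspace_tensor_space: "csubspace (tensor_space W)"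
  by (simp add: tensor_space_def)

lemma pure_in_tensor_space: "a \<in> W \<Longrightarrow> a \<otimes> b \<in> tensor_space W"
  unfolding tensor_space_def by (rule cvs.span_base) blast

lemma tensor_space_mono: "W \<subseteq> U \<Longrightarrow> tensor_space W \<subseteq> tensor_space U"
  unfolding tensor_space_def by (rule cvs.span_mono) blast

lemma tensor_eqI:
  assumes "linear_on (tensor_space W) f" "linear_on (tensor_space W) g"
    "\<And>a b. a \<in> W \<Longrightarrow> f (a \<otimes> b) = g (a \<otimes> b)" "t \<in> tensor_space W"
  shows "f t = g t"
  using linear_on_eq_span[OF assms(1,2)[unfolded tensor_space_def], of t] assms(3,4)
  by (auto simp: tensor_space_def)

lemma linear_on_tensor_space_into:
  assumes "linear_on (tensor_space W) f" "\<And>a b. a \<in> W \<Longrightarrow> f (a \<otimes> b) \<in> U" "csubspace U"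
    "t \<in> tensor_space W"
  shows "f t \<in> U"
  using linear_on_span_into[OF assms(1)[unfolded tensor_space_def] _ assms(3), of t] assms(2,4)
  unfolding tensor_space_def by blast

text \<open>A bilinear map on a subspace of the left factor extends to the whole factor along a
  projection; the induced map on the subspace does not depend on the projection.\<close>

lemma tensor_lift:
  assumes "csubspace W" "bilinear_on W UNIV \<beta>"
  shows "tensor_lift W \<beta> \<in> hom_space (tensor_space W)"
    and "a \<in> W \<Longrightarrow> tensor_lift W \<beta> (a \<otimes> b) = \<beta> a b"
proof -
  obtain p where p: "linear_on UNIV p" "\<And>x. p x \<in> W" "\<And>x. x \<in> W \<Longrightarrow> p x = x"
    using linear_projection[OF assms(1)] by blast
  have "bilinear_on UNIV UNIV (\<lambda>a b. \<beta> (p a) b)"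
    by (rule bilinear_onI) (simp_all add: linear_onD[OF p(1)] p(2) bilinear_onD[OF assms(2)])
  then obtain h where h: "linear_on UNIV h" "\<And>a b. h (a \<otimes> b) = \<beta> (p a) b"
    by (rule tensor_universal) blast
  let ?P = "\<lambda>h. h \<in> hom_space (tensor_space W) \<and> (\<forall>a\<in>W. \<forall>b. h (a \<otimes> b) = \<beta> a b)"
  let ?h = "\<lambda>t. if t \<in> tensor_space W then h t else 0"
  have ex: "?P ?h"
    using h p(3) linear_onD[OF h(1)]
    by (auto simp: hom_space_def linear_on_def pure_in_tensor_space
        cvs.subspace_add[OF csubspace_tensor_space] cvs.subspace_scale[OF csubspace_tensor_space])
  have uniq: "h1 = h2" if "?P h1" "?P h2" for h1 h2
  proof (rule hom_space_ext[of h1 "tensor_space W" h2])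
    show "h1 t = h2 t" if "t \<in> tensor_space W" for t
      using \<open>?P h1\<close> \<open>?P h2\<close> by - (rule tensor_eqI[OF _ _ _ that]; simp add: hom_spaceD(1))
  qed (use that in simp_all)
  have "?P (tensor_lift W \<beta>)"
    unfolding tensor_lift_def by (rule theI[of ?P ?h]) (rule ex, erule uniq, rule ex)
  then show "tensor_lift W \<beta> \<in> hom_space (tensor_space W)"
    "a \<in> W \<Longrightarrow> tensor_lift W \<beta> (a \<otimes> b) = \<beta> a b" by auto
qed

lemma tensor_lift_linear:
  assumes "csubspace W" "bilinear_on W UNIV \<beta>"
  shows "linear_on (tensor_space W) (tensor_lift W \<beta>)"
  using tensor_lift(1)[OF assms] by (rule hom_spaceD)

lemma tensor_lift_unique:
  assumes "csubspace W" "bilinear_on W UNIV \<beta>" "linear_on (tensor_space W) h"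
    "\<And>a b. a \<in> W \<Longrightarrow> h (a \<otimes> b) = \<beta> a b" "t \<in> tensor_space W"
  shows "tensor_lift W \<beta> t = h t"
  using tensor_eqI[OF tensor_lift_linear[OF assms(1,2)] assms(3) _ assms(5)] assms
  by (simp add: tensor_lift(2))

text \<open>With a basis \<open>E\<close> of the right factor, every tensor has coordinates in \<open>W\<close>. The right factors
  below are finite-dimensional, while \<open>W\<close> may be a component of \<open>A\<close> of infinite dimension.\<close>

lemma tensor_space_expand:
  assumes "csubspace W" "finite E" "\<And>v. v = (\<Sum>e\<in>E. \<kappa> e v *\<^sub>C e)" "t \<in> tensor_space W"
  obtains w where "t = (\<Sum>e\<in>E. w e \<otimes> e)" "\<And>e. w e \<in> W"
proof -
  have pure: "a \<otimes> b = (\<Sum>e\<in>E. (\<kappa> e b *\<^sub>C a) \<otimes> e)" for a :: 'a and b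
  proof -
    have "linear_on UNIV ((\<otimes>) a)" by (simp add: linear_on_def pure_tensor_add)
    then have *: "a \<otimes> (\<Sum>e\<in>E. \<kappa> e b *\<^sub>C e) = (\<Sum>e\<in>E. \<kappa> e b *\<^sub>C (a \<otimes> e))"
      by (intro linear_on_sum[OF cvs.subspace_UNIV]) auto
    have "a \<otimes> b = a \<otimes> (\<Sum>e\<in>E. \<kappa> e b *\<^sub>C e)"
      by (rule arg_cong[OF assms(3)])
    with * show ?thesis by (simp add: pure_tensor_add)
  qed
  have "\<exists>w. t = (\<Sum>e\<in>E. w e \<otimes> e) \<and> (\<forall>e. w e \<in> W)"
    using assms(4) unfolding tensor_space_def
  proof (induction rule: cvs.span_induct_alt)
    case base
    show ?case by (rule exI[of _ "\<lambda>_. 0"]) (simp add: cvs.subspace_0 assms(1))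
  next
    case (step c x y)
    then obtain a b w where x: "x = a \<otimes> b" "a \<in> W" and y: "y = (\<Sum>e\<in>E. w e \<otimes> e)" "\<forall>e. w e \<in> W" by blast
    have "c *\<^sub>C x + y = (\<Sum>e\<in>E. (c *\<^sub>C \<kappa> e b *\<^sub>C a + w e) \<otimes> e)"
      unfolding x(1) y(1) pure[of a b] by (simp add: pure_tensor_add sum.distrib cvs.scale_sum_right)
    moreover have "\<forall>e. c *\<^sub>C \<kappa> e b *\<^sub>C a + w e \<in> W"
      using x(2) y(2) assms(1) by (auto intro!: cvs.subspace_add cvs.subspace_scale)
    ultimately show ?case by (rule_tac exI) (rule conjI)
  qed
  with that show ?thesis by blast
qed

text \<open>This is \<open>\<phi> \<otimes> id\<close>, followed by the action of the scalars on \<open>X\<close>. For \<open>W = A\<^sup>1\<close> it gives the values of \<open>psi\<close>.\<close>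

definition slant :: "'a::complex_vector set \<Rightarrow> ('a \<Rightarrow> complex) \<Rightarrow> ('a, 'x::complex_vector) tensor \<Rightarrow> 'x" where
  "slant W \<phi> = tensor_lift W (\<lambda>a x. \<phi> a *\<^sub>C x)"

lemma slant_bilinear:
  "\<phi> \<in> dual_space W \<Longrightarrow> bilinear_on W UNIV (\<lambda>a x. \<phi> a *\<^sub>C (x::'x::complex_vector))"
  by (rule bilinear_onI)
    (auto dest!: hom_spaceD(1) simp: linear_onD scaleC_add_left scaleC_add_right scaleC_complex_def mult.commute)

lemma slant:
  assumes "csubspace W" "\<phi> \<in> dual_space W"
  shows slant_hom: "slant W \<phi> \<in> hom_space (tensor_space W)"
    and slant_pure: "a \<in> W \<Longrightarrow> slant W \<phi> (a \<otimes> x) = \<phi> a *\<^sub>C x"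
    and slant_linear: "linear_on (tensor_space W) (slant W \<phi>)"
  unfolding slant_def using tensor_lift[OF assms(1) slant_bilinear[OF assms(2)]]
  by (auto dest: hom_spaceD(1))

lemma slant_linear_left:
  assumes W: "csubspace W" and t: "t \<in> tensor_space W"
  shows "linear_on (dual_space W) (\<lambda>\<phi>. slant W \<phi> t)"
proof -
  have sub: "\<phi> + \<psi> \<in> dual_space W" "c *\<^sub>C \<phi> \<in> dual_space W"
    if "\<phi> \<in> dual_space W" "\<psi> \<in> dual_space W" for \<phi> \<psi> c
    using that csubspace_hom_space by (auto intro: cvs.subspace_add cvs.subspace_scale)
  have "slant W (\<phi> + \<psi>) t = slant W \<phi> t + slant W \<psi> t"
    if "\<phi> \<in> dual_space W" "\<psi> \<in> dual_space W" for \<phi> \<psi>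
  proof (rule tensor_eqI[OF _ _ _ t])
    show "linear_on (tensor_space W) (slant W (\<phi> + \<psi>))"
      "linear_on (tensor_space W) (\<lambda>t. slant W \<phi> t + slant W \<psi> t)"
      using that by (auto intro!: linear_on_closed slant_linear[OF W] sub)
    show "slant W (\<phi> + \<psi>) (a \<otimes> b) = slant W \<phi> (a \<otimes> b) + slant W \<psi> (a \<otimes> b)" if "a \<in> W" for a b
      unfolding slant_pure[OF W sub(1)[OF \<open>\<phi> \<in> _\<close> \<open>\<psi> \<in> _\<close>] that] slant_pure[OF W \<open>\<phi> \<in> _\<close> that]
        slant_pure[OF W \<open>\<psi> \<in> _\<close> that] by (simp add: scaleC_add_left)
  qed
  moreover have "slant W (c *\<^sub>C \<phi>) t = c *\<^sub>C slant W \<phi> t"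
    if "\<phi> \<in> dual_space W" for \<phi> c
  proof (rule tensor_eqI[OF _ _ _ t])
    show "linear_on (tensor_space W) (slant W (c *\<^sub>C \<phi>))"
      "linear_on (tensor_space W) (\<lambda>t. c *\<^sub>C slant W \<phi> t)"
      using that by (auto intro!: linear_on_closed slant_linear[OF W] sub)
    show "slant W (c *\<^sub>C \<phi>) (a \<otimes> b) = c *\<^sub>C slant W \<phi> (a \<otimes> b)" if "a \<in> W" for a b
      unfolding slant_pure[OF W sub(2)[OF \<open>\<phi> \<in> _\<close> \<open>\<phi> \<in> _\<close>] that] slant_pure[OF W \<open>\<phi> \<in> _\<close> that]
      by (simp add: scaleC_complex_def)
  qed
  ultimately show ?thesis by (simp add: linear_on_def)
qed

lemma slant_expand:
  assumes "csubspace W" "\<phi> \<in> dual_space W" "\<And>e. w e \<in> W"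
  shows "slant W \<phi> (\<Sum>e\<in>E. w e \<otimes> e) = (\<Sum>e\<in>E. \<phi> (w e) *\<^sub>C e)"
  using linear_on_sum[OF csubspace_tensor_space slant_linear[OF assms(1,2)], of E "\<lambda>e. w e \<otimes> e" "\<lambda>_. 1"]
  by (simp add: assms pure_in_tensor_space slant_pure)

lemma basis_coefficients_zero:
  assumes "finite E" "\<And>e. \<kappa> e \<in> dual_space W" "\<And>e e'. e \<in> E \<Longrightarrow> e' \<in> E \<Longrightarrow> \<kappa> e e' = (if e = e' then 1 else 0)"
    "csubspace W" "E \<subseteq> W" "(\<Sum>e\<in>E. c e *\<^sub>C e) = 0" "e \<in> E"
  shows "c e = (0 :: complex)"
proof -
  have "0 = \<kappa> e (\<Sum>e\<in>E. c e *\<^sub>C e)"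
    using assms(6) linear_on_0[OF assms(4) hom_spaceD(1)[OF assms(2)]] by simp
  also have "\<dots> = (\<Sum>e'\<in>E. c e' *\<^sub>C \<kappa> e e')"
    using assms(5) by (intro linear_on_sum[OF assms(4) hom_spaceD(1)[OF assms(2)]]) auto
  also have "\<dots> = (\<Sum>e'\<in>E. if e' = e then c e else 0)"
    using assms(3,7) by (intro sum.cong) (auto simp: scaleC_complex_def)
  finally show ?thesis using assms(1,7) by simp
qed

text \<open>The coordinates of \<open>t\<close> with respect to a basis of the right factor are separated by the
  functionals on \<open>W\<close>. Through this lemma an equation in \<open>A\<^sup>2 \<otimes> X\<close>
  becomes a family of equations in \<open>X\<close>, one for each functional on \<open>A\<^sup>2\<close>.\<close>

lemma slant_separates:
  fixes t :: "('a::complex_vector, 'x::complex_vector) tensor"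
  assumes W: "csubspace W" and "fin_dim (UNIV :: 'x set)" "t \<in> tensor_space W"
    "\<And>\<phi>. \<phi> \<in> dual_space W \<Longrightarrow> slant W \<phi> t = 0"
  shows "t = 0"
proof -
  obtain E and \<kappa> :: "'x \<Rightarrow> 'x \<Rightarrow> complex" where E: "finite E" "\<And>b. \<kappa> b \<in> dual_space UNIV"
    "\<And>x. x = (\<Sum>b\<in>E. \<kappa> b x *\<^sub>C b)"
    "\<And>b b'. b \<in> E \<Longrightarrow> b' \<in> E \<Longrightarrow> \<kappa> b b' = (if b = b' then 1 else 0)"
    by (rule finite_dual_basis[OF assms(2)]) auto
  obtain w where w: "t = (\<Sum>e\<in>E. w e \<otimes> e)" "\<And>e. w e \<in> W"
    using tensor_space_expand[OF W E(1,3) assms(3)] by blast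
  have "w e = 0" if "e \<in> E" for e
  proof (rule ccontr)
    assume "w e \<noteq> 0"
    then obtain \<phi> where \<phi>: "\<phi> \<in> dual_space W" "\<phi> (w e) \<noteq> 0"
      using functional_nonzero[OF W w(2)] by blast
    have "(\<Sum>e\<in>E. \<phi> (w e) *\<^sub>C e) = 0"
      using assms(4)[OF \<phi>(1)] slant_expand[of W \<phi> w E, OF W \<phi>(1) w(2)] w(1) by simp
    then show False
      using basis_coefficients_zero[OF E(1,2,4) cvs.subspace_UNIV, of "\<lambda>e. \<phi> (w e)" e] that \<phi>(2) by simp
  qed
  then show ?thesis using w(1) by simp
qed

section \<open>Differential and product on tensors over a cdga\<close>

lemma psi_eq: "psi A \<omega> = (\<lambda>u. if u \<in> dual_space (grade A 1) then slant (grade A 1) u \<omega> else 0)"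
  unfolding psi_def slant_def ..

text \<open>The data from which a relator of the holonomy Lie algebra is built: a functional on
  \<open>A\<^sup>2\<close> together with a way to write its image under \<open>\<union>\<^sup>*\<close> in the exterior square of
  \<open>A\<^sub>1\<close>.\<close>

definition cup_presentation :: "'a::complex_vector cdga \<Rightarrow> ('a \<Rightarrow> complex)
    \<Rightarrow> (('a \<Rightarrow> complex) \<times> ('a \<Rightarrow> complex)) list \<Rightarrow> bool" where
  "cup_presentation A \<phi> ps \<longleftrightarrow> \<phi> \<in> dual_space (grade A 2) \<and>
     set ps \<subseteq> dual_space (grade A 1) \<times> dual_space (grade A 1) \<and>
     cup_dual A \<phi> = (\<Sum>(u, v)\<leftarrow>ps. wedge2 u v)"

text \<open>A linear map \<open>f\<close> from \<open>A\<^sub>1\<close> to a Lie algebra extends to the free Lie algebra; this is the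
  condition that the extension kills \<open>d\<^sup>*(\<phi>) + \<union>\<^sup>*(\<phi>)\<close> for all functionals \<open>\<phi>\<close> on
  \<open>A\<^sup>2\<close>. It is imposed for every presentation of \<open>\<union>\<^sup>*(\<phi>)\<close> as a sum of terms
  \<open>u \<and> v\<close>, exactly as in the definition of the relators.\<close>

definition satisfies_relators :: "'a::complex_vector cdga \<Rightarrow> ('k::complex_vector \<Rightarrow> 'k \<Rightarrow> 'k)
    \<Rightarrow> (('a \<Rightarrow> complex) \<Rightarrow> 'k) \<Rightarrow> bool" where
  "satisfies_relators A br f \<longleftrightarrow>
     (\<forall>\<phi> ps. cup_presentation A \<phi> ps \<longrightarrow> f (diff_dual A \<phi>) + (\<Sum>(u, v)\<leftarrow>ps. br (f u) (f v)) = 0)"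

context cdga
begin

lemma csubspace_total: "csubspace (total_space A)"
  by (simp add: total_space_def)

lemma grade_total: "grade A i \<subseteq> total_space A"
  unfolding total_space_def by (metis UNIV_I UN_I cvs.span_base subsetI)

lemma in_total: "a \<in> grade A i \<Longrightarrow> a \<in> total_space A"
  using grade_total by blast

lemma tensor_total: "tensor_space (grade A i) \<subseteq> tensor_space (total_space A)"
  by (rule tensor_space_mono[OF grade_total])

lemma diff_bilinear: "bilinear_on (total_space A) UNIV (\<lambda>\<alpha> v. diff A \<alpha> \<otimes> v)"
  by (rule bilinear_onI) (simp_all add: linear_onD[OF linear_diff] pure_tensor_add)

lemma tensor_diff_pure:
  "\<alpha> \<in> grade A i \<Longrightarrow> tensor_diff A (\<alpha> \<otimes> v) = diff A \<alpha> \<otimes> v"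
  using grade_total unfolding tensor_diff_def by (blast intro: tensor_lift(2)[OF csubspace_total diff_bilinear])

lemma tensor_diff_linear: "linear_on (tensor_space (grade A i)) (tensor_diff A)"
  unfolding tensor_diff_def
  by (rule linear_on_subset[OF tensor_lift_linear[OF csubspace_total diff_bilinear] tensor_total])

lemma tensor_diff_grade:
  assumes "t \<in> tensor_space (grade A i)"
  shows "tensor_diff A t \<in> tensor_space (grade A (Suc i))"
  by (rule linear_on_tensor_space_into[OF tensor_diff_linear _ csubspace_tensor_space assms])
    (simp add: tensor_diff_pure diff_grade pure_in_tensor_space)

text \<open>The product is a lift in each variable. That the inner lift is bilinear in the parameters
  \<open>\<eta>\<close> and \<open>x\<close> follows from the uniqueness of lifts: both sides of each identity induce the same bilinear
  map on pure tensors.\<close>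

lemma tensor_mult:
  assumes m: "bilinear_on UNIV UNIV m"
  shows tensor_mult_bilinear:
      "bilinear_on (tensor_space (grade A i)) (tensor_space (grade A j)) (tensor_mult A m)"
    and tensor_mult_pure: "\<eta> \<in> grade A i \<Longrightarrow> \<alpha> \<in> grade A j
      \<Longrightarrow> tensor_mult A m (\<eta> \<otimes> x) (\<alpha> \<otimes> v) = mult A \<eta> \<alpha> \<otimes> m x v"
proof -
  let ?T = "total_space A"
  let ?g = "\<lambda>\<eta> x. tensor_lift ?T (\<lambda>\<alpha> v. mult A \<eta> \<alpha> \<otimes> m x v)"
  note ml = bilinear_onD[OF bilinear_mult] bilinear_onD[OF m, simplified] pure_tensor_add
  note T = csubspace_total
  have 1: "bilinear_on ?T UNIV (\<lambda>\<alpha> v. mult A \<eta> \<alpha> \<otimes> m x v)" if "\<eta> \<in> ?T" for \<eta> x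
    by (rule bilinear_onI) (simp_all add: ml that)
  note lin = tensor_lift_linear[OF T 1] and pure = tensor_lift(2)[OF T 1]
  note sum = cvs.subspace_add[OF T] cvs.subspace_scale[OF T]
  have 2: "bilinear_on ?T UNIV (\<lambda>\<eta> x. ?g \<eta> x t)" if t: "t \<in> tensor_space ?T" for t
  proof (rule bilinear_onI)
    show "?g (\<eta> + \<eta>') x t = ?g \<eta> x t + ?g \<eta>' x t" if "\<eta> \<in> ?T" "\<eta>' \<in> ?T" for \<eta> \<eta>' x
      by (rule tensor_lift_unique[OF T 1 linear_on_closed(1)[OF lin lin] _ t])
        (simp_all add: that sum pure ml)
    show "?g \<eta> (x + x') t = ?g \<eta> x t + ?g \<eta> x' t" if "\<eta> \<in> ?T" for \<eta> x x'
      by (rule tensor_lift_unique[OF T 1 linear_on_closed(1)[OF lin lin] _ t])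
        (simp_all add: that sum pure ml)
    show "?g (c *\<^sub>C \<eta>) x t = c *\<^sub>C ?g \<eta> x t" if "\<eta> \<in> ?T" for \<eta> x c
      by (rule tensor_lift_unique[OF T 1 linear_on_closed(2)[OF lin] _ t])
        (simp_all add: that sum pure ml)
    show "?g \<eta> (c *\<^sub>C x) t = c *\<^sub>C ?g \<eta> x t" if "\<eta> \<in> ?T" for \<eta> x c
      by (rule tensor_lift_unique[OF T 1 linear_on_closed(2)[OF lin] _ t])
        (simp_all add: that sum pure ml)
  qed
  have def': "tensor_mult A m \<omega> t = tensor_lift ?T (\<lambda>\<eta> x. ?g \<eta> x t) \<omega>" for \<omega> t
    by (simp add: tensor_mult_def)
  have left: "linear_on (tensor_space ?T) (\<lambda>\<omega>. tensor_mult A m \<omega> t)"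
    if "t \<in> tensor_space ?T" for t
    unfolding def' by (rule tensor_lift_linear[OF T 2[OF that]])
  have pure1: "tensor_mult A m (\<eta> \<otimes> x) t = ?g \<eta> x t" if "\<eta> \<in> ?T" "t \<in> tensor_space ?T" for \<eta> x t
    unfolding def' by (rule tensor_lift(2)[OF T 2[OF that(2)] that(1)])
  note Tsub = cvs.subspace_add[OF csubspace_tensor_space] cvs.subspace_scale[OF csubspace_tensor_space]
  have right: "linear_on (tensor_space ?T) (tensor_mult A m \<omega>)" if "\<omega> \<in> tensor_space ?T" for \<omega>
  proof -
    have "tensor_mult A m \<omega> (s + t) = tensor_mult A m \<omega> s + tensor_mult A m \<omega> t"
      if st: "s \<in> tensor_space ?T" "t \<in> tensor_space ?T" for s t
    proof (rule tensor_eqI[OF _ _ _ \<open>\<omega> \<in> _\<close>])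
      show "linear_on (tensor_space ?T) (\<lambda>\<omega>. tensor_mult A m \<omega> (s + t))"
        "linear_on (tensor_space ?T) (\<lambda>\<omega>. tensor_mult A m \<omega> s + tensor_mult A m \<omega> t)"
        using st by (auto intro!: left Tsub linear_on_closed)
    qed (simp add: st Tsub pure1 linear_onD[OF lin])
    moreover have "tensor_mult A m \<omega> (c *\<^sub>C t) = c *\<^sub>C tensor_mult A m \<omega> t"
      if st: "t \<in> tensor_space ?T" for t c
    proof (rule tensor_eqI[OF _ _ _ \<open>\<omega> \<in> _\<close>])
      show "linear_on (tensor_space ?T) (\<lambda>\<omega>. tensor_mult A m \<omega> (c *\<^sub>C t))"
        "linear_on (tensor_space ?T) (\<lambda>\<omega>. c *\<^sub>C tensor_mult A m \<omega> t)"
        using st by (auto intro!: left Tsub linear_on_closed)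
    qed (simp add: st Tsub pure1 linear_onD[OF lin])
    ultimately show ?thesis by (simp add: linear_on_def)
  qed
  show "bilinear_on (tensor_space (grade A i)) (tensor_space (grade A j)) (tensor_mult A m)"
    unfolding bilinear_on_def
    by (auto intro!: subsetD[OF tensor_total] linear_on_subset[OF left tensor_total] linear_on_subset[OF right tensor_total])
  show "tensor_mult A m (\<eta> \<otimes> x) (\<alpha> \<otimes> v) = mult A \<eta> \<alpha> \<otimes> m x v"
    if "\<eta> \<in> grade A i" "\<alpha> \<in> grade A j"
  proof -
    have "\<eta> \<in> ?T" "\<alpha> \<in> ?T" using that grade_total by blast+
    then show ?thesis by (simp add: pure1 pure pure_in_tensor_space)
  qed
qed

lemma tensor_mult_linear:
  assumes "bilinear_on UNIV UNIV m"
  shows "\<omega> \<in> tensor_space (grade A i) \<Longrightarrow> linear_on (tensor_space (grade A j)) (tensor_mult A m \<omega>)"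
    "t \<in> tensor_space (grade A j) \<Longrightarrow> linear_on (tensor_space (grade A i)) (\<lambda>\<omega>. tensor_mult A m \<omega> t)"
  using tensor_mult_bilinear[OF assms] unfolding bilinear_on_def by blast+

lemma tensor_mult_grade:
  assumes m: "bilinear_on UNIV UNIV m" and "\<omega> \<in> tensor_space (grade A i)" "t \<in> tensor_space (grade A j)"
  shows "tensor_mult A m \<omega> t \<in> tensor_space (grade A (i + j))"
proof (rule linear_on_tensor_space_into[OF tensor_mult_linear(2)[OF m assms(3)] _ csubspace_tensor_space assms(2)])
  fix a b assume a: "a \<in> grade A i"
  show "tensor_mult A m (a \<otimes> b) t \<in> tensor_space (grade A (i + j))"
  proof (rule linear_on_tensor_space_into[OF tensor_mult_linear(1)[OF m] _ csubspace_tensor_space assms(3)])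
    show "a \<otimes> b \<in> tensor_space (grade A i)" using a by (rule pure_in_tensor_space)
    show "tensor_mult A m (a \<otimes> b) (c \<otimes> d) \<in> tensor_space (grade A (i + j))" if "c \<in> grade A j" for c d
      using a that by (simp add: tensor_mult_pure[OF m] mult_grade pure_in_tensor_space)
  qed
qed

lemma twisted_diff_grade:
  assumes "bilinear_on UNIV UNIV \<theta>" "\<omega> \<in> tensor_space (grade A 1)" "t \<in> tensor_space (grade A i)"
  shows "twisted_diff A \<theta> \<omega> t \<in> tensor_space (grade A (Suc i))"
  unfolding twisted_diff_def
  using tensor_diff_grade[OF assms(3)] tensor_mult_grade[OF assms]
  by (simp add: cvs.subspace_add[OF csubspace_tensor_space] plus_1_eq_Suc)

section \<open>Degree one tensors as homomorphisms\<close>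

lemma psi_pure:
  "u \<in> dual_space (grade A 1) \<Longrightarrow> \<eta> \<in> grade A 1 \<Longrightarrow> psi A (\<eta> \<otimes> x) u = u \<eta> *\<^sub>C x"
  by (simp add: psi_eq slant_pure[OF subspace_grade])

lemma psi_linear_at:
  "u \<in> dual_space (grade A 1) \<Longrightarrow> linear_on (tensor_space (grade A 1)) (\<lambda>\<omega>. psi A \<omega> u)"
  by (simp add: psi_eq slant_linear[OF subspace_grade])

lemma psi_in_hom_space_tensor: "psi A \<in> hom_space (tensor_space (grade A 1))"
proof -
  have "slant (grade A 1) u \<in> hom_space (tensor_space (grade A 1))" if "u \<in> dual_space (grade A 1)" for u
    using that by (rule slant_hom[OF subspace_grade])
  then show ?thesis
    by (fastforce simp: hom_space_def[of "tensor_space _"] linear_on_def psi_eq fun_eq_iff)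
qed

lemma psi_in_hom_space:
  "\<omega> \<in> tensor_space (grade A 1) \<Longrightarrow> psi A \<omega> \<in> hom_space (dual_space (grade A 1))"
  using slant_linear_left[OF subspace_grade, of \<omega> 1]
    cvs.subspace_add[OF csubspace_hom_space] cvs.subspace_scale[OF csubspace_hom_space]
  by (fastforce simp: hom_space_def[of "dual_space _"] linear_on_def psi_eq)

text \<open>With a basis of \<open>A\<^sup>1\<close> and the dual basis \<open>\<kappa>\<close>, a homomorphism \<open>f\<close>
  comes from \<open>\<Sum> b \<otimes> f (\<kappa> b)\<close>.\<close>

lemma bij_betw_psi:
  assumes "fin_dim (grade A 1)" "fin_dim (UNIV :: 'x::complex_vector set)"
  shows "bij_betw (psi A) (tensor_space (grade A 1) :: ('a, 'x) tensor set)
    (hom_space (dual_space (grade A 1)))"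
proof (rule bij_betw_imageI)
  let ?W = "grade A 1"
  let ?T = "tensor_space ?W :: ('a, 'x) tensor set"
  have lin: "linear_on ?T (psi A)" using psi_in_hom_space_tensor by (rule hom_spaceD)
  show "inj_on (psi A) ?T"
  proof (rule inj_onI)
    fix s t assume st: "s \<in> ?T" "t \<in> ?T" "psi A s = psi A t"
    have "s - t = 0"
    proof (rule slant_separates[OF subspace_grade assms(2)])
      show "s - t \<in> ?T" using st(1,2) by (rule cvs.subspace_diff[OF csubspace_tensor_space])
      fix \<phi> assume "\<phi> \<in> dual_space ?W"
      then have "slant ?W \<phi> (s - t) = psi A (s - t) \<phi>" by (simp add: psi_eq)
      also have "psi A (s - t) = psi A s - psi A t"
        by (rule linear_on_diff[OF csubspace_tensor_space lin st(1,2)])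
      finally show "slant ?W \<phi> (s - t) = 0" using st(3) by simp
    qed
    then show "s = t" by simp
  qed
  obtain B \<kappa> where B: "finite B" "B \<subseteq> ?W" "\<And>b. \<kappa> b \<in> dual_space ?W"
    "\<And>x. x \<in> ?W \<Longrightarrow> x = (\<Sum>b\<in>B. \<kappa> b x *\<^sub>C b)"
    by (rule finite_dual_basis[OF assms(1)]) blast
  have "f \<in> psi A ` ?T" if f: "f \<in> hom_space (dual_space ?W)" for f :: "('a \<Rightarrow> complex) \<Rightarrow> 'x"
  proof -
    \<comment> \<open>the preimage from the dual basis\<close>
    let ?\<omega> = "\<Sum>b\<in>B. b \<otimes> f (\<kappa> b)"
    have \<omega>: "?\<omega> \<in> ?T"
      using B(2) by (intro cvs.subspace_sum csubspace_tensor_space pure_in_tensor_space) auto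
    have "f u = psi A ?\<omega> u" if u: "u \<in> dual_space ?W" for u
    proof -
      have "u = (\<Sum>b\<in>B. u b *\<^sub>C \<kappa> b)"
      proof (rule hom_space_ext[OF u])
        show "(\<Sum>b\<in>B. u b *\<^sub>C \<kappa> b) \<in> dual_space ?W"
          by (intro cvs.subspace_sum cvs.subspace_scale csubspace_hom_space B(3))
        fix x assume x: "x \<in> ?W"
        have "u x = u (\<Sum>b\<in>B. \<kappa> b x *\<^sub>C b)" using B(4)[OF x] by (rule arg_cong)
        also have "\<dots> = (\<Sum>b\<in>B. \<kappa> b x *\<^sub>C u b)"
          using B(2) by (intro linear_on_sum[OF subspace_grade hom_spaceD(1)[OF u]]) auto
        finally show "u x = (\<Sum>b\<in>B. u b *\<^sub>C \<kappa> b) x"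
          by (simp add: fun_sum_apply scaleC_complex_def mult.commute)
      qed
      then have "f u = f (\<Sum>b\<in>B. u b *\<^sub>C \<kappa> b)" by (rule arg_cong)
      also have "\<dots> = (\<Sum>b\<in>B. u b *\<^sub>C f (\<kappa> b))"
        by (intro linear_on_sum[OF csubspace_hom_space hom_spaceD(1)[OF f]] B(3))
      also have "\<dots> = (\<Sum>b\<in>B. 1 *\<^sub>C psi A (b \<otimes> f (\<kappa> b)) u)"
        using B(2) u by (intro sum.cong) (auto simp: psi_pure)
      also have "\<dots> = psi A (\<Sum>b\<in>B. 1 *\<^sub>C (b \<otimes> f (\<kappa> b))) u"
        using B(2) by (intro linear_on_sum[OF csubspace_tensor_space psi_linear_at[OF u], symmetric])
          (auto intro: pure_in_tensor_space)
      finally show ?thesis by simp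
    qed
    then have "f = psi A ?\<omega>" by (rule hom_space_ext[OF f psi_in_hom_space[OF \<omega>]])
    then show ?thesis using \<omega> by blast
  qed
  then show "psi A ` ?T = hom_space (dual_space ?W)"
    using psi_in_hom_space by blast
qed

lemma diff_dual_dual: "\<phi> \<in> dual_space (grade A 2) \<Longrightarrow> diff_dual A \<phi> \<in> dual_space (grade A 1)"
  using linear_onD[OF linear_diff] grade_total[of 1] diff_grade[of _ 1]
    cvs.subspace_add[OF subspace_grade[of 1]] cvs.subspace_scale[OF subspace_grade[of 1]]
  by (auto simp: hom_space_def linear_on_def diff_dual_def subset_iff)

text \<open>In a basis of \<open>A\<^sup>1\<close> with dual basis \<open>\<kappa>\<close>, the alternating form
  \<open>(x, y) \<mapsto> \<phi>(xy)\<close> is half the sum of \<open>\<phi>(bc) \<kappa>\<^sub>b \<and> \<kappa>\<^sub>c\<close> over all pairs of basis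
  vectors. This is where the finite dimension of \<open>A\<^sup>1\<close> enters the definition of the holonomy Lie
  algebra.\<close>

lemma cup_presentation_exists:
  assumes "fin_dim (grade A 1)" "\<phi> \<in> dual_space (grade A 2)"
  obtains ps where "cup_presentation A \<phi> ps"
proof -
  let ?W = "grade A 1"
  obtain B \<kappa> where B: "finite B" "B \<subseteq> ?W" "\<And>b. \<kappa> b \<in> dual_space ?W"
    "\<And>x. x \<in> ?W \<Longrightarrow> x = (\<Sum>b\<in>B. \<kappa> b x *\<^sub>C b)"
    by (rule finite_dual_basis[OF assms(1)]) blast
  note lin = hom_spaceD(1)[OF assms(2)]
  have g2: "mult A a b \<in> grade A 2" if "a \<in> ?W" "b \<in> ?W" for a b
    using mult_grade[OF that] by simp
  have linl: "linear_on ?W (\<lambda>a. \<phi> (mult A a b))" if "b \<in> ?W" for b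
    using g2 that bilinear_mult
    by (intro linear_on_compose[OF _ lin])
      (auto simp: bilinear_on_def in_total intro!: linear_on_subset[OF _ grade_total])
  have linr: "linear_on ?W (\<lambda>b. \<phi> (mult A a b))" if "a \<in> ?W" for a
    using g2 that bilinear_mult
    by (intro linear_on_compose[OF _ lin])
      (auto simp: bilinear_on_def in_total intro!: linear_on_subset[OF _ grade_total])
  have expand: "\<phi> (mult A x y) = (\<Sum>b\<in>B. \<Sum>c\<in>B. \<kappa> b x * \<kappa> c y * \<phi> (mult A b c))"
    if xy: "x \<in> ?W" "y \<in> ?W" for x y
  proof -
    have "\<phi> (mult A x y) = \<phi> (mult A (\<Sum>b\<in>B. \<kappa> b x *\<^sub>C b) y)"
      using B(4)[OF xy(1)] by (rule arg_cong)
    also have "\<dots> = (\<Sum>b\<in>B. \<kappa> b x *\<^sub>C \<phi> (mult A b y))"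
      using B(2) by (intro linear_on_sum[OF subspace_grade linl[OF xy(2)]]) auto
    also have "\<dots> = (\<Sum>b\<in>B. \<kappa> b x *\<^sub>C (\<Sum>c\<in>B. \<kappa> c y *\<^sub>C \<phi> (mult A b c)))"
    proof (rule sum.cong[OF refl])
      fix b assume "b \<in> B"
      then have b: "b \<in> ?W" using B(2) by blast
      have "\<phi> (mult A b y) = \<phi> (mult A b (\<Sum>c\<in>B. \<kappa> c y *\<^sub>C c))"
        using B(4)[OF xy(2)] by (rule arg_cong)
      also have "\<dots> = (\<Sum>c\<in>B. \<kappa> c y *\<^sub>C \<phi> (mult A b c))"
        using B(2) by (intro linear_on_sum[OF subspace_grade linr[OF b]]) auto
      finally show "\<kappa> b x *\<^sub>C \<phi> (mult A b y) = \<kappa> b x *\<^sub>C (\<Sum>c\<in>B. \<kappa> c y *\<^sub>C \<phi> (mult A b c))"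
        by (rule arg_cong)
    qed
    finally show ?thesis by (simp add: scaleC_complex_def sum_distrib_left mult.assoc)
  qed
  have anti: "\<phi> (mult A y x) = - \<phi> (mult A x y)" if "x \<in> ?W" "y \<in> ?W" for x y
    using mult_commute[of y 1 x 1] that linear_onD(2)[OF lin g2[OF that], of "- 1"]
    by (simp add: scaleC_complex_def)
  obtain xs where xs: "distinct xs" "set xs = B \<times> B"
    using finite_distinct_list[of "B \<times> B"] B(1) by blast
  \<comment> \<open>the factor one half accounts for each pair of basis vectors occurring in both orders\<close>
  let ?ps = "map (\<lambda>(b, c). ((1 / 2 * \<phi> (mult A b c)) *\<^sub>C \<kappa> b, \<kappa> c)) xs"
  have "cup_dual A \<phi> = (\<Sum>(u, v)\<leftarrow>?ps. wedge2 u v)"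
  proof (intro ext)
    fix x y
    have "(\<Sum>(u, v)\<leftarrow>?ps. wedge2 u v) x y =
        (\<Sum>(b, c)\<leftarrow>xs. 1 / 2 * \<phi> (mult A b c) * (\<kappa> b x * \<kappa> c y - \<kappa> b y * \<kappa> c x))"
      by (induction xs) (auto simp: wedge2_def scaleC_complex_def algebra_simps)
    also have "\<dots> = (\<Sum>(b, c)\<in>B \<times> B. 1 / 2 * \<phi> (mult A b c) * (\<kappa> b x * \<kappa> c y - \<kappa> b y * \<kappa> c x))"
      using xs by (simp add: sum_list_distinct_conv_sum_set)
    also have "\<dots> = 1 / 2 * (\<Sum>b\<in>B. \<Sum>c\<in>B. \<kappa> b x * \<kappa> c y * \<phi> (mult A b c))
        - 1 / 2 * (\<Sum>b\<in>B. \<Sum>c\<in>B. \<kappa> b y * \<kappa> c x * \<phi> (mult A b c))"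
      by (simp add: sum.cartesian_product[symmetric] sum_distrib_left sum_subtractf[symmetric] algebra_simps)
    also have "\<dots> = cup_dual A \<phi> x y"
    proof (cases "x \<in> ?W \<and> y \<in> ?W")
      case True
      then show ?thesis
        by (simp add: cup_dual_def expand[symmetric] anti[of x y])
    next
      case False
      then have "(\<Sum>b\<in>B. \<Sum>c\<in>B. \<kappa> b x * \<kappa> c y * \<phi> (mult A b c)) = 0"
        "(\<Sum>b\<in>B. \<Sum>c\<in>B. \<kappa> b y * \<kappa> c x * \<phi> (mult A b c)) = 0"
        using hom_spaceD(2)[OF B(3)] by (auto intro!: sum.neutral)
      then show ?thesis using False by (auto simp: cup_dual_def)
    qed
    finally show "cup_dual A \<phi> x y = (\<Sum>(u, v)\<leftarrow>?ps. wedge2 u v) x y" by simp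
  qed
  moreover have "set ?ps \<subseteq> dual_space ?W \<times> dual_space ?W"
    using B(3) cvs.subspace_scale[OF csubspace_hom_space] by auto
  ultimately show ?thesis using that assms(2) unfolding cup_presentation_def by blast
qed

lemma slant_tensor_diff:
  assumes \<phi>: "\<phi> \<in> dual_space (grade A 2)" and t: "t \<in> tensor_space (grade A 1)"
  shows "slant (grade A 2) \<phi> (tensor_diff A t) = psi A t (diff_dual A \<phi>)"
proof (rule tensor_eqI[OF _ psi_linear_at[OF diff_dual_dual[OF \<phi>]] _ t])
  show "linear_on (tensor_space (grade A 1)) (\<lambda>t. slant (grade A 2) \<phi> (tensor_diff A t))"
    using tensor_diff_grade[of _ 1]
    by (intro linear_on_compose[OF tensor_diff_linear slant_linear[OF subspace_grade \<phi>]])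
      auto
  show "slant (grade A 2) \<phi> (tensor_diff A (a \<otimes> b)) = psi A (a \<otimes> b) (diff_dual A \<phi>)"
    if "a \<in> grade A 1" for a b
    using that diff_grade[OF that]
    by (simp add: tensor_diff_pure[OF that] slant_pure[OF subspace_grade \<phi>]
      psi_pure diff_dual_dual[OF \<phi>]) (simp add: diff_dual_def)
qed

text \<open>The product of degree one tensors is dual to \<open>\<union>\<^sup>*\<close>. Both sides are bilinear, and on
  pure tensors the identity is the presentation of \<open>\<union>\<^sup>*(\<phi>)\<close>, evaluated at the two factors from
  \<open>A\<^sup>1\<close>.\<close>

lemma slant_tensor_mult:
  assumes ps: "cup_presentation A \<phi> ps" and m: "bilinear_on UNIV UNIV m"
    and \<omega>: "\<omega> \<in> tensor_space (grade A 1)" and t: "t \<in> tensor_space (grade A 1)"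
  shows "slant (grade A 2) \<phi> (tensor_mult A m \<omega> t) =
    (\<Sum>(u, v)\<leftarrow>ps. m (psi A \<omega> u) (psi A t v) - m (psi A \<omega> v) (psi A t u))"
proof -
  let ?W = "grade A 1" and ?S = "slant (grade A 2) \<phi>"
  let ?R = "\<lambda>\<omega> t. \<Sum>(u, v)\<leftarrow>ps. m (psi A \<omega> u) (psi A t v) - m (psi A \<omega> v) (psi A t u)"
  have \<phi>: "\<phi> \<in> dual_space (grade A 2)"
    and uv: "\<And>u v. (u, v) \<in> set ps \<Longrightarrow> u \<in> dual_space ?W \<and> v \<in> dual_space ?W"
    and cup: "cup_dual A \<phi> = (\<Sum>(u, v)\<leftarrow>ps. wedge2 u v)"
    using ps by (auto simp: cup_presentation_def)
  note S = slant_linear[OF subspace_grade \<phi>]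
  have into: "tensor_mult A m \<omega> t \<in> tensor_space (grade A 2)"
    if "\<omega> \<in> tensor_space ?W" "t \<in> tensor_space ?W" for \<omega> t
    using tensor_mult_grade[OF m that] by simp
  have lin: "linear_on (tensor_space ?W) (\<lambda>\<omega>. ?S (tensor_mult A m \<omega> t))"
    "linear_on (tensor_space ?W) (\<lambda>\<omega>. ?R \<omega> t)" if "t \<in> tensor_space ?W" for t
  proof -
    show "linear_on (tensor_space ?W) (\<lambda>\<omega>. ?S (tensor_mult A m \<omega> t))"
      using into that by (intro linear_on_compose[OF tensor_mult_linear(2)[OF m that] S]) auto
    show "linear_on (tensor_space ?W) (\<lambda>\<omega>. ?R \<omega> t)"
      using uv by (intro linear_on_sum_list)
        (auto intro!: linear_on_minus linear_on_bilinear[OF m] psi_linear_at)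
  qed
  have rin: "linear_on (tensor_space ?W) (\<lambda>t. ?S (tensor_mult A m \<omega> t))"
    "linear_on (tensor_space ?W) (\<lambda>t. ?R \<omega> t)" if "\<omega> \<in> tensor_space ?W" for \<omega>
  proof -
    show "linear_on (tensor_space ?W) (\<lambda>t. ?S (tensor_mult A m \<omega> t))"
      using into that by (intro linear_on_compose[OF tensor_mult_linear(1)[OF m that] S]) auto
    show "linear_on (tensor_space ?W) (\<lambda>t. ?R \<omega> t)"
      using uv by (intro linear_on_sum_list)
        (auto intro!: linear_on_minus linear_on_bilinear[OF m] psi_linear_at)
  qed
  show ?thesis
  proof (rule tensor_eqI[OF lin[OF t] _ \<omega>])
    fix \<eta> x assume \<eta>: "\<eta> \<in> ?W"
    show "?S (tensor_mult A m (\<eta> \<otimes> x) t) = ?R (\<eta> \<otimes> x) t"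
    proof (rule tensor_eqI[OF rin[OF pure_in_tensor_space[OF \<eta>]] _ t])
      fix \<alpha> w assume \<alpha>: "\<alpha> \<in> ?W"
      have "mult A \<eta> \<alpha> \<in> grade A 2" using mult_grade[OF \<eta> \<alpha>] by simp
      then have "?S (tensor_mult A m (\<eta> \<otimes> x) (\<alpha> \<otimes> w)) = \<phi> (mult A \<eta> \<alpha>) *\<^sub>C m x w"
        by (simp add: tensor_mult_pure[OF m \<eta> \<alpha>] slant_pure[OF subspace_grade \<phi>])
      also have "\<phi> (mult A \<eta> \<alpha>) = (\<Sum>(u, v)\<leftarrow>ps. wedge2 u v) \<eta> \<alpha>"
        unfolding cup[symmetric] using \<eta> \<alpha> by (simp add: cup_dual_def)
      also have "(\<Sum>(u, v)\<leftarrow>ps. wedge2 u v) \<eta> \<alpha> *\<^sub>C m x w = ?R (\<eta> \<otimes> x) (\<alpha> \<otimes> w)"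
        using uv
      proof (induction ps)
        case (Cons p ps)
        obtain u v where p: "p = (u, v)" by (cases p)
        then have "u \<in> dual_space ?W" "v \<in> dual_space ?W" using Cons.prems by auto
        then have "wedge2 u v \<eta> \<alpha> *\<^sub>C m x w
            = m (psi A (\<eta> \<otimes> x) u) (psi A (\<alpha> \<otimes> w) v) - m (psi A (\<eta> \<otimes> x) v) (psi A (\<alpha> \<otimes> w) u)"
          by (simp add: psi_pure \<eta> \<alpha> bilinear_onD[OF m] wedge2_def scaleC_scaleC
              cvs.scale_left_diff_distrib mult.commute)
        moreover have "(\<Sum>(u, v)\<leftarrow>ps. wedge2 u v) \<eta> \<alpha> *\<^sub>C m x w = (\<Sum>(u, v)\<leftarrow>ps.
            m (psi A (\<eta> \<otimes> x) u) (psi A (\<alpha> \<otimes> w) v) - m (psi A (\<eta> \<otimes> x) v) (psi A (\<alpha> \<otimes> w) u))"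
          using Cons.prems by (intro Cons.IH) auto
        ultimately show ?case by (simp add: p scaleC_add_left)
      qed simp
      finally show "?S (tensor_mult A m (\<eta> \<otimes> x) (\<alpha> \<otimes> w)) = ?R (\<eta> \<otimes> x) (\<alpha> \<otimes> w)" .
    qed
  qed
qed

lemma zero_iff_slant_presentation:
  fixes t :: "('a, 'x::complex_vector) tensor"
  assumes "fin_dim (grade A 1)" "fin_dim (UNIV :: 'x set)" "t \<in> tensor_space (grade A 2)"
  shows "t = 0 \<longleftrightarrow> (\<forall>\<phi> ps. cup_presentation A \<phi> ps \<longrightarrow> slant (grade A 2) \<phi> t = 0)"
proof
  assume "t = 0"
  then show "\<forall>\<phi> ps. cup_presentation A \<phi> ps \<longrightarrow> slant (grade A 2) \<phi> t = 0"
    using linear_on_0[OF csubspace_tensor_space slant_linear[OF subspace_grade]]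
    by (auto simp: cup_presentation_def)
next
  assume "\<forall>\<phi> ps. cup_presentation A \<phi> ps \<longrightarrow> slant (grade A 2) \<phi> t = 0"
  then show "t = 0"
    using cup_presentation_exists[OF assms(1)]
    by (intro slant_separates[OF subspace_grade assms(2,3)]) metis
qed

text \<open>Paired with a functional \<open>\<phi>\<close> on \<open>A\<^sup>2\<close>, the flatness equation is the relator of
  \<open>\<phi>\<close>, evaluated by \<open>psi \<omega>\<close>. The antisymmetry of the bracket makes the two terms of the product equal, which cancels the
  factor one half.\<close>

lemma flat_iff:
  fixes br :: "'g::complex_vector \<Rightarrow> 'g \<Rightarrow> 'g"
  assumes A1: "fin_dim (grade A 1)" and g: "fin_dim (UNIV :: 'g set)" "lie_bracket br"
    and \<omega>: "\<omega> \<in> tensor_space (grade A 1)"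
  shows "\<omega> \<in> flat_connections A br \<longleftrightarrow> satisfies_relators A br (psi A \<omega>)"
proof -
  have br: "bilinear_on UNIV UNIV br" using g(2) by (simp add: lie_bracket_def)
  let ?F = "tensor_diff A \<omega> + (1 / 2) *\<^sub>C tensor_mult A br \<omega> \<omega>"
  have d: "tensor_diff A \<omega> \<in> tensor_space (grade A 2)"
    and m: "tensor_mult A br \<omega> \<omega> \<in> tensor_space (grade A 2)"
    using tensor_diff_grade[OF \<omega>] tensor_mult_grade[OF br \<omega> \<omega>] by simp_all
  have F: "?F \<in> tensor_space (grade A 2)"
    by (intro cvs.subspace_add cvs.subspace_scale csubspace_tensor_space d m)
  have "slant (grade A 2) \<phi> ?F = psi A \<omega> (diff_dual A \<phi>) + (\<Sum>(u, v)\<leftarrow>ps. br (psi A \<omega> u) (psi A \<omega> v))"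
    if ps: "cup_presentation A \<phi> ps" for \<phi> ps
  proof -
    have \<phi>: "\<phi> \<in> dual_space (grade A 2)" using ps by (simp add: cup_presentation_def)
    note S = slant_linear[OF subspace_grade \<phi>]
    have "slant (grade A 2) \<phi> ?F =
        slant (grade A 2) \<phi> (tensor_diff A \<omega>) + (1 / 2) *\<^sub>C slant (grade A 2) \<phi> (tensor_mult A br \<omega> \<omega>)"
      unfolding linear_onD(1)[OF S d cvs.subspace_scale[OF csubspace_tensor_space m]] linear_onD(2)[OF S m] ..
    moreover have "(\<Sum>(u, v)\<leftarrow>ps. br (psi A \<omega> u) (psi A \<omega> v) - br (psi A \<omega> v) (psi A \<omega> u))
        = 2 *\<^sub>C (\<Sum>(u, v)\<leftarrow>ps. br (psi A \<omega> u) (psi A \<omega> v))"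
    proof (induction ps)
      case (Cons p ps)
      have "x + x = 2 *\<^sub>C x" for x :: 'g
        using scaleC_add_left[of 1 1 x] by (simp add: scaleC_one)
      then show ?case
        using Cons br_antisym[OF g(2), of "psi A \<omega> (snd p)" "psi A \<omega> (fst p)"]
        by (cases p) (simp add: scaleC_add_right)
    qed simp
    ultimately show ?thesis
      unfolding slant_tensor_diff[OF \<phi> \<omega>] slant_tensor_mult[OF ps br \<omega> \<omega>]
      by (simp add: scaleC_scaleC scaleC_one)
  qed
  then show ?thesis
    using zero_iff_slant_presentation[OF A1 g(1) F] \<omega>
    by (auto simp: flat_connections_def satisfies_relators_def)
qed

text \<open>The same pairing, applied to the twisted differential, gives the relator of \<open>\<phi>\<close>, linearised
  at \<open>psi \<omega>\<close> in the direction of \<open>psi t\<close>, with \<open>\<theta>\<close> in the place of the bracket.\<close>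

lemma twisted_cocycle_iff:
  fixes \<theta> :: "'g::complex_vector \<Rightarrow> 'v::complex_vector \<Rightarrow> 'v"
  assumes A1: "fin_dim (grade A 1)" and V: "fin_dim (UNIV :: 'v set)" "bilinear_on UNIV UNIV \<theta>"
    and \<omega>: "\<omega> \<in> tensor_space (grade A 1)" and t: "t \<in> tensor_space (grade A 1)"
  shows "twisted_diff A \<theta> \<omega> t = 0 \<longleftrightarrow> (\<forall>\<phi> ps. cup_presentation A \<phi> ps \<longrightarrow>
    psi A t (diff_dual A \<phi>) + (\<Sum>(u, v)\<leftarrow>ps. \<theta> (psi A \<omega> u) (psi A t v) - \<theta> (psi A \<omega> v) (psi A t u)) = 0)"
proof -
  have d: "tensor_diff A t \<in> tensor_space (grade A 2)"
    and m: "tensor_mult A \<theta> \<omega> t \<in> tensor_space (grade A 2)"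
    using tensor_diff_grade[OF t] tensor_mult_grade[OF V(2) \<omega> t] by simp_all
  have F: "twisted_diff A \<theta> \<omega> t \<in> tensor_space (grade A 2)"
    unfolding twisted_diff_def by (intro cvs.subspace_add csubspace_tensor_space d m)
  have "slant (grade A 2) \<phi> (twisted_diff A \<theta> \<omega> t) = psi A t (diff_dual A \<phi>)
      + (\<Sum>(u, v)\<leftarrow>ps. \<theta> (psi A \<omega> u) (psi A t v) - \<theta> (psi A \<omega> v) (psi A t u))"
    if ps: "cup_presentation A \<phi> ps" for \<phi> ps
  proof -
    have \<phi>: "\<phi> \<in> dual_space (grade A 2)" using ps by (simp add: cup_presentation_def)
    show ?thesis
      unfolding twisted_diff_def linear_onD(1)[OF slant_linear[OF subspace_grade \<phi>] d m]
        slant_tensor_diff[OF \<phi> t] slant_tensor_mult[OF ps V(2) \<omega> t] ..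
  qed
  then show ?thesis
    using zero_iff_slant_presentation[OF A1 V(1) F] by auto
qed

end

section \<open>Quotients of nonassociative algebras\<close>

text \<open>The axioms shared by the free nonassociative algebra and its quotients. The zero vector is
  written as a multiple \<open>0 x\<close>, because the record has no field for it; the Lie identities hold only
  after passing to the quotient and enter through its universal property.\<close>

locale nonassociative_algebra =
  fixes L :: "'h lie"
  assumes nonempty: "carrier L \<noteq> {}"
    and add_closed: "x \<in> carrier L \<Longrightarrow> y \<in> carrier L \<Longrightarrow> add L x y \<in> carrier L"
    and smult_closed: "x \<in> carrier L \<Longrightarrow> smult L c x \<in> carrier L"
    and bracket_closed: "x \<in> carrier L \<Longrightarrow> y \<in> carrier L \<Longrightarrow> bracket L x y \<in> carrier L"
    and add_assoc: "x \<in> carrier L \<Longrightarrow> y \<in> carrier L \<Longrightarrow> z \<in> carrier L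
          \<Longrightarrow> add L (add L x y) z = add L x (add L y z)"
    and add_commute: "x \<in> carrier L \<Longrightarrow> y \<in> carrier L \<Longrightarrow> add L x y = add L y x"
    and add_zero: "x \<in> carrier L \<Longrightarrow> y \<in> carrier L \<Longrightarrow> add L x (smult L 0 y) = x"
    and smult_add_left: "x \<in> carrier L \<Longrightarrow> smult L (c + d) x = add L (smult L c x) (smult L d x)"
    and smult_add_right: "x \<in> carrier L \<Longrightarrow> y \<in> carrier L
          \<Longrightarrow> smult L c (add L x y) = add L (smult L c x) (smult L c y)"
    and smult_smult: "x \<in> carrier L \<Longrightarrow> smult L c (smult L d x) = smult L (c * d) x"
    and smult_one: "x \<in> carrier L \<Longrightarrow> smult L 1 x = x"
    and bracket_add_left: "x \<in> carrier L \<Longrightarrow> y \<in> carrier L \<Longrightarrow> z \<in> carrier L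
          \<Longrightarrow> bracket L (add L x y) z = add L (bracket L x z) (bracket L y z)"
    and bracket_add_right: "x \<in> carrier L \<Longrightarrow> y \<in> carrier L \<Longrightarrow> z \<in> carrier L
          \<Longrightarrow> bracket L x (add L y z) = add L (bracket L x y) (bracket L x z)"
    and bracket_smult_left: "x \<in> carrier L \<Longrightarrow> y \<in> carrier L
          \<Longrightarrow> bracket L (smult L c x) y = smult L c (bracket L x y)"
    and bracket_smult_right: "x \<in> carrier L \<Longrightarrow> y \<in> carrier L
          \<Longrightarrow> bracket L x (smult L c y) = smult L c (bracket L x y)"
begin

lemma eq_of_add_neg:
  assumes "x \<in> carrier L" "y \<in> carrier L" "z \<in> carrier L" "add L x (smult L (- 1) y) = smult L 0 z"
  shows "x = y"
proof -
  have "add L (smult L (- 1) y) y = smult L 0 y"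
    using smult_add_left[OF assms(2), of "- 1" 1] smult_one[OF assms(2)] by simp
  then have "x = add L (add L x (smult L (- 1) y)) y"
    using assms(1,2) by (simp add: add_assoc smult_closed add_zero)
  also have "\<dots> = y"
    unfolding assms(4) using add_commute[OF smult_closed[OF assms(3)] assms(2)] add_zero[OF assms(2,3)] by simp
  finally show ?thesis .
qed

lemma lie_ideal_carrier: "lie_ideal L (carrier L)"
  using nonempty by (auto simp: lie_ideal_def add_closed smult_closed bracket_closed)

lemma lie_ideal_generated:
  assumes "S \<subseteq> carrier L"
  shows "lie_ideal L (ideal_generated L S)"
proof -
  have sub: "ideal_generated L S \<subseteq> carrier L"
    unfolding ideal_generated_def using lie_ideal_carrier assms by blast
  obtain x where x: "x \<in> carrier L" using nonempty by blast
  have "smult L 0 x \<in> I" if I: "lie_ideal L I" for I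
  proof -
    obtain y where y: "y \<in> I" "y \<in> carrier L" using I by (auto simp: lie_ideal_def)
    have "smult L 0 x = smult L 0 y"
      using add_zero[OF smult_closed[OF x], of y 0] add_zero[OF smult_closed[OF y(2)], of x 0]
        add_commute[OF smult_closed[OF x] smult_closed[OF y(2)], of 0 0] x y by simp
    then show ?thesis using I y by (simp add: lie_ideal_def)
  qed
  then have "smult L 0 x \<in> ideal_generated L S" by (simp add: ideal_generated_def)
  then have "ideal_generated L S \<noteq> {}" by blast
  moreover have "add L y z \<in> ideal_generated L S"
    if "y \<in> ideal_generated L S" "z \<in> ideal_generated L S" for y z
    using that by (auto simp: ideal_generated_def lie_ideal_def)
  moreover have "smult L c y \<in> ideal_generated L S" if "y \<in> ideal_generated L S" for c y
    using that by (auto simp: ideal_generated_def lie_ideal_def)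
  moreover have "bracket L y z \<in> ideal_generated L S" "bracket L z y \<in> ideal_generated L S"
    if "y \<in> ideal_generated L S" "z \<in> carrier L" for y z
    using that by (auto simp: ideal_generated_def lie_ideal_def)
  ultimately show ?thesis
    unfolding lie_ideal_def[of L "ideal_generated L S"] using sub by blast
qed

lemma generators_in_ideal: "S \<subseteq> ideal_generated L S"
  by (auto simp: ideal_generated_def)

text \<open>Ideals given by generators are only used through this lemma: a homomorphism that kills the
  generators kills the ideal, as its kernel is one of the ideals in the intersection.\<close>

lemma lie_hom_kernel:
  assumes "lie_bracket br" "lie_hom L (lie_of br) f"
  shows "lie_ideal L {x \<in> carrier L. f x = 0}"
proof -
  have f: "f (add L x y) = f x + f y" "f (smult L c x) = c *\<^sub>C f x" "f (bracket L x y) = br (f x) (f y)"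
    if "x \<in> carrier L" "y \<in> carrier L" for x y c
    using assms(2) that by (simp_all add: lie_hom_def lie_of_def)
  have 0: "br 0 z = 0" "br z 0 = 0" for z
    using br_simps(3)[OF assms(1), of 0 0 z] br_simps(4)[OF assms(1), of z 0 0] by simp_all
  obtain x where x: "x \<in> carrier L" using nonempty by blast
  then have "smult L 0 x \<in> {x \<in> carrier L. f x = 0}" by (simp add: f smult_closed)
  then show ?thesis
    unfolding lie_ideal_def by (auto simp: f add_closed smult_closed bracket_closed 0)
qed

lemma lie_hom_ideal_generated:
  assumes "lie_bracket br" "lie_hom L (lie_of br) f" "S \<subseteq> carrier L" "\<And>x. x \<in> S \<Longrightarrow> f x = 0"
    "x \<in> ideal_generated L S"
  shows "f x = 0"
  using lie_hom_kernel[OF assms(1,2)] assms(3-5) by (fastforce simp: ideal_generated_def)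

context
  fixes I assumes I: "lie_ideal L I"
begin

lemma ideal_in: "i \<in> I \<Longrightarrow> i \<in> carrier L"
  using I by (auto simp: lie_ideal_def)

lemma ideal_closed:
  "i \<in> I \<Longrightarrow> j \<in> I \<Longrightarrow> add L i j \<in> I" "i \<in> I \<Longrightarrow> smult L c i \<in> I"
  "i \<in> I \<Longrightarrow> x \<in> carrier L \<Longrightarrow> bracket L i x \<in> I" "i \<in> I \<Longrightarrow> x \<in> carrier L \<Longrightarrow> bracket L x i \<in> I"
  using I by (auto simp: lie_ideal_def)

lemma self_in_coset: "x \<in> carrier L \<Longrightarrow> x \<in> coset L I x"
proof -
  assume x: "x \<in> carrier L"
  obtain i where i: "i \<in> I" using I by (auto simp: lie_ideal_def)
  then have "x = add L x (smult L 0 i)" by (simp add: add_zero x ideal_in)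
  then show ?thesis using ideal_closed(2)[OF i, of 0] unfolding coset_def by blast
qed

lemma add_left_commute:
  "x \<in> carrier L \<Longrightarrow> y \<in> carrier L \<Longrightarrow> z \<in> carrier L \<Longrightarrow> add L x (add L y z) = add L y (add L x z)"
  by (metis add_assoc add_commute)

lemma coset_cong:
  assumes "x \<in> carrier L" "i \<in> I"
  shows "coset L I (add L x i) = coset L I x"
proof -
  have "add L (add L x i) j \<in> coset L I x" if "j \<in> I" for j
    using add_assoc[of x i j] assms that ideal_in ideal_closed(1) unfolding coset_def by auto
  moreover have "add L x j \<in> coset L I (add L x i)" if j: "j \<in> I" for j
  proof -
    have "add L i (smult L (- 1) i) = smult L 0 i"
      using smult_add_left[of i 1 "- 1"] smult_one[of i] assms ideal_in by simp
    moreover have "add L (smult L 0 i) j = j"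
      using add_commute add_zero assms(2) ideal_in j smult_closed by metis
    ultimately have "add L x j = add L (add L x i) (add L (smult L (- 1) i) j)"
      using assms ideal_in j by (simp add: add_assoc add_closed smult_closed)
        (metis add_assoc smult_closed)
    then show ?thesis using ideal_closed(1,2) assms(2) j unfolding coset_def by blast
  qed
  ultimately show ?thesis unfolding coset_def by auto
qed

lemma coset_eqD:
  assumes "x \<in> carrier L" "coset L I x = coset L I y"
  obtains i where "i \<in> I" "x = add L y i"
  using self_in_coset[OF assms(1)] assms(2) unfolding coset_def by auto

lemma quotient_add:
  assumes x: "x \<in> carrier L" and y: "y \<in> carrier L"
  shows "add (quotient_lie L I) (coset L I x) (coset L I y) = coset L I (add L x y)"
proof -
  have "{add L a b |a b. a \<in> coset L I x \<and> b \<in> coset L I y} = coset L I (add L x y)" (is "?A = ?B")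
  proof
    show "?A \<subseteq> ?B"
    proof
      fix z assume "z \<in> ?A"
      then obtain i j where ij: "i \<in> I" "j \<in> I" and z: "z = add L (add L x i) (add L y j)"
        by (auto simp: coset_def)
      have "z = add L (add L x y) (add L i j)"
        using ij x y by (simp add: z add_assoc add_left_commute[of i] add_closed ideal_in)
      then show "z \<in> ?B" using ideal_closed(1)[OF ij] by (auto simp: coset_def)
    qed
    show "?B \<subseteq> ?A"
    proof
      fix z assume "z \<in> ?B"
      then obtain i where "i \<in> I" "z = add L x (add L y i)"
        using x y by (auto simp: coset_def add_assoc ideal_in)
      then show "z \<in> ?A" using self_in_coset[OF x] by (auto simp: coset_def[of _ _ y])
    qed
  qed
  then show ?thesis by (simp add: quotient_lie_def)
qed

lemma quotient_smult:
  assumes x: "x \<in> carrier L"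
  shows "smult (quotient_lie L I) c (coset L I x) = coset L I (smult L c x)"
proof -
  have "{add L (smult L c a) i |a i. a \<in> coset L I x \<and> i \<in> I} = coset L I (smult L c x)" (is "?A = ?B")
  proof
    show "?A \<subseteq> ?B"
    proof
      fix z assume "z \<in> ?A"
      then obtain i j where ij: "i \<in> I" "j \<in> I" and z: "z = add L (smult L c (add L x i)) j"
        by (auto simp: coset_def)
      have "z = add L (smult L c x) (add L (smult L c i) j)"
        using ij x by (simp add: z smult_add_right add_assoc smult_closed ideal_in)
      then show "z \<in> ?B" using ideal_closed(1)[OF ideal_closed(2)] ij by (auto simp: coset_def)
    qed
    show "?B \<subseteq> ?A" using self_in_coset[OF x] by (auto simp: coset_def[of _ _ "smult L c x"])
  qed
  then show ?thesis by (simp add: quotient_lie_def)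
qed

lemma quotient_bracket:
  assumes x: "x \<in> carrier L" and y: "y \<in> carrier L"
  shows "bracket (quotient_lie L I) (coset L I x) (coset L I y) = coset L I (bracket L x y)"
proof -
  have "{add L (bracket L a b) k |a b k. a \<in> coset L I x \<and> b \<in> coset L I y \<and> k \<in> I}
      = coset L I (bracket L x y)" (is "?A = ?B")
  proof
    show "?A \<subseteq> ?B"
    proof
      fix z assume "z \<in> ?A"
      then obtain i j k where ij: "i \<in> I" "j \<in> I" "k \<in> I"
        and z: "z = add L (bracket L (add L x i) (add L y j)) k"
        by (auto simp: coset_def)
      let ?r = "add L (bracket L i y) (add L (bracket L x j) (add L (bracket L i j) k))"
      have "z = add L (bracket L x y) ?r"
        using ij x y by (simp add: z bracket_add_left bracket_add_right add_assoc
            bracket_closed add_closed ideal_in)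
      moreover have "?r \<in> I" using ij x y by (simp add: ideal_closed ideal_in)
      ultimately show "z \<in> ?B" by (auto simp: coset_def)
    qed
    show "?B \<subseteq> ?A"
      using self_in_coset[OF x] self_in_coset[OF y] by (auto simp: coset_def[of _ _ "bracket L x y"])
  qed
  then show ?thesis by (simp add: quotient_lie_def)
qed

lemma quotient_carrier: "carrier (quotient_lie L I) = coset L I ` carrier L"
  by (simp add: quotient_lie_def)

lemma coset_hom: "lie_hom L (quotient_lie L I) (coset L I)"
  by (simp add: lie_hom_def quotient_add quotient_smult quotient_bracket quotient_carrier)

text \<open>All axioms pass to the quotient, since the operations on cosets are those on
  representatives.\<close>

lemma quotient_algebra: "nonassociative_algebra (quotient_lie L I)"
proof -
  have comm: "coset L I (add L x y) = coset L I (add L y x)" if "x \<in> carrier L" "y \<in> carrier L" for x y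
    using add_commute[OF that] by simp
  show ?thesis
    unfolding nonassociative_algebra_def quotient_carrier
    using nonempty
    by (auto simp: quotient_add quotient_smult quotient_bracket add_closed smult_closed bracket_closed
        add_assoc add_zero smult_add_left smult_add_right smult_smult smult_one bracket_add_left
        bracket_add_right bracket_smult_left bracket_smult_right comm)
qed

lemma quotient_lift:
  assumes f: "lie_hom L (lie_of br) f" "\<And>i. i \<in> I \<Longrightarrow> f i = 0"
  obtains F where "lie_hom (quotient_lie L I) (lie_of br) F" "\<And>x. x \<in> carrier L \<Longrightarrow> F (coset L I x) = f x"
proof -
  let ?F = "\<lambda>X. f (SOME x. x \<in> carrier L \<and> coset L I x = X)"
  have F: "?F (coset L I x) = f x" if x: "x \<in> carrier L" for x
  proof -
    let ?y = "SOME y. y \<in> carrier L \<and> coset L I y = coset L I x"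
    have y: "?y \<in> carrier L \<and> coset L I ?y = coset L I x"
      by (rule someI[of _ x]) (simp add: x)
    then obtain i where "i \<in> I" "?y = add L x i" using coset_eqD by metis
    then show ?thesis using f x by (simp add: lie_hom_def lie_of_def ideal_in)
  qed
  have "lie_hom (quotient_lie L I) (lie_of br) ?F"
    using f(1)
    by (auto simp: lie_hom_def quotient_carrier quotient_add quotient_smult quotient_bracket F
        add_closed smult_closed bracket_closed)
  then show ?thesis using F that by blast
qed

end

end

lemma lie_hom_compose: "lie_hom L M f \<Longrightarrow> lie_hom M N g \<Longrightarrow> lie_hom L N (\<lambda>x. g (f x))"
  by (simp add: lie_hom_def)

section \<open>Free Lie algebras\<close>

lemma magma_mult_eq:
  "magma_mult p q = linear_extension (\<lambda>s. linear_extension (\<lambda>t. Poly_Mapping.single (Node s t) 1) q) p"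
  by (simp add: magma_mult_def linear_extension_def cvs.scale_sum_right scaleC_single scaleC_complex_def)

lemma magma_mult_linear:
  "magma_mult (p + p') q = magma_mult p q + magma_mult p' q"
  "magma_mult p (q + q') = magma_mult p q + magma_mult p q'"
  "magma_mult (c *\<^sub>C p) q = c *\<^sub>C magma_mult p q"
  "magma_mult p (c *\<^sub>C q) = c *\<^sub>C magma_mult p q"
  by (simp_all add: magma_mult_eq linear_extension_add linear_extension_scaleC linear_extension_plus)

lemma csubspace_magma_carrier: "csubspace (carrier (magma_algebra W))"
  unfolding cvs.subspace_def
  using Poly_Mapping.keys_add keys_scaleC by (fastforce simp: magma_algebra_def)

lemma single_in_magma: "leaves t \<subseteq> W \<Longrightarrow> Poly_Mapping.single t c \<in> carrier (magma_algebra W)"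
  by (auto simp: magma_algebra_def)

lemma magma_mult_closed:
  assumes "p \<in> carrier (magma_algebra W)" "q \<in> carrier (magma_algebra W)"
  shows "magma_mult p q \<in> carrier (magma_algebra W)"
  unfolding magma_mult_def
  using assms by (intro cvs.subspace_sum csubspace_magma_carrier single_in_magma)
    (auto simp: magma_algebra_def)

lemma nonassociative_magma_algebra: "nonassociative_algebra (magma_algebra W)"
proof -
  have sel [simp]: "add (magma_algebra W) = (+)" "smult (magma_algebra W) = scaleC"
    "bracket (magma_algebra W) = magma_mult"
    by (simp_all add: magma_algebra_def)
  show ?thesis
    by unfold_locales
      (use cvs.subspace_0[OF csubspace_magma_carrier[of W]] in
        \<open>auto simp: magma_mult_linear magma_mult_closed cvs.subspace_add[OF csubspace_magma_carrier]
          cvs.subspace_scale[OF csubspace_magma_carrier] add.assoc add.commute scaleC_add_left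
          scaleC_add_right scaleC_scaleC scaleC_one\<close>)
qed

primrec magma_eval :: "('k \<Rightarrow> 'k \<Rightarrow> 'k) \<Rightarrow> ('w \<Rightarrow> 'k) \<Rightarrow> 'w magma \<Rightarrow> 'k" where
  "magma_eval br f (Leaf u) = f u"
| "magma_eval br f (Node s t) = br (magma_eval br f s) (magma_eval br f t)"

lemma magma_eval_hom:
  assumes "bilinear_on UNIV UNIV br"
  shows "lie_hom (magma_algebra W) (lie_of br) (linear_extension (magma_eval br f))"
proof -
  let ?E = "linear_extension (magma_eval br f)"
  have "?E (magma_mult p q) = br (?E p) (?E q)" for p q
  proof -
    have lin: "linear_on UNIV (br x)" "linear_on UNIV (\<lambda>x. br x y)" for x y
      using assms by (auto simp: bilinear_on_def)
    have "br (?E p) (?E q) = linear_extension (\<lambda>s. linear_extension (\<lambda>t. magma_eval br f (Node s t)) q) p"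
      by (subst linear_linear_extension[OF lin(2)]) (simp add: linear_linear_extension[OF lin(1)])
    then show ?thesis
      by (simp add: magma_mult_eq linear_linear_extension[OF linear_on_linear_extension] scaleC_one
          del: magma_eval.simps)
  qed
  then show ?thesis
    by (simp add: lie_hom_def lie_of_def magma_algebra_def linear_extension_add linear_extension_scaleC)
qed

text \<open>Words are built from letters by the product, and the elements are combinations of words. The
  letter \<open>u0\<close> only serves to reach the empty combination, as a multiple of it.\<close>

lemma magma_induct:
  assumes p: "p \<in> carrier (magma_algebra W)" and "u0 \<in> W"
    and leaf: "\<And>u. u \<in> W \<Longrightarrow> P (leaf u)"
    and add: "\<And>p q. p \<in> carrier (magma_algebra W) \<Longrightarrow> q \<in> carrier (magma_algebra W) \<Longrightarrow> P p \<Longrightarrow> P q \<Longrightarrow> P (p + q)"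
    and scale: "\<And>c p. p \<in> carrier (magma_algebra W) \<Longrightarrow> P p \<Longrightarrow> P (c *\<^sub>C p)"
    and mult: "\<And>p q. p \<in> carrier (magma_algebra W) \<Longrightarrow> q \<in> carrier (magma_algebra W) \<Longrightarrow> P p \<Longrightarrow> P q \<Longrightarrow> P (magma_mult p q)"
  shows "P p"
proof -
  have single: "P (Poly_Mapping.single t 1)" if "leaves t \<subseteq> W" for t
    using that
  proof (induction t)
    case (Leaf u)
    then show ?case using leaf[of u] by (simp add: leaf_def)
  next
    case (Node s t)
    have "magma_mult (Poly_Mapping.single s 1) (Poly_Mapping.single t 1) = Poly_Mapping.single (Node s t) 1"
      by (simp add: magma_mult_eq scaleC_one)
    then show ?case
      using mult[of "Poly_Mapping.single s 1" "Poly_Mapping.single t 1"] Node by (simp add: single_in_magma)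
  qed
  have zero: "P 0" using scale[of "leaf u0" 0] leaf[of u0] assms(2) by (simp add: leaf_def single_in_magma)
  have "P (\<Sum>t\<in>K. Poly_Mapping.lookup p t *\<^sub>C Poly_Mapping.single t 1) \<and>
      (\<Sum>t\<in>K. Poly_Mapping.lookup p t *\<^sub>C Poly_Mapping.single t 1) \<in> carrier (magma_algebra W)"
    if "finite K" "\<And>t. t \<in> K \<Longrightarrow> leaves t \<subseteq> W" for K
    using that
  proof (induction K)
    case empty
    then show ?case using zero cvs.subspace_0[OF csubspace_magma_carrier] by simp
  next
    case (insert t K)
    have "P (Poly_Mapping.lookup p t *\<^sub>C Poly_Mapping.single t 1)"
      "Poly_Mapping.lookup p t *\<^sub>C Poly_Mapping.single t 1 \<in> carrier (magma_algebra W)"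
      using insert.prems[of t] by (auto intro!: scale single single_in_magma cvs.subspace_scale[OF csubspace_magma_carrier])
    moreover have "P (\<Sum>t\<in>K. Poly_Mapping.lookup p t *\<^sub>C Poly_Mapping.single t 1) \<and>
      (\<Sum>t\<in>K. Poly_Mapping.lookup p t *\<^sub>C Poly_Mapping.single t 1) \<in> carrier (magma_algebra W)"
      using insert.prems by (intro insert.IH) auto
    ultimately show ?case
      using insert.hyps by (simp add: add cvs.subspace_add[OF csubspace_magma_carrier])
  qed
  from this[of "Poly_Mapping.keys p"] p have "P (linear_extension (\<lambda>t. Poly_Mapping.single t 1) p)"
    by (simp add: linear_extension_def magma_algebra_def)
  then show ?thesis by (simp add: linear_extension_single_id)
qed

lemma free_lie_relations_in_magma:
  assumes "csubspace W"
  shows "free_lie_relations W \<subseteq> carrier (magma_algebra W)"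
proof -
  have "leaf u \<in> carrier (magma_algebra W)" if "u \<in> W" for u
    using that by (simp add: leaf_def single_in_magma)
  then show ?thesis
    unfolding free_lie_relations_def
    using cvs.subspace_add[OF assms] cvs.subspace_scale[OF assms]
    by (auto intro!: magma_mult_closed cvs.subspace_add[OF csubspace_magma_carrier]
        cvs.subspace_diff[OF csubspace_magma_carrier] cvs.subspace_scale[OF csubspace_magma_carrier])
qed

lemma lie_ideal_free_lie_ideal:
  "csubspace W \<Longrightarrow> lie_ideal (magma_algebra W) (free_lie_ideal W)"
  unfolding free_lie_ideal_def
  by (rule nonassociative_algebra.lie_ideal_generated[OF nonassociative_magma_algebra free_lie_relations_in_magma])

lemma nonassociative_free_lie: "csubspace W \<Longrightarrow> nonassociative_algebra (free_lie W)"
  unfolding free_lie_def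
  by (rule nonassociative_algebra.quotient_algebra[OF nonassociative_magma_algebra lie_ideal_free_lie_ideal])

lemma free_lie_coset_hom:
  "csubspace W \<Longrightarrow> lie_hom (magma_algebra W) (free_lie W) (coset (magma_algebra W) (free_lie_ideal W))"
  unfolding free_lie_def
  by (rule nonassociative_algebra.coset_hom[OF nonassociative_magma_algebra lie_ideal_free_lie_ideal])

lemma free_lie_gen_carrier:
  assumes "csubspace W" "u \<in> W" shows "free_lie_gen W u \<in> carrier (free_lie W)"
  using assms free_lie_coset_hom[OF assms(1)]
  by (simp add: free_lie_gen_def lie_hom_def leaf_def single_in_magma)

lemma free_lie_gen_linear:
  assumes W: "csubspace W" and u: "u \<in> W"
  shows "v \<in> W \<Longrightarrow> free_lie_gen W (u + v) = add (free_lie W) (free_lie_gen W u) (free_lie_gen W v)"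
    and "free_lie_gen W (c *\<^sub>C u) = smult (free_lie W) c (free_lie_gen W u)"
proof -
  let ?M = "magma_algebra W"
  have leaf: "leaf w \<in> carrier ?M" if "w \<in> W" for w using that by (simp add: leaf_def single_in_magma)
  have sel: "add ?M = (+)" "smult ?M = scaleC" by (simp_all add: magma_algebra_def)
  note hom = free_lie_coset_hom[OF W, unfolded lie_hom_def]
  note rel = nonassociative_algebra.generators_in_ideal[OF nonassociative_magma_algebra,
      of "free_lie_relations W" W, folded free_lie_ideal_def]
  have cong: "coset ?M (free_lie_ideal W) x = coset ?M (free_lie_ideal W) y"
    if "y \<in> carrier ?M" "x - y \<in> free_lie_relations W" for x y
    using nonassociative_algebra.coset_cong[OF nonassociative_magma_algebra lie_ideal_free_lie_ideal[OF W] that(1), of "x - y"]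
      that(2) rel by (auto simp: sel)
  show "free_lie_gen W (u + v) = add (free_lie W) (free_lie_gen W u) (free_lie_gen W v)" if v: "v \<in> W"
  proof -
    have "free_lie_gen W (u + v) = coset ?M (free_lie_ideal W) (leaf u + leaf v)"
      unfolding free_lie_gen_def using u v leaf
      by (intro cong cvs.subspace_add[OF csubspace_magma_carrier])
        (auto simp: free_lie_relations_def diff_diff_eq[symmetric])
    then show ?thesis using hom leaf u v by (simp add: free_lie_gen_def sel)
  qed
  have "free_lie_gen W (c *\<^sub>C u) = coset ?M (free_lie_ideal W) (c *\<^sub>C leaf u)"
    unfolding free_lie_gen_def using u leaf
    by (intro cong cvs.subspace_scale[OF csubspace_magma_carrier]) (auto simp: free_lie_relations_def)
  then show "free_lie_gen W (c *\<^sub>C u) = smult (free_lie W) c (free_lie_gen W u)"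
    using hom leaf u by (simp add: free_lie_gen_def sel)
qed

text \<open>Evaluation of bracketed words kills the relations of the free Lie algebra: the linear ones
  because \<open>f\<close> is linear, the others because the target is a Lie algebra.\<close>

lemma free_lie_universal:
  assumes W: "csubspace W" and br: "lie_bracket br" and f: "linear_on W f"
  obtains F where "lie_hom (free_lie W) (lie_of br) F" "\<And>u. u \<in> W \<Longrightarrow> F (free_lie_gen W u) = f u"
proof -
  let ?E = "linear_extension (magma_eval br f)" and ?M = "magma_algebra W"
  have bil: "bilinear_on UNIV UNIV br" using br by (simp add: lie_bracket_def)
  have E: "lie_hom ?M (lie_of br) ?E" by (rule magma_eval_hom[OF bil])
  have mult: "?E (magma_mult p q) = br (?E p) (?E q)" if "p \<in> carrier ?M" "q \<in> carrier ?M" for p q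
    using E that by (simp add: lie_hom_def magma_algebra_def lie_of_def)
  have leaf: "?E (leaf u) = f u" for u by (simp add: leaf_def scaleC_one)
  have jac: "br x (br y z) + br y (br z x) + br z (br x y) = 0" "br x x = 0" for x y z
    using br by (auto simp: lie_bracket_def)
  have "?E r = 0" if "r \<in> free_lie_relations W" for r
    using that unfolding free_lie_relations_def
    by (auto simp: linear_extension_add linear_extension_diff linear_extension_scaleC leaf mult jac
        magma_mult_closed linear_onD[OF f])
  then have "?E r = 0" if "r \<in> free_lie_ideal W" for r
    using nonassociative_algebra.lie_hom_ideal_generated[OF nonassociative_magma_algebra br E
        free_lie_relations_in_magma[OF W]] that unfolding free_lie_ideal_def by blast
  then obtain F where F: "lie_hom (free_lie W) (lie_of br) F"
      "\<And>p. p \<in> carrier ?M \<Longrightarrow> F (coset ?M (free_lie_ideal W) p) = ?E p"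
    using nonassociative_algebra.quotient_lift[OF nonassociative_magma_algebra lie_ideal_free_lie_ideal[OF W] E]
    unfolding free_lie_def by blast
  show ?thesis
  proof
    show "F (free_lie_gen W u) = f u" if "u \<in> W" for u
      using F(2)[of "leaf u"] that leaf by (simp add: free_lie_gen_def leaf_def single_in_magma)
  qed (rule F(1))
qed

section \<open>The universal property of the holonomy Lie algebra\<close>

text \<open>The generic form, for any target of the letters, allows to transport a relator along
  homomorphisms: from the free Lie algebra to the holonomy Lie algebra and on to \<open>\<gg>\<close>.\<close>

definition relator :: "'h lie \<Rightarrow> (('a \<Rightarrow> complex) \<Rightarrow> 'h) \<Rightarrow> 'a::complex_vector cdga \<Rightarrow> ('a \<Rightarrow> complex)
    \<Rightarrow> (('a \<Rightarrow> complex) \<times> ('a \<Rightarrow> complex)) list \<Rightarrow> 'h" where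
  "relator L \<iota> A \<phi> ps = foldr (\<lambda>(u, v) x. add L (bracket L (\<iota> u) (\<iota> v)) x) ps (\<iota> (diff_dual A \<phi>))"

lemma holonomy_relators_eq:
  "holonomy_relators A = {relator (free_lie (dual_space (grade A 1))) (free_lie_gen (dual_space (grade A 1))) A \<phi> ps
     | ps \<phi>. cup_presentation A \<phi> ps}"
  by (auto simp: holonomy_relators_def relator_def Let_def cup_presentation_def)

lemma relator_lie_of: "relator (lie_of br) f A \<phi> ps = f (diff_dual A \<phi>) + (\<Sum>(u, v)\<leftarrow>ps. br (f u) (f v))"
  by (induction ps) (auto simp: relator_def lie_of_def algebra_simps)

lemma relator_hom:
  assumes "nonassociative_algebra L" "lie_hom L M h" "\<And>u. u \<in> U \<Longrightarrow> \<iota> u \<in> carrier L"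
    "diff_dual A \<phi> \<in> U" "set ps \<subseteq> U \<times> U"
  shows "relator L \<iota> A \<phi> ps \<in> carrier L"
    and "h (relator L \<iota> A \<phi> ps) = relator M (\<lambda>u. h (\<iota> u)) A \<phi> ps"
proof -
  interpret nonassociative_algebra L by fact
  have "relator L \<iota> A \<phi> ps \<in> carrier L \<and> h (relator L \<iota> A \<phi> ps) = relator M (\<lambda>u. h (\<iota> u)) A \<phi> ps"
    using assms(5)
  proof (induction ps)
    case (Cons p ps)
    then show ?case
      using assms(2,3) by (cases p) (simp add: relator_def add_closed bracket_closed lie_hom_def)
  qed (use assms(3,4) in \<open>simp add: relator_def\<close>)
  then show "relator L \<iota> A \<phi> ps \<in> carrier L"
    "h (relator L \<iota> A \<phi> ps) = relator M (\<lambda>u. h (\<iota> u)) A \<phi> ps" by auto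
qed

lemma relator_cong:
  assumes "\<And>u. u \<in> U \<Longrightarrow> f u = g u" "diff_dual A \<phi> \<in> U" "set ps \<subseteq> U \<times> U"
  shows "relator L f A \<phi> ps = relator L g A \<phi> ps"
  using assms(3) by (induction ps) (auto simp: relator_def assms(1,2))

context cdga
begin

abbreviation "A1 \<equiv> dual_space (grade A 1)"

lemma presentation_in:
  assumes "cup_presentation A \<phi> ps" shows "diff_dual A \<phi> \<in> A1" "set ps \<subseteq> A1 \<times> A1"
  using assms diff_dual_dual by (auto simp: cup_presentation_def)

lemma free_lie_gen_dual: "u \<in> A1 \<Longrightarrow> free_lie_gen A1 u \<in> carrier (free_lie A1)"
  by (rule free_lie_gen_carrier[OF csubspace_hom_space])

lemma holonomy_relators_in: "holonomy_relators A \<subseteq> carrier (free_lie A1)"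
  unfolding holonomy_relators_eq
proof clarify
  fix \<phi> ps assume ps: "cup_presentation A \<phi> ps"
  have "lie_hom (free_lie A1) (free_lie A1) (\<lambda>x. x)" by (simp add: lie_hom_def)
  then show "relator (free_lie A1) (free_lie_gen A1) A \<phi> ps \<in> carrier (free_lie A1)"
    by (rule relator_hom(1)[OF nonassociative_free_lie[OF csubspace_hom_space] _
      free_lie_gen_dual presentation_in[OF ps]])
qed

lemma lie_ideal_holonomy_ideal: "lie_ideal (free_lie A1) (holonomy_ideal A)"
  unfolding holonomy_ideal_def
  by (rule nonassociative_algebra.lie_ideal_generated[OF nonassociative_free_lie[OF csubspace_hom_space] holonomy_relators_in])

lemma nonassociative_holonomy: "nonassociative_algebra (holonomy A)"
  unfolding holonomy_def
  by (rule nonassociative_algebra.quotient_algebra[OF nonassociative_free_lie[OF csubspace_hom_space] lie_ideal_holonomy_ideal])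

lemma holonomy_coset_hom: "lie_hom (free_lie A1) (holonomy A) (coset (free_lie A1) (holonomy_ideal A))"
  unfolding holonomy_def
  by (rule nonassociative_algebra.coset_hom[OF nonassociative_free_lie[OF csubspace_hom_space] lie_ideal_holonomy_ideal])

lemma holonomy_gen_carrier: "u \<in> A1 \<Longrightarrow> holonomy_gen A u \<in> carrier (holonomy A)"
  using holonomy_coset_hom free_lie_gen_dual
  by (simp add: holonomy_gen_def lie_hom_def)

lemma holonomy_gen_linear:
  "u \<in> A1 \<Longrightarrow> v \<in> A1 \<Longrightarrow>
     holonomy_gen A (u + v) = add (holonomy A) (holonomy_gen A u) (holonomy_gen A v)"
  "u \<in> A1 \<Longrightarrow> holonomy_gen A (c *\<^sub>C u) = smult (holonomy A) c (holonomy_gen A u)"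
  using holonomy_coset_hom free_lie_gen_dual
  by (simp_all add: holonomy_gen_def lie_hom_def free_lie_gen_linear[OF csubspace_hom_space])

text \<open>The relator lies in the ideal, so its coset is the zero vector, written as a multiple
  \<open>0 x\<close>.\<close>

lemma holonomy_relator:
  assumes ps: "cup_presentation A \<phi> ps"
  shows "relator (holonomy A) (holonomy_gen A) A \<phi> ps = smult (holonomy A) 0 (holonomy_gen A 0)"
proof -
  let ?F = "free_lie A1" and ?J = "holonomy_ideal A"
  let ?r = "relator ?F (free_lie_gen A1) A \<phi> ps"
  interpret F: nonassociative_algebra ?F by (rule nonassociative_free_lie[OF csubspace_hom_space])
  note gen = free_lie_gen_dual
  have r: "?r \<in> ?J"
  proof -
    have "?r \<in> holonomy_relators A" unfolding holonomy_relators_eq using ps by blast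
    then show ?thesis unfolding holonomy_ideal_def by (rule subsetD[OF F.generators_in_ideal])
  qed
  have 0: "free_lie_gen A1 0 \<in> carrier ?F" by (rule gen[OF cvs.subspace_0[OF csubspace_hom_space]])
  have rF: "?r \<in> carrier ?F" by (rule relator_hom(1)[OF F.nonassociative_algebra_axioms holonomy_coset_hom gen presentation_in[OF ps]])
  have "relator (holonomy A) (holonomy_gen A) A \<phi> ps = coset ?F ?J ?r"
    unfolding holonomy_gen_def
    by (rule relator_hom(2)[OF F.nonassociative_algebra_axioms holonomy_coset_hom gen presentation_in[OF ps], symmetric])
  also have "?r = add ?F (smult ?F 0 (free_lie_gen A1 0)) ?r"
    using F.add_zero[OF rF 0] unfolding F.add_commute[OF rF F.smult_closed[OF 0]] by (rule sym)
  also have "coset ?F ?J \<dots> = coset ?F ?J (smult ?F 0 (free_lie_gen A1 0))"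
    by (rule F.coset_cong[OF lie_ideal_holonomy_ideal F.smult_closed[OF 0] r])
  also have "\<dots> = smult (holonomy A) 0 (holonomy_gen A 0)"
    using holonomy_coset_hom 0 by (simp add: lie_hom_def holonomy_gen_def)
  finally show ?thesis .
qed

text \<open>The elements of \<open>A\<^sub>1\<close> generate the holonomy Lie algebra, being images of the letters of
  the free nonassociative algebra.\<close>

lemma holonomy_induct:
  assumes X: "X \<in> carrier (holonomy A)"
    and gen: "\<And>u. u \<in> A1 \<Longrightarrow> P (holonomy_gen A u)"
    and add: "\<And>X Y. X \<in> carrier (holonomy A) \<Longrightarrow> Y \<in> carrier (holonomy A) \<Longrightarrow> P X \<Longrightarrow> P Y \<Longrightarrow> P (add (holonomy A) X Y)"
    and smult: "\<And>c X. X \<in> carrier (holonomy A) \<Longrightarrow> P X \<Longrightarrow> P (smult (holonomy A) c X)"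
    and bracket: "\<And>X Y. X \<in> carrier (holonomy A) \<Longrightarrow> Y \<in> carrier (holonomy A) \<Longrightarrow> P X \<Longrightarrow> P Y \<Longrightarrow> P (bracket (holonomy A) X Y)"
  shows "P X"
proof -
  let ?\<pi> = "\<lambda>p. coset (free_lie A1) (holonomy_ideal A) (coset (magma_algebra A1) (free_lie_ideal A1) p)"
  have hom: "lie_hom (magma_algebra A1) (holonomy A) ?\<pi>"
    by (rule lie_hom_compose[OF free_lie_coset_hom[OF csubspace_hom_space] holonomy_coset_hom])
  then have hom': "?\<pi> p \<in> carrier (holonomy A)" "?\<pi> (p + q) = add (holonomy A) (?\<pi> p) (?\<pi> q)"
    "?\<pi> (c *\<^sub>C p) = smult (holonomy A) c (?\<pi> p)" "?\<pi> (magma_mult p q) = bracket (holonomy A) (?\<pi> p) (?\<pi> q)"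
    if "p \<in> carrier (magma_algebra A1)" "q \<in> carrier (magma_algebra A1)" for p q c
    using that by (simp_all add: lie_hom_def magma_algebra_def)
  obtain p where p: "p \<in> carrier (magma_algebra A1)" "X = ?\<pi> p"
    using X by (auto simp: holonomy_def free_lie_def quotient_lie_def)
  have "P (?\<pi> p)"
  proof (rule magma_induct[where P = "\<lambda>p. P (?\<pi> p)", OF p(1) cvs.subspace_0[OF csubspace_hom_space]])
    show "P (?\<pi> (leaf u))" if "u \<in> A1" for u
      using gen[OF that] by (simp add: holonomy_gen_def free_lie_gen_def)
  qed (simp_all add: hom' add smult bracket)
  then show ?thesis using p(2) by simp
qed

text \<open>Both levels of the quotient are crossed by their universal properties; at the second one the
  relators are killed by hypothesis.\<close>

lemma holonomy_universal:
  assumes br: "lie_bracket br" and f: "f \<in> hom_space A1" "satisfies_relators A br f"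
  obtains \<rho> where "\<rho> \<in> Hom_Lie (holonomy A) br" "\<And>u. u \<in> A1 \<Longrightarrow> \<rho> (holonomy_gen A u) = f u"
proof -
  let ?F = "free_lie A1" and ?J = "holonomy_ideal A"
  interpret F: nonassociative_algebra ?F by (rule nonassociative_free_lie[OF csubspace_hom_space])
  note gen = free_lie_gen_dual
  obtain h where h: "lie_hom ?F (lie_of br) h" "\<And>u. u \<in> A1 \<Longrightarrow> h (free_lie_gen A1 u) = f u"
    using free_lie_universal[OF csubspace_hom_space br hom_spaceD(1)[OF f(1)]] by blast
  have "h r = 0" if rel: "r \<in> holonomy_relators A" for r
  proof -
    obtain \<phi> ps where ps: "cup_presentation A \<phi> ps" and r: "r = relator ?F (free_lie_gen A1) A \<phi> ps"
      using rel by (auto simp: holonomy_relators_eq)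
    have "h r = relator (lie_of br) (\<lambda>u. h (free_lie_gen A1 u)) A \<phi> ps"
      unfolding r by (rule relator_hom(2)[OF F.nonassociative_algebra_axioms h(1) gen presentation_in[OF ps]])
    also have "\<dots> = relator (lie_of br) f A \<phi> ps"
      by (rule relator_cong[OF h(2) presentation_in[OF ps]])
    also have "\<dots> = 0" using f(2) ps by (simp add: relator_lie_of satisfies_relators_def)
    finally show ?thesis .
  qed
  then have "h r = 0" if "r \<in> ?J" for r
    using F.lie_hom_ideal_generated[OF br h(1) holonomy_relators_in] that
    unfolding holonomy_ideal_def by blast
  then obtain \<rho> where \<rho>: "lie_hom (holonomy A) (lie_of br) \<rho>"
      "\<And>x. x \<in> carrier ?F \<Longrightarrow> \<rho> (coset ?F ?J x) = h x"
    using F.quotient_lift[OF lie_ideal_holonomy_ideal h(1)] unfolding holonomy_def by blast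
  let ?\<rho> = "\<lambda>X. if X \<in> carrier (holonomy A) then \<rho> X else 0"
  interpret H: nonassociative_algebra "holonomy A" by (rule nonassociative_holonomy)
  show ?thesis
  proof
    show "?\<rho> \<in> Hom_Lie (holonomy A) br"
      using \<rho>(1) by (auto simp: Hom_Lie_def lie_hom_def H.add_closed H.smult_closed H.bracket_closed)
    show "?\<rho> (holonomy_gen A u) = f u" if "u \<in> A1" for u
      using holonomy_gen_carrier[OF that] \<rho>(2)[OF gen[OF that]] h(2)[OF that] by (simp add: holonomy_gen_def)
  qed
qed

lemma Hom_Lie_holonomy_eqI:
  assumes "\<rho> \<in> Hom_Lie (holonomy A) br" "\<rho>' \<in> Hom_Lie (holonomy A) br"
    "\<And>u. u \<in> A1 \<Longrightarrow> \<rho> (holonomy_gen A u) = \<rho>' (holonomy_gen A u)"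
  shows "\<rho> = \<rho>'"
proof
  fix X show "\<rho> X = \<rho>' X"
  proof (cases "X \<in> carrier (holonomy A)")
    case True
    then show ?thesis
      by (rule holonomy_induct) (use assms in \<open>auto simp: Hom_Lie_def lie_hom_def\<close>)
  qed (use assms in \<open>simp add: Hom_Lie_def\<close>)
qed

lemma inj_on_restrict_gen: "inj_on (restrict_gen A) (Hom_Lie (holonomy A) br)"
proof (rule inj_onI)
  fix \<rho> \<rho>'
  assume *: "\<rho> \<in> Hom_Lie (holonomy A) br" "\<rho>' \<in> Hom_Lie (holonomy A) br" "restrict_gen A \<rho> = restrict_gen A \<rho>'"
  have "\<rho> (holonomy_gen A u) = \<rho>' (holonomy_gen A u)" if "u \<in> A1" for u
    using fun_cong[OF *(3), of u] that by (simp add: restrict_gen_def)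
  then show "\<rho> = \<rho>'" by (rule Hom_Lie_holonomy_eqI[OF *(1,2)])
qed

text \<open>Together with injectivity this describes \<open>Hom(\<hh>(A), \<gg>)\<close> inside
  \<open>Hom(A\<^sub>1, \<gg>)\<close> by the same equations that describe flat connections inside
  \<open>A\<^sup>1 \<otimes> \<gg>\<close>.\<close>

lemma restrict_gen_Hom_Lie:
  assumes br: "lie_bracket br"
  shows "restrict_gen A ` Hom_Lie (holonomy A) br = {f \<in> hom_space A1. satisfies_relators A br f}"
proof (intro equalityI subsetI)
  fix f assume "f \<in> restrict_gen A ` Hom_Lie (holonomy A) br"
  then obtain \<rho> where \<rho>: "\<rho> \<in> Hom_Lie (holonomy A) br" and f: "f = restrict_gen A \<rho>" by blast
  have hom: "lie_hom (holonomy A) (lie_of br) \<rho>" using \<rho> by (simp add: Hom_Lie_def)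
  have "f \<in> hom_space A1"
    unfolding f hom_space_def[of "dual_space _"] linear_on_def
    using hom holonomy_gen_carrier
    by (auto simp: restrict_gen_def lie_hom_def lie_of_def holonomy_gen_linear
        cvs.subspace_add[OF csubspace_hom_space] cvs.subspace_scale[OF csubspace_hom_space])
  moreover have "satisfies_relators A br f"
    unfolding satisfies_relators_def
  proof (intro allI impI)
    fix \<phi> ps assume ps: "cup_presentation A \<phi> ps"
    have "f (diff_dual A \<phi>) + (\<Sum>(u, v)\<leftarrow>ps. br (f u) (f v)) = relator (lie_of br) f A \<phi> ps"
      by (simp add: relator_lie_of)
    also have "\<dots> = relator (lie_of br) (\<lambda>u. \<rho> (holonomy_gen A u)) A \<phi> ps"
      by (rule relator_cong[OF _ presentation_in[OF ps]]) (simp add: f restrict_gen_def)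
    also have "\<dots> = \<rho> (relator (holonomy A) (holonomy_gen A) A \<phi> ps)"
      by (rule relator_hom(2)[OF nonassociative_holonomy hom holonomy_gen_carrier presentation_in[OF ps], symmetric])
    also have "\<dots> = 0"
      unfolding holonomy_relator[OF ps]
      using hom holonomy_gen_carrier[OF cvs.subspace_0[OF csubspace_hom_space]]
      by (simp add: lie_hom_def lie_of_def)
    finally show "f (diff_dual A \<phi>) + (\<Sum>(u, v)\<leftarrow>ps. br (f u) (f v)) = 0" .
  qed
  ultimately show "f \<in> {f \<in> hom_space A1. satisfies_relators A br f}" by simp
next
  fix f :: "('a \<Rightarrow> complex) \<Rightarrow> 'b" assume "f \<in> {f \<in> hom_space A1. satisfies_relators A br f}"
  then have f: "f \<in> hom_space A1" "satisfies_relators A br f" by auto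
  then obtain \<rho> where \<rho>: "\<rho> \<in> Hom_Lie (holonomy A) br" "\<And>u. u \<in> A1 \<Longrightarrow> \<rho> (holonomy_gen A u) = f u"
    using holonomy_universal[OF br] by blast
  have "f = restrict_gen A \<rho>"
    using hom_spaceD(2)[OF f(1)] \<rho>(2) by (auto simp: restrict_gen_def fun_eq_iff)
  then show "f \<in> restrict_gen A ` Hom_Lie (holonomy A) br" using \<rho>(1) by blast
qed

end

section \<open>Semidirect products\<close>

instantiation prod :: (complex_vector, complex_vector) complex_vector
begin

definition scaleC_prod :: "complex \<Rightarrow> 'a \<times> 'b \<Rightarrow> 'a \<times> 'b" where
  "scaleC_prod c p = (c *\<^sub>C fst p, c *\<^sub>C snd p)"

instance
  by standard (simp_all add: scaleC_prod_def prod_eq_iff scaleC_add_right scaleC_add_left scaleC_scaleC scaleC_one)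

end

lemma scaleC_prod_sel [simp]: "fst (c *\<^sub>C p) = c *\<^sub>C fst p" "snd (c *\<^sub>C p) = c *\<^sub>C snd p"
  by (simp_all add: scaleC_prod_def)

text \<open>The Lie algebra \<open>\<gg> \<ltimes> V\<close>, in which \<open>V\<close> is an abelian ideal.\<close>

definition semidirect_bracket :: "('g::complex_vector \<Rightarrow> 'g \<Rightarrow> 'g) \<Rightarrow> ('g \<Rightarrow> 'v::complex_vector \<Rightarrow> 'v)
    \<Rightarrow> 'g \<times> 'v \<Rightarrow> 'g \<times> 'v \<Rightarrow> 'g \<times> 'v" where
  "semidirect_bracket br \<theta> p q = (br (fst p) (fst q), \<theta> (fst p) (snd q) - \<theta> (fst q) (snd p))"

lemma semidirect_sel [simp]:
  "fst (semidirect_bracket br \<theta> p q) = br (fst p) (fst q)"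
  "snd (semidirect_bracket br \<theta> p q) = \<theta> (fst p) (snd q) - \<theta> (fst q) (snd p)"
  by (simp_all add: semidirect_bracket_def)

lemma representation_bilinear: "representation br \<theta> \<Longrightarrow> bilinear_on UNIV UNIV \<theta>"
  by (simp add: representation_def)

lemma representation_bracket:
  "representation br \<theta> \<Longrightarrow> \<theta> (br x y) v = \<theta> x (\<theta> y v) - \<theta> y (\<theta> x v)"
  by (simp add: representation_def)

lemma representation_simps:
  assumes "representation br \<theta>"
  shows "\<theta> (x + y) v = \<theta> x v + \<theta> y v" "\<theta> x (v + w) = \<theta> x v + \<theta> x w"
    "\<theta> (c *\<^sub>C x) v = c *\<^sub>C \<theta> x v" "\<theta> x (c *\<^sub>C v) = c *\<^sub>C \<theta> x v"
    "\<theta> x (v - w) = \<theta> x v - \<theta> x w" "\<theta> x 0 = 0" "\<theta> 0 v = 0"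
proof -
  note b = bilinear_onD[OF representation_bilinear[OF assms], simplified]
  show *: "\<theta> (x + y) v = \<theta> x v + \<theta> y v" "\<theta> x (v + w) = \<theta> x v + \<theta> x w"
    "\<theta> (c *\<^sub>C x) v = c *\<^sub>C \<theta> x v" "\<theta> x (c *\<^sub>C v) = c *\<^sub>C \<theta> x v" for x y v w c
    by (simp_all add: b)
  show "\<theta> x 0 = 0" "\<theta> 0 v = 0"
    using *(3)[of 0 0 v] *(4)[of x 0 0] by simp_all
  show "\<theta> x (v - w) = \<theta> x v - \<theta> x w"
    using *(2)[of x v "(- 1) *\<^sub>C w"] *(4)[of x "- 1" w] by simp
qed

lemma lie_bracket_semidirect:
  assumes g: "lie_bracket br" and \<theta>: "representation br \<theta>"
  shows "lie_bracket (semidirect_bracket br \<theta>)"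
proof -
  note r = representation_simps[OF \<theta>] representation_bracket[OF \<theta>] br_simps[OF g]
  have jac: "br x (br y z) + br y (br z x) + br z (br x y) = 0" for x y z
    using g by (simp add: lie_bracket_def)
  show ?thesis
    unfolding lie_bracket_def
    by (intro conjI allI bilinear_onI)
      (simp_all add: prod_eq_iff r jac cvs.scale_right_diff_distrib)
qed

section \<open>Lie algebra cochains in degrees zero and one\<close>

lemma length_omit: "i < length xs \<Longrightarrow> length (omit i xs) = length xs - 1"
  by (simp add: omit_def)

definition constant_cochain :: "'v::complex_vector \<Rightarrow> 'h list \<Rightarrow> 'v" where
  "constant_cochain v xs = (if xs = [] then v else 0)"

lemma constant_cochain_Cons [simp]: "constant_cochain v (x # xs) = 0"
  by (simp add: constant_cochain_def)

lemma constant_cochain_0 [simp]: "constant_cochain 0 = 0"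
  by (auto simp: constant_cochain_def)

lemma ce_cochains_0: "ce_cochains L 0 = range constant_cochain"
proof (intro equalityI subsetI)
  fix c assume c: "c \<in> ce_cochains L 0"
  have "c = constant_cochain (c [])"
  proof
    fix xs show "c xs = constant_cochain (c []) xs"
      using c by (cases "xs = []") (auto simp: ce_cochains_def constant_cochain_def)
  qed
  then show "c \<in> range constant_cochain" by blast
qed (auto simp: ce_cochains_def constant_cochain_def)

lemma ce_diff_constant:
  assumes "\<And>x. act x 0 = 0"
  shows "ce_diff L act (constant_cochain v) xs =
    (if length xs = 1 \<and> set xs \<subseteq> carrier L then act (hd xs) v else 0)"
proof (cases "length xs = 1")
  case True
  then obtain x where "xs = [x]" by (cases xs) auto
  then show ?thesis by (simp add: ce_diff_def constant_cochain_def omit_def scaleC_one)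
next
  case False
  have "act (xs ! i) (constant_cochain v (omit i xs)) = 0" if "i < length xs" for i
  proof -
    have "omit i xs \<noteq> []" using length_omit[OF that] that False by auto
    then show ?thesis by (simp add: constant_cochain_def assms)
  qed
  then show ?thesis using False by (simp add: ce_diff_def)
qed

text \<open>The one-cocycles, described by their values on single elements instead of by the vanishing of
  the differential on all lists.\<close>

definition lie_cocycles :: "'h lie \<Rightarrow> ('h \<Rightarrow> 'v \<Rightarrow> 'v) \<Rightarrow> ('h list \<Rightarrow> 'v::complex_vector) set" where
  "lie_cocycles L act = {c. (\<forall>xs. (\<forall>x\<in>carrier L. xs \<noteq> [x]) \<longrightarrow> c xs = 0) \<and>
     (\<forall>x\<in>carrier L. \<forall>y\<in>carrier L. c [add L x y] = c [x] + c [y]) \<and>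
     (\<forall>k. \<forall>x\<in>carrier L. c [smult L k x] = k *\<^sub>C c [x]) \<and>
     (\<forall>x\<in>carrier L. \<forall>y\<in>carrier L. c [bracket L x y] = act x (c [y]) - act y (c [x]))}"

lemma ce_cochains_1:
  "c \<in> ce_cochains L 1 \<longleftrightarrow> (\<forall>xs. (\<forall>x\<in>carrier L. xs \<noteq> [x]) \<longrightarrow> c xs = 0) \<and>
     (\<forall>x\<in>carrier L. \<forall>y\<in>carrier L. c [add L x y] = c [x] + c [y]) \<and>
     (\<forall>k. \<forall>x\<in>carrier L. c [smult L k x] = k *\<^sub>C c [x])" (is "?A \<longleftrightarrow> ?B")
proof
  assume c: ?A
  have "c xs = 0" if "\<forall>x\<in>carrier L. xs \<noteq> [x]" for xs
  proof -
    have "\<not> (length xs = 1 \<and> set xs \<subseteq> carrier L)" using that by (cases xs) auto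
    then show ?thesis using c by (simp add: ce_cochains_def)
  qed
  moreover have "c [add L x y] = c [x] + c [y]" "c [smult L k x] = k *\<^sub>C c [x]"
    if "x \<in> carrier L" "y \<in> carrier L" for x y k
  proof -
    have add: "\<forall>us x y vs. set us \<union> {x, y} \<union> set vs \<subseteq> carrier L \<longrightarrow>
        c (us @ add L x y # vs) = c (us @ x # vs) + c (us @ y # vs)"
      and smult: "\<forall>us k x vs. set us \<union> {x} \<union> set vs \<subseteq> carrier L \<longrightarrow>
        c (us @ smult L k x # vs) = k *\<^sub>C c (us @ x # vs)"
      using c by (simp_all add: ce_cochains_def)
    show "c [add L x y] = c [x] + c [y]" using add[rule_format, of "[]" x y "[]"] that by simp
    show "c [smult L k x] = k *\<^sub>C c [x]" using smult[rule_format, of "[]" x "[]" k] that by simp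
  qed
  ultimately show ?B by blast
next
  assume c: ?B
  have zero: "c (us @ x # vs) = 0" if "us \<noteq> [] \<or> vs \<noteq> []" for us vs x
  proof -
    have "us @ x # vs \<noteq> [y]" for y using that by (cases us) auto
    then show ?thesis using c by blast
  qed
  have nd: "c xs = 0" if "\<not> distinct xs" for xs
  proof -
    have "xs \<noteq> [y]" for y using that by auto
    then show ?thesis using c by blast
  qed
  have len: "c xs = 0" if "\<not> (length xs = 1 \<and> set xs \<subseteq> carrier L)" for xs
  proof -
    have "xs \<noteq> [y]" if "y \<in> carrier L" for y
      using \<open>\<not> (length xs = 1 \<and> set xs \<subseteq> carrier L)\<close> that by auto
    then show ?thesis using c by blast
  qed
  have add: "c (us @ add L x y # vs) = c (us @ x # vs) + c (us @ y # vs)"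
    if "set us \<union> {x, y} \<union> set vs \<subseteq> carrier L" for us x y vs
    using that c zero[of us vs] by (cases "us = [] \<and> vs = []") auto
  have smult: "c (us @ smult L k x # vs) = k *\<^sub>C c (us @ x # vs)"
    if "set us \<union> {x} \<union> set vs \<subseteq> carrier L" for us x k vs
    using that c zero[of us vs] by (cases "us = [] \<and> vs = []") auto
  show ?A
    unfolding ce_cochains_def mem_Collect_eq
    by (intro conjI allI impI) (erule len, erule add, erule smult, erule conjE, erule nd)
qed

lemma ce_diff_1:
  assumes "\<And>x. act x 0 = 0" "c \<in> ce_cochains L 1"
  shows "x \<in> carrier L \<Longrightarrow> y \<in> carrier L
      \<Longrightarrow> ce_diff L act c [x, y] = act x (c [y]) - act y (c [x]) - c [bracket L x y]"
    and "length xs \<noteq> 2 \<Longrightarrow> ce_diff L act c xs = 0"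
proof -
  show "ce_diff L act c [x, y] = act x (c [y]) - act y (c [x]) - c [bracket L x y]"
    if "x \<in> carrier L" "y \<in> carrier L"
    using that by (simp add: ce_diff_def omit_def lessThan_Suc numeral_2_eq_2 scaleC_one One_nat_def)
  have c0: "c xs = 0" if "length xs \<noteq> 1" for xs
    using that assms(2) by (simp add: ce_cochains_def)
  show "ce_diff L act c xs = 0" if "length xs \<noteq> 2"
  proof -
    have "act (xs ! i) (c (omit i xs)) = 0" if "i < length xs" for i
      using length_omit[OF that] \<open>length xs \<noteq> 2\<close> that by (subst c0) (auto simp: assms(1))
    moreover have "c (a # omit i (omit j xs)) = 0" if "i < j" "j < length xs" for a i j
    proof (rule c0)
      have "length (omit i (omit j xs)) = length xs - 2"
        using that by (simp add: length_omit)
      then show "length (a # omit i (omit j xs)) \<noteq> 1" using that \<open>length xs \<noteq> 2\<close> by auto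
    qed
    ultimately show ?thesis by (simp add: ce_diff_def)
  qed
qed

lemma lie_cocycles_eq:
  assumes "\<And>x. act x 0 = 0"
  shows "{c \<in> ce_cochains L 1. ce_diff L act c = 0} = lie_cocycles L act"
proof -
  have "ce_diff L act c = 0 \<longleftrightarrow>
      (\<forall>x\<in>carrier L. \<forall>y\<in>carrier L. c [bracket L x y] = act x (c [y]) - act y (c [x]))"
    if c: "c \<in> ce_cochains L 1" for c
  proof
    assume 0: "ce_diff L act c = 0"
    show "\<forall>x\<in>carrier L. \<forall>y\<in>carrier L. c [bracket L x y] = act x (c [y]) - act y (c [x])"
      using ce_diff_1(1)[where act = act, OF assms c] 0 by auto
  next
    assume *: "\<forall>x\<in>carrier L. \<forall>y\<in>carrier L. c [bracket L x y] = act x (c [y]) - act y (c [x])"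
    show "ce_diff L act c = 0"
    proof
      fix xs show "ce_diff L act c xs = 0 xs"
      proof (cases "length xs = 2 \<and> set xs \<subseteq> carrier L")
        case True
        then obtain x y where "xs = [x, y]" by (auto simp: numeral_2_eq_2 length_Suc_conv)
        then show ?thesis using True * ce_diff_1(1)[where act = act, OF assms c, of x y] by simp
      next
        case False
        then show ?thesis using ce_diff_1(2)[where act = act, OF assms c, of xs] by (cases "length xs = 2") (auto simp: ce_diff_def)
      qed
    qed
  qed
  then show ?thesis
    unfolding lie_cocycles_def by (auto simp: ce_cochains_1)
qed

lemma csubspace_lie_cocycles:
  assumes "\<And>x. linear_on UNIV (act x)"
  shows "csubspace (lie_cocycles L act)"
  using linear_onD[OF assms] linear_on_0[OF cvs.subspace_UNIV assms]
  by (auto simp: cvs.subspace_def lie_cocycles_def add_ac add_diff_add scaleC_add_right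
      cvs.scale_right_diff_distrib cvs.scale_left_commute)

section \<open>Resonance in degrees zero and one\<close>

context cdga
begin

text \<open>The condition for a linear map \<open>\<tau>\<close> on \<open>A\<^sub>1\<close> to extend to a cocycle of the holonomy
  Lie algebra along \<open>f\<close>.\<close>

definition satisfies_cocycle_relators ::
  "('g::complex_vector \<Rightarrow> 'v::complex_vector \<Rightarrow> 'v) \<Rightarrow> (('a \<Rightarrow> complex) \<Rightarrow> 'g) \<Rightarrow> (('a \<Rightarrow> complex) \<Rightarrow> 'v) \<Rightarrow> bool"
  where "satisfies_cocycle_relators \<theta> f \<tau> \<longleftrightarrow> (\<forall>\<phi> ps. cup_presentation A \<phi> ps \<longrightarrow>
    \<tau> (diff_dual A \<phi>) + (\<Sum>(u, v)\<leftarrow>ps. \<theta> (f u) (\<tau> v) - \<theta> (f v) (\<tau> u)) = 0)"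

text \<open>The second component of the relators of \<open>(f, \<tau>)\<close> is the linearisation of the relators
  of \<open>f\<close>.\<close>

lemma satisfies_relators_semidirect:
  "satisfies_relators A (semidirect_bracket br \<theta>) (\<lambda>u. (f u, \<tau> u)) \<longleftrightarrow>
     satisfies_relators A br f \<and> satisfies_cocycle_relators \<theta> f \<tau>"
proof -
  have "fst (\<Sum>(u, v)\<leftarrow>ps. semidirect_bracket br \<theta> (f u, \<tau> u) (f v, \<tau> v)) = (\<Sum>(u, v)\<leftarrow>ps. br (f u) (f v))"
    "snd (\<Sum>(u, v)\<leftarrow>ps. semidirect_bracket br \<theta> (f u, \<tau> u) (f v, \<tau> v))
      = (\<Sum>(u, v)\<leftarrow>ps. \<theta> (f u) (\<tau> v) - \<theta> (f v) (\<tau> u))" for ps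
    by (induction ps) auto
  then show ?thesis
    by (auto simp: satisfies_relators_def satisfies_cocycle_relators_def prod_eq_iff)
qed

definition restrict_cocycle ::
  "((('a \<Rightarrow> complex) magma \<Rightarrow>\<^sub>0 complex) set set list \<Rightarrow> 'v::complex_vector) \<Rightarrow> ('a \<Rightarrow> complex) \<Rightarrow> 'v" where
  "restrict_cocycle c = (\<lambda>u. if u \<in> A1 then c [holonomy_gen A u] else 0)"

context
  fixes br :: "'g::complex_vector \<Rightarrow> 'g \<Rightarrow> 'g" and \<theta> :: "'g \<Rightarrow> 'v::complex_vector \<Rightarrow> 'v" and \<rho> f
  assumes g: "lie_bracket br" and \<theta>: "representation br \<theta>"
    and \<rho>: "\<rho> \<in> Hom_Lie (holonomy A) br" and f: "f = restrict_gen A \<rho>"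
begin

lemma restriction_at_gen: "u \<in> A1 \<Longrightarrow> f u = \<rho> (holonomy_gen A u)"
  by (simp add: f restrict_gen_def)

lemma restricted_hom:
  assumes "X \<in> carrier (holonomy A)" "Y \<in> carrier (holonomy A)"
  shows "\<rho> (add (holonomy A) X Y) = \<rho> X + \<rho> Y" "\<rho> (smult (holonomy A) c X) = c *\<^sub>C \<rho> X"
    "\<rho> (bracket (holonomy A) X Y) = br (\<rho> X) (\<rho> Y)"
  using \<rho> assms by (auto simp: Hom_Lie_def lie_hom_def lie_of_def)

text \<open>A cocycle is determined on a bracket by its values on the two factors, hence by its values on
  generators.\<close>

lemma inj_on_restrict_cocycle:
  "inj_on restrict_cocycle (lie_cocycles (holonomy A) (\<lambda>X. \<theta> (\<rho> X)))"
proof (rule inj_onI)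
  fix c c' assume c: "c \<in> lie_cocycles (holonomy A) (\<lambda>X. \<theta> (\<rho> X))"
    "c' \<in> lie_cocycles (holonomy A) (\<lambda>X. \<theta> (\<rho> X))" and eq: "restrict_cocycle c = restrict_cocycle c'"
  have *: "c [X] = c' [X]" if "X \<in> carrier (holonomy A)" for X
    using that
  proof (rule holonomy_induct)
    show "c [holonomy_gen A u] = c' [holonomy_gen A u]" if "u \<in> A1" for u
      using fun_cong[OF eq, of u] that by (simp add: restrict_cocycle_def)
  qed (use c in \<open>auto simp: lie_cocycles_def\<close>)
  show "c = c'"
  proof
    fix xs show "c xs = c' xs"
      using c * by (cases "\<exists>X\<in>carrier (holonomy A). xs = [X]") (auto simp: lie_cocycles_def)
  qed
qed

text \<open>A linear map \<open>c\<close> on a Lie algebra is a cocycle along \<open>\<rho>\<close> exactly if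
  \<open>X \<mapsto> (\<rho> X, c X)\<close> is a homomorphism into the semidirect product. The
  universal property applied to the latter gives the extension of cocycles.\<close>

lemma restrict_cocycle_image:
  "restrict_cocycle ` lie_cocycles (holonomy A) (\<lambda>X. \<theta> (\<rho> X))
    = {\<tau> \<in> hom_space A1. satisfies_cocycle_relators \<theta> f \<tau>}"
proof (intro equalityI subsetI)
  let ?sd = "semidirect_bracket br \<theta>"
  note sd = lie_bracket_semidirect[OF g \<theta>]
  interpret H: nonassociative_algebra "holonomy A" by (rule nonassociative_holonomy)
  fix \<tau> assume "\<tau> \<in> restrict_cocycle ` lie_cocycles (holonomy A) (\<lambda>X. \<theta> (\<rho> X))"
  then obtain c where c: "c \<in> lie_cocycles (holonomy A) (\<lambda>X. \<theta> (\<rho> X))" and \<tau>: "\<tau> = restrict_cocycle c" by blast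
  let ?P = "\<lambda>X. if X \<in> carrier (holonomy A) then (\<rho> X, c [X]) else 0"
  have "?P \<in> Hom_Lie (holonomy A) ?sd"
    using c restricted_hom
    by (auto simp: Hom_Lie_def lie_hom_def lie_of_def lie_cocycles_def prod_eq_iff
        H.add_closed H.smult_closed H.bracket_closed)
  then have "restrict_gen A ?P \<in> hom_space A1 \<and> satisfies_relators A ?sd (restrict_gen A ?P)"
    using restrict_gen_Hom_Lie[OF sd] by blast
  moreover have "restrict_gen A ?P = (\<lambda>u. (f u, \<tau> u))"
    by (auto simp: fun_eq_iff f \<tau> restrict_gen_def restrict_cocycle_def holonomy_gen_carrier prod_eq_iff)
  ultimately have "(\<lambda>u. (f u, \<tau> u)) \<in> hom_space A1" "satisfies_cocycle_relators \<theta> f \<tau>"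
    by (auto simp: satisfies_relators_semidirect)
  then show "\<tau> \<in> {\<tau> \<in> hom_space A1. satisfies_cocycle_relators \<theta> f \<tau>}"
    by (auto simp: hom_space_def[of "dual_space _"] linear_on_def prod_eq_iff)
next
  let ?sd = "semidirect_bracket br \<theta>"
  note sd = lie_bracket_semidirect[OF g \<theta>]
  fix \<tau> :: "('a \<Rightarrow> complex) \<Rightarrow> 'v" assume "\<tau> \<in> {\<tau> \<in> hom_space A1. satisfies_cocycle_relators \<theta> f \<tau>}"
  then have \<tau>: "\<tau> \<in> hom_space A1" "satisfies_cocycle_relators \<theta> f \<tau>" by auto
  have f': "f \<in> hom_space A1" "satisfies_relators A br f"
    using restrict_gen_Hom_Lie[OF g] \<rho> f by blast+
  have "(\<lambda>u. (f u, \<tau> u)) \<in> hom_space A1"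
    using f'(1) \<tau>(1) by (auto simp: hom_space_def[of "dual_space _"] linear_on_def prod_eq_iff)
  moreover have "satisfies_relators A ?sd (\<lambda>u. (f u, \<tau> u))"
    using f'(2) \<tau>(2) by (simp add: satisfies_relators_semidirect)
  ultimately obtain P where P: "P \<in> Hom_Lie (holonomy A) ?sd"
      "\<And>u. u \<in> A1 \<Longrightarrow> P (holonomy_gen A u) = (f u, \<tau> u)"
    using holonomy_universal[OF sd] by blast
  have "(\<lambda>X. fst (P X)) = \<rho>"
    using P restriction_at_gen by (intro Hom_Lie_holonomy_eqI[OF _ \<rho>]) (auto simp: Hom_Lie_def lie_hom_def lie_of_def)
  then have fst: "fst (P X) = \<rho> X" for X by (rule fun_cong)
  let ?c = "\<lambda>xs. case xs of [X] \<Rightarrow> snd (P X) | _ \<Rightarrow> 0"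
  have "?c \<in> lie_cocycles (holonomy A) (\<lambda>X. \<theta> (\<rho> X))"
    using P(1) fst by (auto simp: lie_cocycles_def Hom_Lie_def lie_hom_def lie_of_def split: list.splits)
  moreover have "restrict_cocycle ?c = \<tau>"
    using P(2) hom_spaceD(2)[OF \<tau>(1)] by (auto simp: restrict_cocycle_def fun_eq_iff)
  ultimately show "\<tau> \<in> restrict_cocycle ` lie_cocycles (holonomy A) (\<lambda>X. \<theta> (\<rho> X))" by blast
qed

abbreviation "coboundary_at_gens v \<equiv> (\<lambda>u. if u \<in> A1 then \<theta> (f u) v else 0)"

lemma action_zero: "\<theta> (\<rho> X) 0 = 0"
  by (rule representation_simps(6)[OF \<theta>])

lemma lie_coboundaries:
  "ce_diff (holonomy A) (\<lambda>X. \<theta> (\<rho> X)) ` ce_cochains (holonomy A) 0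
    \<subseteq> lie_cocycles (holonomy A) (\<lambda>X. \<theta> (\<rho> X))"
proof -
  interpret H: nonassociative_algebra "holonomy A" by (rule nonassociative_holonomy)
  note cst = ce_diff_constant[of "\<lambda>X. \<theta> (\<rho> X)", OF action_zero]
  show ?thesis
    unfolding ce_cochains_0
    by (auto simp: lie_cocycles_def cst restricted_hom H.add_closed H.smult_closed H.bracket_closed
      representation_simps[OF \<theta>] representation_bracket[OF \<theta>] length_Suc_conv One_nat_def) blast
qed

lemma restrict_coboundaries:
  "restrict_cocycle ` ce_diff (holonomy A) (\<lambda>X. \<theta> (\<rho> X)) ` ce_cochains (holonomy A) 0 = range coboundary_at_gens"
proof -
  note cst = ce_diff_constant[of "\<lambda>X. \<theta> (\<rho> X)", OF action_zero]
  have "restrict_cocycle (ce_diff (holonomy A) (\<lambda>X. \<theta> (\<rho> X)) (constant_cochain v)) = coboundary_at_gens v" for v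
    by (auto simp: restrict_cocycle_def cst fun_eq_iff restriction_at_gen holonomy_gen_carrier)
  then show ?thesis unfolding ce_cochains_0 image_image by simp
qed

text \<open>Cocycles of the holonomy Lie algebra are determined by their restrictions to \<open>A\<^sub>1\<close>. So the
  cohomology can be computed inside \<open>Hom(A\<^sub>1, V)\<close>, by conditions on \<open>f\<close> alone.\<close>

lemma lie_cohomology_1:
  "cohomology_dim (ce_cochains (holonomy A)) (ce_diff (holonomy A) (\<lambda>X. \<theta> (\<rho> X))) 1 =
   quotient_dim {\<tau> \<in> hom_space A1. satisfies_cocycle_relators \<theta> f \<tau>} (range coboundary_at_gens)"
proof -
  let ?Z = "lie_cocycles (holonomy A) (\<lambda>X. \<theta> (\<rho> X))"
  have lin: "linear_on UNIV (\<theta> (\<rho> X))" for X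
    by (simp add: linear_on_def representation_simps[OF \<theta>])
  have "linear_on ?Z restrict_cocycle"
    by (auto simp: linear_on_def restrict_cocycle_def fun_eq_iff)
  then show ?thesis
    unfolding cohomology_dim_def restrict_cocycle_image[symmetric] restrict_coboundaries[symmetric]
    using quotient_dim_image[OF csubspace_lie_cocycles[OF lin] _ inj_on_restrict_cocycle order_refl lie_coboundaries]
      lie_cocycles_eq[of "\<lambda>X. \<theta> (\<rho> X)" "holonomy A", OF action_zero]
    by (simp add: One_nat_def)
qed

text \<open>The elements that annihilate a given vector form a subalgebra, so it suffices to test
  invariance on generators.\<close>

lemma lie_cohomology_0:
  "cohomology_dim (ce_cochains (holonomy A)) (ce_diff (holonomy A) (\<lambda>X. \<theta> (\<rho> X))) 0 =
   quotient_dim {v. \<forall>u\<in>A1. \<theta> (f u) v = 0} {0}"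
proof -
  note cst = ce_diff_constant[of "\<lambda>X. \<theta> (\<rho> X)", OF action_zero]
  let ?k = "constant_cochain :: 'v \<Rightarrow> _"
  have lin: "linear_on UNIV ?k"
    by (auto simp: linear_on_def constant_cochain_def fun_eq_iff)
  have inj: "inj ?k"
    by (auto simp: inj_def constant_cochain_def fun_eq_iff dest: spec[of _ "[]"])
  have inv: "(\<forall>X\<in>carrier (holonomy A). \<theta> (\<rho> X) v = 0) \<longleftrightarrow> (\<forall>u\<in>A1. \<theta> (f u) v = 0)" for v
  proof
    assume "\<forall>X\<in>carrier (holonomy A). \<theta> (\<rho> X) v = 0"
    then show "\<forall>u\<in>A1. \<theta> (f u) v = 0" using holonomy_gen_carrier restriction_at_gen by simp
  next
    assume *: "\<forall>u\<in>A1. \<theta> (f u) v = 0"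
    show "\<forall>X\<in>carrier (holonomy A). \<theta> (\<rho> X) v = 0"
    proof
      fix X assume "X \<in> carrier (holonomy A)"
      then show "\<theta> (\<rho> X) v = 0"
        by (rule holonomy_induct)
          (use * restriction_at_gen in \<open>simp_all add: restricted_hom representation_simps[OF \<theta>] representation_bracket[OF \<theta>]\<close>)
    qed
  qed
  have Z: "{c \<in> ce_cochains (holonomy A) 0. ce_diff (holonomy A) (\<lambda>X. \<theta> (\<rho> X)) c = 0}
      = ?k ` {v. \<forall>u\<in>A1. \<theta> (f u) v = 0}"
  proof -
    have "ce_diff (holonomy A) (\<lambda>X. \<theta> (\<rho> X)) (?k v) = 0 \<longleftrightarrow> (\<forall>X\<in>carrier (holonomy A). \<theta> (\<rho> X) v = 0)" for v
      by (auto simp: fun_eq_iff cst length_Suc_conv One_nat_def)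
    then show ?thesis unfolding inv[symmetric] ce_cochains_0 by auto
  qed
  show ?thesis
    unfolding cohomology_dim_def Z
    using quotient_dim_image[OF cvs.subspace_UNIV lin inj, of "{v. \<forall>u\<in>A1. \<theta> (f u) v = 0}" "{0}"] by simp
qed

end

end

context connected_cdga
begin

lemma diff_unit: "diff A (unit A) = 0"
proof -
  have d: "diff A (unit A) \<in> grade A 1" using diff_grade[OF unit_grade] by (simp add: One_nat_def)
  \<comment> \<open>the Leibniz rule for the square of the unit doubles its differential\<close>
  have "diff A (mult A (unit A) (unit A)) = mult A (diff A (unit A)) (unit A) + (- 1) ^ 0 *\<^sub>C mult A (unit A) (diff A (unit A))"
    by (rule leibniz[OF unit_grade unit_grade])
  then show ?thesis
    by (simp add: unit_left[OF unit_grade] unit_left[OF d] unit_right[OF d] scaleC_one)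
qed

lemma tensor_space_grade_0:
  "tensor_space (grade A 0) = range ((\<otimes>) (unit A) :: 'v::complex_vector \<Rightarrow> _)"
proof
  have "csubspace (range ((\<otimes>) (unit A) :: 'v \<Rightarrow> _))"
    unfolding cvs.subspace_def
    by (auto simp: pure_tensor_add(2,4)[symmetric] intro: range_eqI[where x = 0])
  moreover have "a \<otimes> b \<in> range ((\<otimes>) (unit A))" if "a \<in> grade A 0" for a and b :: 'v
  proof -
    obtain k where "a = k *\<^sub>C unit A" using \<open>a \<in> grade A 0\<close> unfolding connected by (auto simp: cvs.span_singleton)
    then have "a \<otimes> b = unit A \<otimes> (k *\<^sub>C b)" by (simp add: pure_tensor_add)
    then show ?thesis by blast
  qed
  ultimately show "tensor_space (grade A 0) \<subseteq> range ((\<otimes>) (unit A) :: 'v \<Rightarrow> _)"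
    unfolding tensor_space_def by (intro cvs.span_minimal) auto
qed (auto intro: pure_in_tensor_space unit_grade)

lemma inj_unit_tensor: "inj ((\<otimes>) (unit A) :: 'v::complex_vector \<Rightarrow> _)"
proof (rule injI)
  obtain \<phi> where \<phi>: "\<phi> \<in> dual_space (grade A 0)" "\<phi> (unit A) \<noteq> 0"
    using functional_nonzero[OF subspace_grade unit_grade unit_nonzero] by blast
  fix v w :: 'v assume "unit A \<otimes> v = unit A \<otimes> w"
  then have "slant (grade A 0) \<phi> (unit A \<otimes> v) = slant (grade A 0) \<phi> (unit A \<otimes> w)" by simp
  then show "v = w" using \<phi>(2) by (simp add: slant_pure[OF subspace_grade \<phi>(1) unit_grade])
qed

text \<open>The differential of the unit vanishes, so only the action of \<open>\<omega>\<close> on \<open>v\<close> remains.\<close>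

lemma psi_twisted_diff_unit:
  assumes \<theta>: "bilinear_on UNIV UNIV \<theta>" and \<omega>: "\<omega> \<in> tensor_space (grade A 1)" and u: "u \<in> A1"
  shows "psi A (twisted_diff A \<theta> \<omega> (unit A \<otimes> v)) u = \<theta> (psi A \<omega> u) v"
proof -
  have 0: "twisted_diff A \<theta> \<omega> (unit A \<otimes> v) = tensor_mult A \<theta> \<omega> (unit A \<otimes> v)"
    by (simp add: twisted_diff_def tensor_diff_pure[OF unit_grade] diff_unit)
  have v: "unit A \<otimes> v \<in> tensor_space (grade A 0)" by (rule pure_in_tensor_space[OF unit_grade])
  have into: "tensor_mult A \<theta> \<omega> (unit A \<otimes> v) \<in> tensor_space (grade A 1)"
    if "\<omega> \<in> tensor_space (grade A 1)" for \<omega>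
    using tensor_mult_grade[OF \<theta> that v] by simp
  show ?thesis
    unfolding 0
  proof (rule tensor_eqI[OF _ _ _ \<omega>])
    show "linear_on (tensor_space (grade A 1)) (\<lambda>\<omega>. psi A (tensor_mult A \<theta> \<omega> (unit A \<otimes> v)) u)"
      using into by (intro linear_on_compose[OF tensor_mult_linear(2)[OF \<theta> v] psi_linear_at[OF u]]) auto
    show "linear_on (tensor_space (grade A 1)) (\<lambda>\<omega>. \<theta> (psi A \<omega> u) v)"
      by (rule linear_on_bilinear(1)[OF \<theta> psi_linear_at[OF u]])
    show "psi A (tensor_mult A \<theta> (a \<otimes> b) (unit A \<otimes> v)) u = \<theta> (psi A (a \<otimes> b) u) v" if "a \<in> grade A 1" for a b
      using that by (simp add: tensor_mult_pure[OF \<theta> that unit_grade] unit_right[OF that] psi_pure[OF u that]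
          bilinear_onD[OF \<theta>])
  qed
qed

context
  fixes \<theta> :: "'g::complex_vector \<Rightarrow> 'v::complex_vector \<Rightarrow> 'v" and \<omega> :: "('a, 'g) tensor"
  assumes V: "fin_dim (UNIV :: 'v set)" and fin: "fin_dim (grade A 1)" and \<theta>: "bilinear_on UNIV UNIV \<theta>"
    and \<omega>: "\<omega> \<in> tensor_space (grade A 1)"
begin

text \<open>By connectedness degree zero is \<open>1 \<otimes> V\<close>.\<close>

lemma twisted_cohomology_0:
  "cohomology_dim (\<lambda>j. tensor_space (grade A j)) (twisted_diff A \<theta> \<omega>) 0 =
   quotient_dim {v. \<forall>u\<in>A1. \<theta> (psi A \<omega> u) v = 0} {0}"
proof -
  let ?k = "(\<otimes>) (unit A) :: 'v \<Rightarrow> _"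
  have lin: "linear_on UNIV ?k" by (simp add: linear_on_def pure_tensor_add)
  have inj: "inj_on (psi A) (tensor_space (grade A 1) :: ('a, 'v) tensor set)"
    using bij_betw_psi[OF fin V] by (rule bij_betw_imp_inj_on)
  have p0: "psi A (0 :: ('a, 'v) tensor) = 0"
    by (rule linear_on_0[OF csubspace_tensor_space hom_spaceD(1)[OF psi_in_hom_space_tensor]])
  have "twisted_diff A \<theta> \<omega> (unit A \<otimes> v) = 0 \<longleftrightarrow> (\<forall>u\<in>A1. \<theta> (psi A \<omega> u) v = 0)" for v
  proof -
    have "twisted_diff A \<theta> \<omega> (unit A \<otimes> v) \<in> tensor_space (grade A 1)"
      using twisted_diff_grade[OF \<theta> \<omega> pure_in_tensor_space[OF unit_grade]] by (simp add: One_nat_def)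
    then have "twisted_diff A \<theta> \<omega> (unit A \<otimes> v) = 0 \<longleftrightarrow> psi A (twisted_diff A \<theta> \<omega> (unit A \<otimes> v)) = 0"
      using inj_on_eq_iff[OF inj, of _ 0] cvs.subspace_0[OF csubspace_tensor_space] p0 by metis
    also have "\<dots> \<longleftrightarrow> (\<forall>u\<in>A1. psi A (twisted_diff A \<theta> \<omega> (unit A \<otimes> v)) u = 0)"
      by (auto simp: fun_eq_iff psi_eq)
    finally show ?thesis using psi_twisted_diff_unit[OF \<theta> \<omega>] by simp
  qed
  then have "{t \<in> tensor_space (grade A 0). twisted_diff A \<theta> \<omega> t = 0} = ?k ` {v. \<forall>u\<in>A1. \<theta> (psi A \<omega> u) v = 0}"
    unfolding tensor_space_grade_0 by auto
  then show ?thesis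
    using quotient_dim_image[OF cvs.subspace_UNIV lin inj_unit_tensor, of "{v. \<forall>u\<in>A1. \<theta> (psi A \<omega> u) v = 0}" "{0}"]
    by (simp add: cohomology_dim_def)
qed

text \<open>The map \<open>psi\<close> carries cocycles and coboundaries to the same subspaces of
  \<open>Hom(A\<^sub>1, V)\<close> as the restriction of cocycles of the holonomy Lie algebra to generators does.\<close>

lemma twisted_cohomology_1:
  assumes f: "f = psi A \<omega>"
  shows "cohomology_dim (\<lambda>j. tensor_space (grade A j)) (twisted_diff A \<theta> \<omega>) 1 =
    quotient_dim {\<tau> \<in> hom_space A1. satisfies_cocycle_relators \<theta> f \<tau>}
      (range (\<lambda>v u. if u \<in> A1 then \<theta> (f u) v else 0))"
proof -
  let ?T = "tensor_space (grade A 1) :: ('a, 'v) tensor set"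
  let ?Z = "{t \<in> ?T. twisted_diff A \<theta> \<omega> t = 0}" and ?B = "twisted_diff A \<theta> \<omega> ` tensor_space (grade A 0)"
  have bij: "bij_betw (psi A) ?T (hom_space A1)" by (rule bij_betw_psi[OF fin V])
  have B: "?B \<subseteq> ?T"
    using twisted_diff_grade[OF \<theta> \<omega>, of _ 0] by (auto simp: One_nat_def)
  have "psi A ` ?Z = {\<tau> \<in> hom_space A1. satisfies_cocycle_relators \<theta> f \<tau>}"
    using twisted_cocycle_iff[OF fin V \<theta> \<omega>] bij_betw_imp_surj_on[OF bij, symmetric]
    by (auto simp: satisfies_cocycle_relators_def f)
  moreover have "psi A (twisted_diff A \<theta> \<omega> (unit A \<otimes> v)) = (\<lambda>u. if u \<in> A1 then \<theta> (f u) v else 0)" for v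
  proof
    fix u show "psi A (twisted_diff A \<theta> \<omega> (unit A \<otimes> v)) u = (if u \<in> A1 then \<theta> (f u) v else 0)"
      using psi_twisted_diff_unit[OF \<theta> \<omega>, of u v] by (cases "u \<in> A1") (simp_all add: f, simp add: psi_eq)
  qed
  then have "psi A ` ?B = range (\<lambda>v u. if u \<in> A1 then \<theta> (f u) v else 0)"
    unfolding tensor_space_grade_0 image_image by simp
  ultimately show ?thesis
    using quotient_dim_image[OF csubspace_tensor_space hom_spaceD(1)[OF psi_in_hom_space_tensor]
        bij_betw_imp_inj_on[OF bij], of ?Z ?B] B
    by (auto simp: cohomology_dim_def One_nat_def)
qed

end

lemma bij_betw_flat:
  fixes br :: "'g::complex_vector \<Rightarrow> 'g \<Rightarrow> 'g"
  assumes "fin_dim (grade A 1)" "lie_bracket br" "fin_dim (UNIV :: 'g set)"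
  shows "bij_betw (psi A) (flat_connections A br) (restrict_gen A ` Hom_Lie (holonomy A) br)"
proof -
  let ?T = "tensor_space (grade A 1) :: ('a, 'g) tensor set"
  have bij: "bij_betw (psi A) ?T (hom_space A1)" by (rule bij_betw_psi[OF assms(1,3)])
  have sub: "flat_connections A br \<subseteq> ?T" by (auto simp: flat_connections_def)
  have "psi A ` flat_connections A br = {f \<in> hom_space A1. satisfies_relators A br f}"
    using sub flat_iff[OF assms(1,3,2)] bij_betw_imp_surj_on[OF bij, symmetric] by auto
  then show ?thesis
    unfolding restrict_gen_Hom_Lie[OF assms(2)] using bij_betw_subset[OF bij sub] by simp
qed

lemma bij_betw_resonance:
  fixes br :: "'g::complex_vector \<Rightarrow> 'g \<Rightarrow> 'g" and \<theta> :: "'g \<Rightarrow> 'v::complex_vector \<Rightarrow> 'v"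
  assumes fin: "fin_dim (grade A 1)" and g: "lie_bracket br" "fin_dim (UNIV :: 'g set)"
    and V: "representation br \<theta>" "fin_dim (UNIV :: 'v set)" and i: "i \<le> 1"
  shows "bij_betw (psi A) (resonance_cdga A br \<theta> i r)
    (restrict_gen A ` resonance_lie (holonomy A) br \<theta> i r)"
proof -
  note bij = bij_betw_flat[OF fin g]
  have dim: "cohomology_dim (\<lambda>j. tensor_space (grade A j)) (twisted_diff A \<theta> \<omega>) i =
      cohomology_dim (ce_cochains (holonomy A)) (ce_diff (holonomy A) (\<lambda>x. \<theta> (\<rho> x))) i"
    if "\<omega> \<in> flat_connections A br" "\<rho> \<in> Hom_Lie (holonomy A) br" "psi A \<omega> = restrict_gen A \<rho>" for \<omega> \<rho>
  proof -
    have \<omega>: "\<omega> \<in> tensor_space (grade A 1)" using that(1) by (simp add: flat_connections_def)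
    have "i = 0 \<or> i = 1" using i by auto
    then show ?thesis
      using twisted_cohomology_0[OF V(2) fin representation_bilinear[OF V(1)] \<omega>]
        twisted_cohomology_1[OF V(2) fin representation_bilinear[OF V(1)] \<omega> refl]
        lie_cohomology_0[OF g(1) V(1) that(2,3)] lie_cohomology_1[OF g(1) V(1) that(2,3)]
      by auto
  qed
  have "psi A ` resonance_cdga A br \<theta> i r = restrict_gen A ` resonance_lie (holonomy A) br \<theta> i r"
  proof (intro equalityI subsetI)
    fix f assume "f \<in> psi A ` resonance_cdga A br \<theta> i r"
    then obtain \<omega> where \<omega>: "\<omega> \<in> resonance_cdga A br \<theta> i r" "f = psi A \<omega>" by blast
    then have flat: "\<omega> \<in> flat_connections A br" by (simp add: resonance_cdga_def)
    then obtain \<rho> where "\<rho> \<in> Hom_Lie (holonomy A) br" "psi A \<omega> = restrict_gen A \<rho>"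
      using bij_betw_imp_surj_on[OF bij] by (metis image_iff)
    then show "f \<in> restrict_gen A ` resonance_lie (holonomy A) br \<theta> i r"
      using \<omega> dim[OF flat] by (auto simp: resonance_cdga_def resonance_lie_def)
  next
    fix f assume "f \<in> restrict_gen A ` resonance_lie (holonomy A) br \<theta> i r"
    then obtain \<rho> where \<rho>: "\<rho> \<in> resonance_lie (holonomy A) br \<theta> i r" "f = restrict_gen A \<rho>" by blast
    then have hom: "\<rho> \<in> Hom_Lie (holonomy A) br" by (simp add: resonance_lie_def)
    then obtain \<omega> where \<omega>: "\<omega> \<in> flat_connections A br" "psi A \<omega> = restrict_gen A \<rho>"
      using bij_betw_imp_surj_on[OF bij] by (metis image_iff)
    then show "f \<in> psi A ` resonance_cdga A br \<theta> i r"
      using \<rho> \<omega> dim[OF \<omega>(1) hom \<omega>(2)]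
      by (intro image_eqI[of _ _ \<omega>]) (auto simp: resonance_cdga_def resonance_lie_def)
  qed
  moreover have "resonance_cdga A br \<theta> i r \<subseteq> flat_connections A br" by (auto simp: resonance_cdga_def)
  ultimately show ?thesis using bij_betw_subset[OF bij] by blast
qed

end

section \<open>Vector-valued forms\<close>

text \<open>For a first factor of degree one the shuffles only choose the position of its
  argument.\<close>

lemma wedge_one_form:
  assumes "alternating 1 \<eta>"
  shows "wedge \<eta> \<beta> xs = (\<Sum>i<length xs. (- 1) ^ i * \<eta> [xs ! i] * \<beta> (omit i xs))"
proof (induction xs arbitrary: \<beta>)
  case Nil
  have "\<eta> [] = 0" using assms by (simp add: alternating_def)
  then show ?case by simp
next
  case (Cons x xs)
  have "contract x \<eta> = \<eta> [x] *\<^sub>C (\<lambda>xs. if xs = [] then 1 else 0)"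
  proof
    fix ys show "contract x \<eta> ys = (\<eta> [x] *\<^sub>C (\<lambda>xs. if xs = [] then 1 else 0)) ys"
      using assms by (cases ys) (auto simp: contract_def alternating_def scaleC_complex_def)
  qed
  then have 1: "wedge (contract x \<eta>) \<beta> xs = \<eta> [x] * \<beta> xs"
    by (simp add: wedge_unit scaleC_complex_def)
  have "parity \<eta> = - \<eta>" using parity_alternating[OF assms] by simp
  then have 2: "wedge (parity \<eta>) (contract x \<beta>) xs = - wedge \<eta> (contract x \<beta>) xs" by simp
  show ?case
    unfolding wedge_Cons 1 2 Cons.IH
    by (simp add: sum.lessThan_Suc_shift contract_def sum_negf del: sum.lessThan_Suc)
qed

text \<open>A tensor of scalar forms and vectors, seen as a form with values in \<open>V\<close>. Only the pointwise
  structure of forms enters, so the arguments have an arbitrary type.\<close>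

definition vector_form :: "('x \<Rightarrow> complex, 'v::complex_vector) tensor \<Rightarrow> 'x \<Rightarrow> 'v" where
  "vector_form = tensor_lift UNIV (\<lambda>\<alpha> v xs. \<alpha> xs *\<^sub>C v)"

lemma vector_form_bilinear: "bilinear_on UNIV UNIV (\<lambda>(\<alpha> :: 'x \<Rightarrow> complex) (v :: 'v::complex_vector) xs. \<alpha> xs *\<^sub>C v)"
  by (rule bilinear_onI)
    (simp_all add: fun_eq_iff scaleC_add_left scaleC_add_right scaleC_scaleC scaleC_complex_def mult.commute)

lemma vector_form_linear: "linear_on (tensor_space W) vector_form"
  unfolding vector_form_def
  by (rule linear_on_subset[OF tensor_lift_linear[OF cvs.subspace_UNIV vector_form_bilinear] tensor_space_mono]) simp

lemma vector_form_pure: "vector_form (\<alpha> \<otimes> v) xs = \<alpha> xs *\<^sub>C v"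
  unfolding vector_form_def by (simp add: tensor_lift(2)[OF cvs.subspace_UNIV vector_form_bilinear])

lemma vector_form_expand: "vector_form (\<Sum>e\<in>E. w e \<otimes> e) xs = (\<Sum>e\<in>E. w e xs *\<^sub>C e)"
  using linear_on_sum[OF csubspace_tensor_space linear_on_apply[OF vector_form_linear[of UNIV], of xs],
      of E "\<lambda>e. w e \<otimes> e" "\<lambda>_. 1"]
  by (simp add: vector_form_pure pure_in_tensor_space scaleC_one)

lemma inj_on_vector_form:
  assumes W: "csubspace W" and V: "fin_dim (UNIV :: 'v::complex_vector set)"
  shows "inj_on vector_form (tensor_space W :: ('x \<Rightarrow> complex, 'v) tensor set)"
proof (rule inj_onI)
  obtain E and \<kappa> :: "'v \<Rightarrow> 'v \<Rightarrow> complex" where E: "finite E" "\<And>b. \<kappa> b \<in> dual_space UNIV"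
    "\<And>x. x = (\<Sum>b\<in>E. \<kappa> b x *\<^sub>C b)"
    "\<And>b b'. b \<in> E \<Longrightarrow> b' \<in> E \<Longrightarrow> \<kappa> b b' = (if b = b' then 1 else 0)"
    by (rule finite_dual_basis[OF V]) auto
  fix s t :: "('x \<Rightarrow> complex, 'v) tensor"
  assume st: "s \<in> tensor_space W" "t \<in> tensor_space W" "vector_form s = vector_form t"
  then have d: "s - t \<in> tensor_space W" by (intro cvs.subspace_diff csubspace_tensor_space)
  obtain w where w: "s - t = (\<Sum>e\<in>E. w e \<otimes> e)" "\<And>e. w e \<in> W"
    using tensor_space_expand[OF W E(1,3) d] by blast
  have "vector_form (s - t) = 0"
    using linear_on_diff[OF csubspace_tensor_space vector_form_linear st(1,2)] st(3) by simp
  then have "(\<Sum>e\<in>E. w e xs *\<^sub>C e) = 0" for xs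
    using vector_form_expand[of w E xs] w(1) by simp
  then have "w e xs = 0" if "e \<in> E" for e xs
    using basis_coefficients_zero[OF E(1,2,4) cvs.subspace_UNIV, of "\<lambda>e. w e xs" e] that by simp
  then have "w e = 0" if "e \<in> E" for e using that by (simp add: fun_eq_iff)
  then show "s = t" using w(1) by simp
qed

lemma csubspace_ce_cochains: "csubspace (ce_cochains (lie_of br) n)"
  by (auto simp: cvs.subspace_def ce_cochains_def lie_of_def scaleC_add_right add_ac cvs.scale_left_commute)

text \<open>As \<open>V\<close> is finite-dimensional, a form with values in \<open>V\<close> is the sum of its coordinate forms,
  each tensored with a basis vector.\<close>

lemma vector_form_image:
  assumes V: "fin_dim (UNIV :: 'v::complex_vector set)"
  shows "vector_form ` (tensor_space (ce_cochains (lie_of br) n) :: ('f::complex_vector list \<Rightarrow> complex, 'v) tensor set)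
    = ce_cochains (lie_of br) n"
proof (intro equalityI subsetI)
  fix c :: "'f list \<Rightarrow> 'v"
  assume "c \<in> vector_form ` (tensor_space (ce_cochains (lie_of br) n) :: ('f list \<Rightarrow> complex, 'v) tensor set)"
  then obtain t :: "('f list \<Rightarrow> complex, 'v) tensor" where t: "t \<in> tensor_space (ce_cochains (lie_of br) n)" "c = vector_form t" by blast
  have "vector_form t \<in> ce_cochains (lie_of br) n"
  proof (rule linear_on_tensor_space_into[OF vector_form_linear _ csubspace_ce_cochains t(1)])
    fix a :: "'f list \<Rightarrow> complex" and b :: 'v assume "a \<in> ce_cochains (lie_of br) n"
    then show "vector_form (a \<otimes> b) \<in> ce_cochains (lie_of br) n"
      by (auto simp: ce_cochains_def lie_of_def vector_form_pure scaleC_add_left scaleC_scaleC scaleC_complex_def)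
  qed
  then show "c \<in> ce_cochains (lie_of br) n" using t(2) by simp
next
  obtain E and \<kappa> :: "'v \<Rightarrow> 'v \<Rightarrow> complex" where E: "finite E" "\<And>b. \<kappa> b \<in> dual_space UNIV"
    "\<And>x. x = (\<Sum>b\<in>E. \<kappa> b x *\<^sub>C b)"
    by (rule finite_dual_basis[OF V]) auto
  fix c :: "'f list \<Rightarrow> 'v" assume c: "c \<in> ce_cochains (lie_of br) n"
  let ?t = "\<Sum>e\<in>E. (\<lambda>xs. \<kappa> e (c xs)) \<otimes> e"
  note \<kappa> = linear_onD[OF hom_spaceD(1)[OF E(2)], simplified] linear_on_0[OF cvs.subspace_UNIV hom_spaceD(1)[OF E(2)]]
  have "(\<lambda>xs. \<kappa> e (c xs)) \<in> ce_cochains (lie_of br) n" for e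
    using c by (auto simp: ce_cochains_def lie_of_def \<kappa>)
  then have "?t \<in> tensor_space (ce_cochains (lie_of br) n)"
    by (intro cvs.subspace_sum csubspace_tensor_space pure_in_tensor_space)
  moreover have "vector_form ?t = c"
    by (rule ext) (unfold vector_form_expand, rule E(3)[symmetric])
  ultimately show "c \<in> vector_form ` (tensor_space (ce_cochains (lie_of br) n) :: ('f list \<Rightarrow> complex, 'v) tensor set)"
    by (intro image_eqI[where x = ?t]) simp_all
qed

section \<open>The Chevalley-Eilenberg algebra\<close>

context
  fixes br :: "'f::complex_vector \<Rightarrow> 'f \<Rightarrow> 'f"
  assumes f: "lie_bracket br"
begin

interpretation connected_cdga "CE_algebra br"
  by (rule connected_cdga_CE_algebra[OF f])

abbreviation (input) "C \<equiv> CE_algebra br"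

lemma grade_ce: "grade C = ce_cochains (lie_of br)"
  and mult_ce: "mult C = wedge"
  and diff_ce: "diff C = CE_diff br"
  by (simp_all add: CE_algebra_def)

lemma grade_alternating: "\<alpha> \<in> grade C n \<longleftrightarrow> alternating n \<alpha>"
  by (simp add: grade_CE_algebra)

lemma vector_form_mult:
  assumes m: "bilinear_on UNIV UNIV m" and \<omega>: "\<omega> \<in> tensor_space (grade C 1)"
    and t: "t \<in> tensor_space (grade C n)"
  shows "vector_form (tensor_mult C m \<omega> t) xs =
    (\<Sum>i<length xs. (- 1) ^ i *\<^sub>C m (vector_form \<omega> [xs ! i]) (vector_form t (omit i xs)))"
proof -
  let ?R = "\<lambda>\<omega> t. \<Sum>i<length xs. (- 1) ^ i *\<^sub>C m (vector_form \<omega> [xs ! i]) (vector_form t (omit i xs))"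
  have R: "linear_on (tensor_space W) (\<lambda>\<omega>. ?R \<omega> t)" "linear_on (tensor_space W') (\<lambda>t. ?R \<omega> t)" for \<omega> t W W'
    by (intro linear_on_fun_sum linear_on_closed(2) linear_on_bilinear[OF m] linear_on_apply[OF vector_form_linear])+
  have L: "linear_on (tensor_space (grade C 1)) (\<lambda>\<omega>. vector_form (tensor_mult C m \<omega> t) xs)"
    if "t \<in> tensor_space (grade C n)" for t
    using tensor_mult_grade[OF m _ that, of _ 1]
    by (intro linear_on_compose[OF tensor_mult_linear(2)[OF m that] linear_on_apply[OF vector_form_linear[of "grade C (1 + n)"]]]) auto
  have L': "linear_on (tensor_space (grade C n)) (\<lambda>t. vector_form (tensor_mult C m \<omega> t) xs)"
    if "\<omega> \<in> tensor_space (grade C 1)" for \<omega>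
    using tensor_mult_grade[OF m that, of _ n]
    by (intro linear_on_compose[OF tensor_mult_linear(1)[OF m that] linear_on_apply[OF vector_form_linear[of "grade C (1 + n)"]]]) auto
  show ?thesis
  proof (rule tensor_eqI[OF L[OF t] R(1) _ \<omega>])
    fix \<eta> x assume \<eta>: "\<eta> \<in> grade C 1"
    show "vector_form (tensor_mult C m (\<eta> \<otimes> x) t) xs = ?R (\<eta> \<otimes> x) t"
    proof (rule tensor_eqI[OF L'[OF pure_in_tensor_space[OF \<eta>]] R(2) _ t])
      fix \<alpha> v assume \<alpha>: "\<alpha> \<in> grade C n"
      show "vector_form (tensor_mult C m (\<eta> \<otimes> x) (\<alpha> \<otimes> v)) xs = ?R (\<eta> \<otimes> x) (\<alpha> \<otimes> v)"
        using \<eta> by (simp add: tensor_mult_pure[OF m \<eta> \<alpha>] vector_form_pure mult_ce grade_alternating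
            wedge_one_form cvs.scale_sum_left bilinear_onD[OF m] scaleC_scaleC mult_ac)
    qed
  qed
qed

lemma vector_form_diff:
  assumes t: "t \<in> tensor_space (grade C n)"
  shows "vector_form (tensor_diff C t) xs = (\<Sum>j<length xs. \<Sum>i<j.
    (- 1) ^ (i + j) *\<^sub>C vector_form t (br (xs ! i) (xs ! j) # omit i (omit j xs)))"
proof (rule tensor_eqI[OF _ _ _ t])
  show "linear_on (tensor_space (grade C n)) (\<lambda>t. \<Sum>j<length xs. \<Sum>i<j.
      (- 1) ^ (i + j) *\<^sub>C vector_form t (br (xs ! i) (xs ! j) # omit i (omit j xs)))"
    by (intro linear_on_fun_sum linear_on_closed(2) linear_on_apply[OF vector_form_linear])
  show "linear_on (tensor_space (grade C n)) (\<lambda>t. vector_form (tensor_diff C t) xs)"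
    using tensor_diff_grade[of _ n]
    by (intro linear_on_compose[OF tensor_diff_linear linear_on_apply[OF vector_form_linear[of "grade C (Suc n)"]]]) auto
  show "vector_form (tensor_diff C (\<alpha> \<otimes> v)) xs = (\<Sum>j<length xs. \<Sum>i<j.
      (- 1) ^ (i + j) *\<^sub>C vector_form (\<alpha> \<otimes> v) (br (xs ! i) (xs ! j) # omit i (omit j xs)))"
    if "\<alpha> \<in> grade C n" for \<alpha> v
    by (simp add: tensor_diff_pure[OF that] vector_form_pure diff_ce CE_diff_eq cvs.scale_sum_left scaleC_scaleC)
qed

text \<open>The product with \<open>\<omega>\<close> gives the terms of the Chevalley-Eilenberg differential that involve
  the action, the differential of the algebra those that involve the bracket.\<close>

lemma vector_form_twisted_diff:
  assumes \<theta>: "bilinear_on UNIV UNIV \<theta>" and \<omega>: "\<omega> \<in> tensor_space (grade C 1)"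
    and t: "t \<in> tensor_space (grade C n)"
  shows "vector_form (twisted_diff C \<theta> \<omega> t) =
    ce_diff (lie_of br) (\<lambda>x. \<theta> (vector_form \<omega> [x])) (vector_form t)"
proof
  fix xs
  have "tensor_diff C t \<in> tensor_space (grade C (Suc n))" "tensor_mult C \<theta> \<omega> t \<in> tensor_space (grade C (Suc n))"
    using tensor_diff_grade[OF t] tensor_mult_grade[OF \<theta> \<omega> t] by (simp_all add: plus_1_eq_Suc)
  then have "vector_form (twisted_diff C \<theta> \<omega> t) = vector_form (tensor_diff C t) + vector_form (tensor_mult C \<theta> \<omega> t)"
    unfolding twisted_diff_def by (rule linear_onD(1)[OF vector_form_linear])
  then show "vector_form (twisted_diff C \<theta> \<omega> t) xs =
      ce_diff (lie_of br) (\<lambda>x. \<theta> (vector_form \<omega> [x])) (vector_form t) xs"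
    by (simp add: vector_form_diff[OF t] vector_form_mult[OF \<theta> \<omega> t] ce_diff_def lie_of_def)
qed

lemma CE_cohomology:
  fixes \<theta> :: "'g::complex_vector \<Rightarrow> 'v::complex_vector \<Rightarrow> 'v"
  assumes V: "fin_dim (UNIV :: 'v set)" and \<theta>: "bilinear_on UNIV UNIV \<theta>" and \<omega>: "\<omega> \<in> tensor_space (grade C 1)"
  shows "cohomology_dim (\<lambda>j. tensor_space (grade C j)) (twisted_diff C \<theta> \<omega>) i =
    cohomology_dim (ce_cochains (lie_of br)) (ce_diff (lie_of br) (\<lambda>x. \<theta> (vector_form \<omega> [x]))) i"
proof (rule cohomology_dim_iso[where F = vector_form])
  show "vector_form ` tensor_space (grade C j) = (ce_cochains (lie_of br) j :: ('f list \<Rightarrow> 'v) set)" for j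
    unfolding grade_ce by (rule vector_form_image[OF V])
qed (rule csubspace_tensor_space twisted_diff_grade[OF \<theta> \<omega>] vector_form_linear
    inj_on_vector_form[OF subspace_grade V] vector_form_twisted_diff[OF \<theta> \<omega>]; assumption?)+

lemma CE_eval_apply: "\<alpha> \<in> grade C 1 \<Longrightarrow> CE_eval br x \<alpha> = \<alpha> [x]"
  by (simp add: CE_eval_def)

lemma one_form_linear:
  assumes "\<alpha> \<in> grade C 1"
  shows "\<alpha> [x + y] = \<alpha> [x] + \<alpha> [y]" "\<alpha> [k *\<^sub>C x] = k * \<alpha> [x]"
proof -
  have "alternating 1 \<alpha>" using assms by (simp add: grade_alternating)
  then have *: "\<And>us x y vs. \<alpha> (us @ (x + y) # vs) = \<alpha> (us @ x # vs) + \<alpha> (us @ y # vs)"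
    "\<And>us k x vs. \<alpha> (us @ (k *\<^sub>C x) # vs) = k *\<^sub>C \<alpha> (us @ x # vs)"
    by (simp_all add: alternating_def)
  show "\<alpha> [x + y] = \<alpha> [x] + \<alpha> [y]" "\<alpha> [k *\<^sub>C x] = k * \<alpha> [x]"
    using *(1)[of "[]" x y "[]"] *(2)[of "[]" k x "[]"] by (simp_all add: scaleC_complex_def)
qed

lemma CE_eval_dual: "CE_eval br x \<in> A1"
  using cvs.subspace_add[OF subspace_grade] cvs.subspace_scale[OF subspace_grade]
  by (auto simp: hom_space_def linear_on_def CE_eval_def)

lemma CE_eval_linear: "linear_on UNIV (CE_eval br)"
  by (auto simp: linear_on_def CE_eval_def fun_eq_iff one_form_linear scaleC_complex_def)

lemma psi_CE_eval:
  assumes "\<omega> \<in> tensor_space (grade C 1)"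
  shows "psi C \<omega> (CE_eval br x) = vector_form \<omega> [x]"
  by (rule tensor_eqI[OF psi_linear_at[OF CE_eval_dual] linear_on_apply[OF vector_form_linear] _ assms])
    (simp add: psi_pure[OF CE_eval_dual] CE_eval_apply vector_form_pure)

text \<open>Evaluated at two vectors, the flatness equation is the Maurer-Cartan equation: the connection
  form is compatible with the brackets.\<close>

lemma CE_flat_iff:
  fixes brg :: "'g::complex_vector \<Rightarrow> 'g \<Rightarrow> 'g"
  assumes g: "lie_bracket brg" "fin_dim (UNIV :: 'g set)" and \<omega>: "\<omega> \<in> tensor_space (grade C 1)"
  shows "\<omega> \<in> flat_connections C brg \<longleftrightarrow>
    (\<forall>x y. vector_form \<omega> [br x y] = brg (vector_form \<omega> [x]) (vector_form \<omega> [y]))"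
proof -
  have b: "bilinear_on UNIV UNIV brg" using g(1) by (simp add: lie_bracket_def)
  let ?F = "tensor_diff C \<omega> + (1 / 2) *\<^sub>C tensor_mult C brg \<omega> \<omega>"
  have d: "tensor_diff C \<omega> \<in> tensor_space (grade C 2)"
    and m: "tensor_mult C brg \<omega> \<omega> \<in> tensor_space (grade C 2)"
    using tensor_diff_grade[OF \<omega>] tensor_mult_grade[OF b \<omega> \<omega>] by simp_all
  note m' = cvs.subspace_scale[OF csubspace_tensor_space m, of "1 / 2"]
  have F: "?F \<in> tensor_space (grade C 2)" by (rule cvs.subspace_add[OF csubspace_tensor_space d m'])
  have val: "vector_form ?F [x, y] = brg (vector_form \<omega> [x]) (vector_form \<omega> [y]) - vector_form \<omega> [br x y]" for x y
  proof -
    have two: "2 *\<^sub>C z = z + z" for z :: 'g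
      using scaleC_add_left[of 1 1 z] by (simp add: scaleC_one)
    have half: "(1 / 2) *\<^sub>C (z + z) = z" for z :: 'g
      unfolding two[symmetric] by (simp add: scaleC_scaleC scaleC_one)
    have "vector_form ?F [x, y] = vector_form (tensor_diff C \<omega>) [x, y] + (1 / 2) *\<^sub>C vector_form (tensor_mult C brg \<omega> \<omega>) [x, y]"
      using linear_onD(1)[OF vector_form_linear d m'] linear_onD(2)[OF vector_form_linear m, of "1 / 2"] by simp
    also have "vector_form (tensor_diff C \<omega>) [x, y] = - vector_form \<omega> [br x y]"
      by (simp add: vector_form_diff[OF \<omega>] lessThan_Suc omit_def)
    also have "vector_form (tensor_mult C brg \<omega> \<omega>) [x, y]
        = brg (vector_form \<omega> [x]) (vector_form \<omega> [y]) + brg (vector_form \<omega> [x]) (vector_form \<omega> [y])"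
      using br_antisym[OF g(1), of "vector_form \<omega> [y]" "vector_form \<omega> [x]"]
      by (simp add: vector_form_mult[OF b \<omega> \<omega>] lessThan_Suc omit_def scaleC_one)
    finally show ?thesis by (simp add: half)
  qed
  have "?F = 0 \<longleftrightarrow> vector_form ?F = 0"
  proof -
    have "vector_form (0 :: ('f list \<Rightarrow> complex, 'g) tensor) = 0"
      by (rule linear_on_0[OF csubspace_tensor_space vector_form_linear])
    then show ?thesis
      using inj_on_eq_iff[OF inj_on_vector_form[OF subspace_grade g(2)] F cvs.subspace_0[OF csubspace_tensor_space]] by simp
  qed
  also have "\<dots> \<longleftrightarrow> (\<forall>x y. vector_form ?F [x, y] = 0)"
  proof
    assume *: "\<forall>x y. vector_form ?F [x, y] = 0"
    have "vector_form ?F \<in> ce_cochains (lie_of br) 2"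
      using F vector_form_image[OF g(2), of br 2] unfolding grade_ce by blast
    then have "vector_form ?F xs = 0" if "length xs \<noteq> 2" for xs
      using that by (simp add: ce_cochains_def)
    then have "vector_form ?F xs = 0" for xs
      using * by (cases "length xs = 2") (auto simp: numeral_2_eq_2 length_Suc_conv)
    then show "vector_form ?F = 0" by (simp add: fun_eq_iff)
  qed simp
  finally show ?thesis
    using \<omega> by (auto simp: flat_connections_def val)
qed

text \<open>The value at other lists is \<open>0\<close>, as required of a homogeneous form of degree one.\<close>

definition one_form :: "('f \<Rightarrow> complex) \<Rightarrow> 'f list \<Rightarrow> complex" where
  "one_form \<kappa> xs = (case xs of [x] \<Rightarrow> \<kappa> x | _ \<Rightarrow> 0)"

lemma one_form_grade: "linear_on UNIV \<kappa> \<Longrightarrow> one_form \<kappa> \<in> grade C 1"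
  unfolding grade_ce ce_cochains_1
  by (auto simp: one_form_def lie_of_def linear_on_def split: list.splits)

lemma grade_1_eqI:
  assumes "\<alpha> \<in> grade C 1" "\<beta> \<in> grade C 1" "\<And>x. \<alpha> [x] = \<beta> [x]"
  shows "\<alpha> = \<beta>"
proof
  fix xs show "\<alpha> xs = \<beta> xs"
  proof (cases "\<exists>x. xs = [x]")
    case False
    then have "length xs \<noteq> 1" by (cases xs) auto
    then show ?thesis using assms(1,2) by (simp add: grade_alternating alternating_def)
  qed (use assms(3) in auto)
qed

text \<open>For the functional \<open>\<gamma> \<mapsto> \<gamma>(x, y)\<close> on two-forms, the relator says that the bracket of the
  generators \<open>x\<close> and \<open>y\<close> in the holonomy Lie algebra is the generator \<open>br x y\<close>.\<close>

lemma cup_presentation_eval: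
  defines "\<phi> \<equiv> \<lambda>x y \<gamma>. if \<gamma> \<in> grade C 2 then \<gamma> [x, y] else 0"
  shows "cup_presentation C (\<phi> x y) [(CE_eval br x, CE_eval br y)]"
    and "diff_dual C (\<phi> x y) = (- 1) *\<^sub>C CE_eval br (br x y)"
proof -
  have m: "mult C a b \<in> grade C 2" if "a \<in> grade C 1" "b \<in> grade C 1" for a b
    using mult_grade[OF that] by simp
  have d: "diff C a \<in> grade C 2" if "a \<in> grade C 1" for a
    using diff_grade[OF that] by simp
  have "\<phi> x y \<in> dual_space (grade C 2)"
    using cvs.subspace_add[OF subspace_grade[of 2]] cvs.subspace_scale[OF subspace_grade[of 2]]
    by (auto simp: hom_space_def linear_on_def \<phi>_def)
  moreover have "cup_dual C (\<phi> x y) = wedge2 (CE_eval br x) (CE_eval br y)"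
    by (intro ext) (auto simp: cup_dual_def wedge2_def \<phi>_def m mult_CE_algebra_1 CE_eval_def)
  ultimately show "cup_presentation C (\<phi> x y) [(CE_eval br x, CE_eval br y)]"
    by (simp add: cup_presentation_def CE_eval_dual)
  show "diff_dual C (\<phi> x y) = (- 1) *\<^sub>C CE_eval br (br x y)"
    by (intro ext) (auto simp: diff_dual_def \<phi>_def d diff_CE_algebra_1 CE_eval_def)
qed

abbreviation (input) "holonomy_section x \<equiv> holonomy_gen C (CE_eval br x)"

text \<open>Linearity is the linearity of generators; compatibility with brackets is the vanishing of the
  relators that come from evaluation of two-forms.\<close>

lemma holonomy_section_hom: "lie_hom (lie_of br) (holonomy C) holonomy_section"
proof -
  interpret H: nonassociative_algebra "holonomy C" by (rule nonassociative_holonomy)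
  note gen = holonomy_gen_carrier[OF CE_eval_dual]
  have "holonomy_section (br x y) = bracket (holonomy C) (holonomy_section x) (holonomy_section y)" for x y
  proof (rule H.eq_of_add_neg[OF _ _ holonomy_gen_carrier[OF cvs.subspace_0[OF csubspace_hom_space]], symmetric])
    show "add (holonomy C) (bracket (holonomy C) (holonomy_section x) (holonomy_section y))
        (smult (holonomy C) (- 1) (holonomy_section (br x y))) = smult (holonomy C) 0 (holonomy_gen C 0)"
      using holonomy_relator[OF cup_presentation_eval(1)[of x y]]
      unfolding relator_def cup_presentation_eval(2) holonomy_gen_linear(2)[OF CE_eval_dual] by simp
  qed (simp_all add: gen H.bracket_closed)
  moreover have "holonomy_section (x + y) = add (holonomy C) (holonomy_section x) (holonomy_section y)"
    "holonomy_section (c *\<^sub>C x) = smult (holonomy C) c (holonomy_section x)" for x y c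
    using CE_eval_linear holonomy_gen_linear CE_eval_dual by (simp_all add: linear_on_def)
  ultimately show ?thesis using gen by (simp add: lie_hom_def lie_of_def)
qed

context
  assumes fin: "fin_dim (UNIV :: 'f set)"
begin

lemma CE_basis:
  obtains E \<kappa> where "finite E" "\<And>e. \<kappa> e \<in> grade C 1" "\<And>x. x = (\<Sum>e\<in>E. \<kappa> e [x] *\<^sub>C e)"
    "\<And>\<alpha>. \<alpha> \<in> grade C 1 \<Longrightarrow> \<alpha> = (\<Sum>e\<in>E. \<alpha> [e] *\<^sub>C \<kappa> e)"
proof -
  obtain E and \<kappa> :: "'f \<Rightarrow> 'f \<Rightarrow> complex" where E: "finite E" "\<And>b. \<kappa> b \<in> dual_space UNIV"
    "\<And>x. x = (\<Sum>b\<in>E. \<kappa> b x *\<^sub>C b)"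
    by (rule finite_dual_basis[OF fin]) auto
  show ?thesis
  proof
    show k: "one_form (\<kappa> e) \<in> grade C 1" for e by (rule one_form_grade[OF hom_spaceD(1)[OF E(2)]])
    show "x = (\<Sum>e\<in>E. one_form (\<kappa> e) [x] *\<^sub>C e)" for x
      unfolding one_form_def using E(3) by simp
    show "\<alpha> = (\<Sum>e\<in>E. \<alpha> [e] *\<^sub>C one_form (\<kappa> e))" if \<alpha>: "\<alpha> \<in> grade C 1" for \<alpha>
    proof (rule grade_1_eqI[OF \<alpha>])
      show "(\<Sum>e\<in>E. \<alpha> [e] *\<^sub>C one_form (\<kappa> e)) \<in> grade C 1"
        by (intro cvs.subspace_sum cvs.subspace_scale subspace_grade k)
      fix x
      have lin: "linear_on UNIV (\<lambda>x. \<alpha> [x])"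
        by (simp add: linear_on_def one_form_linear[OF \<alpha>] scaleC_complex_def)
      have "\<alpha> [x] = \<alpha> [\<Sum>e\<in>E. \<kappa> e x *\<^sub>C e]" using E(3)[of x] by (rule arg_cong)
      also have "\<dots> = (\<Sum>e\<in>E. \<kappa> e x *\<^sub>C \<alpha> [e])"
        by (rule linear_on_sum[OF cvs.subspace_UNIV lin]) simp
      finally show "\<alpha> [x] = (\<Sum>e\<in>E. \<alpha> [e] *\<^sub>C one_form (\<kappa> e)) [x]"
        by (simp add: fun_sum_apply one_form_def scaleC_complex_def mult.commute)
    qed
  qed (rule E(1))
qed

lemma fin_dim_grade_1: "fin_dim (grade C 1)"
proof -
  obtain E \<kappa> where E: "finite E" "\<And>e. \<kappa> e \<in> grade C 1" "\<And>x. x = (\<Sum>e\<in>E. \<kappa> e [x] *\<^sub>C e)"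
    "\<And>\<alpha>. \<alpha> \<in> grade C 1 \<Longrightarrow> \<alpha> = (\<Sum>e\<in>E. \<alpha> [e] *\<^sub>C \<kappa> e)"
    by (rule CE_basis) blast
  have "\<alpha> \<in> cspan (\<kappa> ` E)" if "\<alpha> \<in> grade C 1" for \<alpha>
  proof -
    have "(\<Sum>e\<in>E. \<alpha> [e] *\<^sub>C \<kappa> e) \<in> cspan (\<kappa> ` E)"
      by (intro cvs.span_sum cvs.span_scale cvs.span_base) auto
    then show ?thesis by (rule ssubst[OF E(4)[OF that]])
  qed
  moreover have "cspan (\<kappa> ` E) \<subseteq> grade C 1"
    using E(2) by (intro cvs.span_minimal subspace_grade) auto
  ultimately show ?thesis using E(1) unfolding fin_dim_def by blast
qed

text \<open>This is the reflexivity of a finite-dimensional space; the inverse is written in coordinates.\<close>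

lemma CE_eval_inverse:
  obtains h where "h \<in> hom_space A1" "\<And>x. h (CE_eval br x) = x" "\<And>u. u \<in> A1 \<Longrightarrow> CE_eval br (h u) = u"
proof -
  obtain E \<kappa> where E: "finite E" "\<And>e. \<kappa> e \<in> grade C 1" "\<And>x. x = (\<Sum>e\<in>E. \<kappa> e [x] *\<^sub>C e)"
    "\<And>\<alpha>. \<alpha> \<in> grade C 1 \<Longrightarrow> \<alpha> = (\<Sum>e\<in>E. \<alpha> [e] *\<^sub>C \<kappa> e)"
    by (rule CE_basis) blast
  let ?h = "\<lambda>u. if u \<in> A1 then (\<Sum>e\<in>E. u (\<kappa> e) *\<^sub>C e) else 0"
  show ?thesis
  proof
    show "?h \<in> hom_space A1"
      by (auto simp: hom_space_def[of "dual_space _"] linear_on_def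
          cvs.subspace_add[OF csubspace_hom_space] cvs.subspace_scale[OF csubspace_hom_space] scaleC_add_left sum.distrib
          cvs.scale_sum_right scaleC_scaleC scaleC_complex_def)
    show "?h (CE_eval br x) = x" for x
      using E(3)[of x, symmetric] by (simp add: CE_eval_dual CE_eval_apply E(2))
    show "CE_eval br (?h u) = u" if u: "u \<in> A1" for u
    proof (rule hom_space_ext[OF CE_eval_dual u])
      fix \<alpha> assume \<alpha>: "\<alpha> \<in> grade C 1"
      have lin: "linear_on UNIV (\<lambda>x. \<alpha> [x])"
        by (simp add: linear_on_def one_form_linear[OF \<alpha>] scaleC_complex_def)
      have "CE_eval br (?h u) \<alpha> = \<alpha> [\<Sum>e\<in>E. u (\<kappa> e) *\<^sub>C e]" by (simp add: CE_eval_apply[OF \<alpha>] u)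
      also have "\<dots> = (\<Sum>e\<in>E. u (\<kappa> e) *\<^sub>C \<alpha> [e])"
        by (rule linear_on_sum[OF cvs.subspace_UNIV lin]) simp
      also have "\<dots> = (\<Sum>e\<in>E. \<alpha> [e] *\<^sub>C u (\<kappa> e))" by (simp add: scaleC_complex_def mult.commute)
      also have "\<dots> = u (\<Sum>e\<in>E. \<alpha> [e] *\<^sub>C \<kappa> e)"
        by (rule linear_on_sum[OF subspace_grade hom_spaceD(1)[OF u] E(2), symmetric])
      also have "\<dots> = u \<alpha>" using E(4)[OF \<alpha>, symmetric] by (rule arg_cong)
      finally show "CE_eval br (?h u) \<alpha> = u \<alpha>" .
    qed
  qed
qed

lemma bij_betw_CE_eval: "bij_betw (CE_eval br) UNIV A1"
proof -
  obtain h where h: "h \<in> hom_space A1" "\<And>x. h (CE_eval br x) = x" "\<And>u. u \<in> A1 \<Longrightarrow> CE_eval br (h u) = u"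
    by (rule CE_eval_inverse) blast
  show ?thesis by (rule bij_betw_byWitness[where f' = h]) (auto simp: h(2,3) CE_eval_dual)
qed

lemma bij_betw_compose_CE_eval:
  "bij_betw (\<lambda>g. g \<circ> CE_eval br) (hom_space A1) (hom_space UNIV :: ('f \<Rightarrow> 'g::complex_vector) set)"
proof -
  obtain h where h: "h \<in> hom_space A1" "\<And>x. h (CE_eval br x) = x" "\<And>u. u \<in> A1 \<Longrightarrow> CE_eval br (h u) = u"
    by (rule CE_eval_inverse) blast
  let ?inv = "\<lambda>(k :: 'f \<Rightarrow> 'g) u. if u \<in> A1 then k (h u) else 0"
  show ?thesis
  proof (rule bij_betw_byWitness[where f' = ?inv])
    show "\<forall>g\<in>hom_space A1. ?inv (g \<circ> CE_eval br) = g"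
      by (auto simp: fun_eq_iff h(3) dest: hom_spaceD(2))
    show "\<forall>k\<in>hom_space UNIV. ?inv k \<circ> CE_eval br = k"
      by (simp add: fun_eq_iff h(2) CE_eval_dual)
    show "(\<lambda>g. g \<circ> CE_eval br) ` hom_space A1 \<subseteq> (hom_space UNIV :: ('f \<Rightarrow> 'g) set)"
      using CE_eval_linear CE_eval_dual by (auto simp: hom_space_def[of UNIV] hom_space_def[of "dual_space _"] linear_on_def)
    show "?inv ` hom_space UNIV \<subseteq> hom_space A1"
      using linear_onD[OF hom_spaceD(1)[OF h(1)]]
      by (auto simp: hom_space_def[of UNIV] hom_space_def[of "dual_space _"] linear_on_def
          cvs.subspace_add[OF csubspace_hom_space] cvs.subspace_scale[OF csubspace_hom_space])
  qed
qed

lemma bij_betw_CE_flat: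
  fixes brg :: "'g::complex_vector \<Rightarrow> 'g \<Rightarrow> 'g"
  assumes g: "lie_bracket brg" "fin_dim (UNIV :: 'g set)"
  shows "bij_betw (\<lambda>\<omega>. psi C \<omega> \<circ> CE_eval br) (flat_connections C brg) (Hom_Lie (lie_of br) brg)"
proof -
  let ?T = "tensor_space (grade C 1) :: ('f list \<Rightarrow> complex, 'g) tensor set"
  let ?\<psi> = "\<lambda>\<omega>. psi C \<omega> \<circ> CE_eval br"
  have bij: "bij_betw ?\<psi> ?T (hom_space UNIV :: ('f \<Rightarrow> 'g) set)"
    using bij_betw_trans[OF bij_betw_psi[OF fin_dim_grade_1 g(2)] bij_betw_compose_CE_eval]
    by (simp add: comp_def)
  have sub: "flat_connections C brg \<subseteq> ?T" by (auto simp: flat_connections_def)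
  have hom: "Hom_Lie (lie_of br) brg = {\<rho> \<in> hom_space UNIV. \<forall>x y. \<rho> (br x y) = brg (\<rho> x) (\<rho> y)}"
    by (auto simp: Hom_Lie_def lie_hom_def lie_of_def hom_space_def linear_on_def)
  have flat: "\<omega> \<in> flat_connections C brg \<longleftrightarrow> ?\<psi> \<omega> \<in> Hom_Lie (lie_of br) brg" if \<omega>: "\<omega> \<in> ?T" for \<omega>
    using CE_flat_iff[OF g \<omega>] bij_betw_apply[OF bij \<omega>] by (simp add: hom psi_CE_eval[OF \<omega>])
  have "?\<psi> ` flat_connections C brg = Hom_Lie (lie_of br) brg"
  proof (intro equalityI subsetI)
    fix \<rho> assume \<rho>: "\<rho> \<in> Hom_Lie (lie_of br) brg"
    then have "\<rho> \<in> hom_space UNIV" by (simp add: hom)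
    then obtain \<omega> where "\<omega> \<in> ?T" "\<rho> = ?\<psi> \<omega>" using bij_betw_imp_surj_on[OF bij] by blast
    then show "\<rho> \<in> ?\<psi> ` flat_connections C brg" using flat \<rho> by blast
  qed (use flat sub in blast)
  then show ?thesis using bij_betw_subset[OF bij sub] by simp
qed

text \<open>By flatness \<open>\<omega>\<close> corresponds to a homomorphism \<open>\<rho>\<close>, and the twisted complex of
  \<open>\<omega>\<close> is isomorphic to the Chevalley-Eilenberg complex of the module given by \<open>\<rho>\<close>, in every
  degree.\<close>

lemma bij_betw_CE_resonance:
  fixes brg :: "'g::complex_vector \<Rightarrow> 'g \<Rightarrow> 'g" and \<theta> :: "'g \<Rightarrow> 'v::complex_vector \<Rightarrow> 'v"
  assumes g: "lie_bracket brg" "fin_dim (UNIV :: 'g set)"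
    and V: "representation brg \<theta>" "fin_dim (UNIV :: 'v set)"
  shows "bij_betw (\<lambda>\<omega>. psi C \<omega> \<circ> CE_eval br) (resonance_cdga C brg \<theta> i r) (resonance_lie (lie_of br) brg \<theta> i r)"
proof -
  let ?\<psi> = "\<lambda>\<omega>. psi C \<omega> \<circ> CE_eval br"
  note bij = bij_betw_CE_flat[OF g]
  have dim: "cohomology_dim (\<lambda>j. tensor_space (grade C j)) (twisted_diff C \<theta> \<omega>) i =
      cohomology_dim (ce_cochains (lie_of br)) (ce_diff (lie_of br) (\<lambda>x. \<theta> (?\<psi> \<omega> x))) i"
    if "\<omega> \<in> flat_connections C brg" for \<omega>
  proof -
    have \<omega>: "\<omega> \<in> tensor_space (grade C 1)" using that by (simp add: flat_connections_def)
    show ?thesis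
      using CE_cohomology[OF V(2) representation_bilinear[OF V(1)] \<omega>] by (simp add: psi_CE_eval[OF \<omega>])
  qed
  have "?\<psi> ` resonance_cdga C brg \<theta> i r = resonance_lie (lie_of br) brg \<theta> i r"
  proof (intro equalityI subsetI)
    fix \<rho> assume "\<rho> \<in> resonance_lie (lie_of br) brg \<theta> i r"
    then have \<rho>: "\<rho> \<in> Hom_Lie (lie_of br) brg"
      "enat r \<le> cohomology_dim (ce_cochains (lie_of br)) (ce_diff (lie_of br) (\<lambda>x. \<theta> (\<rho> x))) i"
      by (auto simp: resonance_lie_def)
    then obtain \<omega> where "\<omega> \<in> flat_connections C brg" "\<rho> = ?\<psi> \<omega>"
      using bij_betw_imp_surj_on[OF bij] by blast
    then show "\<rho> \<in> ?\<psi> ` resonance_cdga C brg \<theta> i r"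
      using \<rho>(2) dim by (auto simp: resonance_cdga_def)
  next
    fix \<rho> assume "\<rho> \<in> ?\<psi> ` resonance_cdga C brg \<theta> i r"
    then obtain \<omega> where \<omega>: "\<omega> \<in> flat_connections C brg" "\<rho> = ?\<psi> \<omega>"
      "enat r \<le> cohomology_dim (\<lambda>j. tensor_space (grade C j)) (twisted_diff C \<theta> \<omega>) i"
      by (auto simp: resonance_cdga_def)
    then show "\<rho> \<in> resonance_lie (lie_of br) brg \<theta> i r"
      using dim[OF \<omega>(1)] bij_betw_apply[OF bij \<omega>(1)] by (simp add: resonance_lie_def)
  qed
  moreover have "resonance_cdga C brg \<theta> i r \<subseteq> flat_connections C brg" by (auto simp: resonance_cdga_def)
  ultimately show ?thesis using bij_betw_subset[OF bij] by blast
qed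

text \<open>The inverse \<open>h\<close> of evaluation corresponds to the canonical connection, whose form is the
  identity of \<open>\<ff>\<close> and which is flat. So \<open>h\<close> extends to the holonomy Lie algebra. The extension
  is inverse to \<open>holonomy_section\<close>: on one side by construction, on the other side because the image of the
  latter is a subalgebra that contains the generators.\<close>

lemma holonomy_CE_iso:
  obtains \<Phi> where "lie_iso (holonomy C) (lie_of br) \<Phi>" "\<And>x. \<Phi> (holonomy_section x) = x"
proof -
  obtain h where h: "h \<in> hom_space A1" "\<And>x. h (CE_eval br x) = x" "\<And>u. u \<in> A1 \<Longrightarrow> CE_eval br (h u) = u"
    by (rule CE_eval_inverse) blast
  obtain \<omega> where \<omega>: "\<omega> \<in> tensor_space (grade C 1)" "h = psi C \<omega>"
    using h(1) bij_betw_imp_surj_on[OF bij_betw_psi[OF fin_dim_grade_1 fin]] by blast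
  have "vector_form \<omega> [x] = x" for x
    using psi_CE_eval[OF \<omega>(1), of x] h(2)[of x] \<omega>(2) by simp
  then have "\<omega> \<in> flat_connections C br" by (simp add: CE_flat_iff[OF f fin \<omega>(1)])
  then have "satisfies_relators C br h"
    using flat_iff[OF fin_dim_grade_1 fin f \<omega>(1)] \<omega>(2) by simp
  then obtain \<Phi> where \<Phi>: "\<Phi> \<in> Hom_Lie (holonomy C) br" "\<And>u. u \<in> A1 \<Longrightarrow> \<Phi> (holonomy_gen C u) = h u"
    using holonomy_universal[OF f h(1)] by blast
  have sec: "\<Phi> (holonomy_section x) = x" for x using \<Phi>(2)[OF CE_eval_dual] h(2) by simp
  have sections: "add (holonomy C) (holonomy_section x) (holonomy_section y) = holonomy_section (x + y)"
    "smult (holonomy C) c (holonomy_section x) = holonomy_section (c *\<^sub>C x)"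
    "bracket (holonomy C) (holonomy_section x) (holonomy_section y) = holonomy_section (br x y)" for x y c
    using holonomy_section_hom by (simp_all add: lie_hom_def lie_of_def)
  have surj: "\<exists>x. X = holonomy_section x" if "X \<in> carrier (holonomy C)" for X
    using that
  proof (rule holonomy_induct)
    show "\<exists>x. holonomy_gen C u = holonomy_section x" if "u \<in> A1" for u
      by (rule exI[of _ "h u"]) (simp add: h(3) that)
  qed (auto simp: sections)
  have "bij_betw \<Phi> (carrier (holonomy C)) (carrier (lie_of br))"
  proof (rule bij_betw_byWitness[where f' = holonomy_section])
    show "\<forall>X\<in>carrier (holonomy C). holonomy_section (\<Phi> X) = X" using surj sec by fastforce
    show "holonomy_section ` carrier (lie_of br) \<subseteq> carrier (holonomy C)"
      using holonomy_gen_carrier[OF CE_eval_dual] by blast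
  qed (simp_all add: sec lie_of_def)
  then have "lie_iso (holonomy C) (lie_of br) \<Phi>"
    using \<Phi>(1) by (simp add: lie_iso_def Hom_Lie_def)
  then show ?thesis using sec that by blast
qed

end

end

theorem theorem1p3:
  fixes A :: "'a::complex_vector cdga"
    and brg :: "'g::complex_vector \<Rightarrow> 'g \<Rightarrow> 'g"
    and \<theta> :: "'g \<Rightarrow> 'v::complex_vector \<Rightarrow> 'v"
    and brf :: "'f::complex_vector \<Rightarrow> 'f \<Rightarrow> 'f"
  assumes g: "lie_bracket brg" "fin_dim (UNIV :: 'g set)"
    and V: "representation brg \<theta>" "fin_dim (UNIV :: 'v set)"
  shows
    "(connected_cdga A \<and> fin_dim (grade A 1) \<longrightarrow>
        psi A \<in> hom_space (tensor_space (grade A 1) :: ('a, 'g) tensor set) \<and>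
        bij_betw (psi A) (tensor_space (grade A 1) :: ('a, 'g) tensor set)
          (hom_space (dual_space (grade A 1))) \<and>
        inj_on (restrict_gen A) (Hom_Lie (holonomy A) brg) \<and>
        bij_betw (psi A) (flat_connections A brg)
          (restrict_gen A ` Hom_Lie (holonomy A) brg) \<and>
        (\<forall>i r. i \<le> 1 \<longrightarrow>
          bij_betw (psi A) (resonance_cdga A brg \<theta> i r)
            (restrict_gen A ` resonance_lie (holonomy A) brg \<theta> i r)))
     \<and>
     (lie_bracket brf \<and> fin_dim (UNIV :: 'f set) \<longrightarrow>
        CE_eval brf \<in> hom_space UNIV \<and>
        bij_betw (CE_eval brf) UNIV (dual_space (grade (CE_algebra brf) 1)) \<and>
        (\<exists>\<Phi>. lie_iso (holonomy (CE_algebra brf)) (lie_of brf) \<Phi> \<and>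
          (\<forall>x. \<Phi> (holonomy_gen (CE_algebra brf) (CE_eval brf x)) = x)) \<and>
        (\<forall>i r.
          bij_betw (\<lambda>\<omega>. psi (CE_algebra brf) \<omega> \<circ> CE_eval brf)
            (resonance_cdga (CE_algebra brf) brg \<theta> i r)
            (resonance_lie (lie_of brf) brg \<theta> i r)))"
proof (rule conjI; rule impI; elim conjE)
  assume A: "connected_cdga A" and fin: "fin_dim (grade A 1)"
  interpret connected_cdga A by (rule A)
  show "psi A \<in> hom_space (tensor_space (grade A 1) :: ('a, 'g) tensor set) \<and>
        bij_betw (psi A) (tensor_space (grade A 1) :: ('a, 'g) tensor set)
          (hom_space (dual_space (grade A 1))) \<and>
        inj_on (restrict_gen A) (Hom_Lie (holonomy A) brg) \<and>
        bij_betw (psi A) (flat_connections A brg)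
          (restrict_gen A ` Hom_Lie (holonomy A) brg) \<and>
        (\<forall>i r. i \<le> 1 \<longrightarrow>
          bij_betw (psi A) (resonance_cdga A brg \<theta> i r)
            (restrict_gen A ` resonance_lie (holonomy A) brg \<theta> i r))"
    using psi_in_hom_space_tensor bij_betw_psi[OF fin g(2)] inj_on_restrict_gen
      bij_betw_flat[OF fin g] bij_betw_resonance[OF fin g V] by blast
next
  assume f: "lie_bracket brf" "fin_dim (UNIV :: 'f set)"
  have "CE_eval brf \<in> hom_space UNIV"
    using CE_eval_linear[OF f(1)] by (simp add: hom_space_def)
  moreover have "\<exists>\<Phi>. lie_iso (holonomy (CE_algebra brf)) (lie_of brf) \<Phi> \<and>
      (\<forall>x. \<Phi> (holonomy_gen (CE_algebra brf) (CE_eval brf x)) = x)"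
    by (rule holonomy_CE_iso[OF f]) blast
  ultimately show "CE_eval brf \<in> hom_space UNIV \<and>
        bij_betw (CE_eval brf) UNIV (dual_space (grade (CE_algebra brf) 1)) \<and>
        (\<exists>\<Phi>. lie_iso (holonomy (CE_algebra brf)) (lie_of brf) \<Phi> \<and>
          (\<forall>x. \<Phi> (holonomy_gen (CE_algebra brf) (CE_eval brf x)) = x)) \<and>
        (\<forall>i r.
          bij_betw (\<lambda>\<omega>. psi (CE_algebra brf) \<omega> \<circ> CE_eval brf)
            (resonance_cdga (CE_algebra brf) brg \<theta> i r)
            (resonance_lie (lie_of brf) brg \<theta> i r))"
    using bij_betw_CE_eval[OF f] bij_betw_CE_resonance[OF f g V] by blast
qed

end
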